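(* Let the sequence $(\omega^k)_{k\ge 1}$ be generated by the successive point insertion algorithm described in the context, with step sizes $s^k$ chosen by the quasi-Armijo-Goldstein condition with parameters $\gamma\in(0,1)$ and $\alpha\in(0,1/2]$. Then $(\omega^k)$ has at least one weak* accumulation point $\bar\omega_\beta$, and every such point is an optimal solution of $(P_\beta)$, i.e. a minimizer of $F$ over $M^+(\Omega_o)$. Additionally, for all $k\ge 1$, $$ r_F(\omega^k)\le \frac{r_F(\omega^1)}{1+q(k-1)},\qquad q=\alpha\min\left\{\frac{c_1}{L_{\omega^1}(M_0+c_2)^2},\,1\right\}, $$ where $L_{\omega^1}>0$ is a Lipschitz constant of $\psi'$ on $E_{\omega^1}$ (with respect to $\|\cdot\|_{M(\Omega_o)}$ and $\|\cdot\|_{C(\Omega_o)}$), $M_0=F(\omega^1)/\beta$, $c_1=2\gamma(1-\alpha)r_F(\omega^1)$, and $c_2>0$ is a constant with $\|v^k\|_{M(\Omega_o)}\le c_2$ for all $k$ (such a constant exists).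
   Context: Setting. Let $n\in\mathbb N$, $\Omega\subset\mathbb R^d$ a bounded domain, $\Omega_o\subset\bar\Omega$ nonempty and closed (hence compact). $C(\Omega_o)$ carries the supremum norm; $M(\Omega_o)=C(\Omega_o)^*$ is the space of regular signed Borel measures with duality pairing $\langle\cdot,\cdot\rangle$ and total variation norm $\|\cdot\|_{M(\Omega_o)}$; $M^+(\Omega_o)$ is the cone of positive measures; $\#\operatorname{supp}\omega$ is the cardinality of the support. $\operatorname{Sym}(n)$, $\operatorname{NND}(n)$, $\operatorname{PD}(n)$ are the symmetric, symmetric positive semidefinite, and symmetric positive definite real $n\times n$ matrices; $\operatorname{Sym}(n)$ has inner product $\operatorname{Tr}(AB^\top)$ (Frobenius norm); $A\le_L B$ means $B-A\in\operatorname{NND}(n)$. Let $Q_{ad}\subset\mathbb R^n$ and let $S$ (the parameter-to-state map) be a map with values in $C(\Omega_o)$, continuously differentiable in a neighborhood of $Q_{ad}$; fix $\hat q\in Q_{ad}$ and let $\partial S[\hat q]=(\partial_1S[\hat q],\dots,\partial_nS[\hat q])^\top\in C(\Omega_o,\mathbb R^n)$ be its partial derivatives at $\hat q$. Define $\mathcal I:M(\Omega_o)\to\operatorname{Sym}(n)$ by $\mathcal I(\omega)_{kl}=\langle\partial_kS[\hat q]\,\partial_lS[\hat q],\omega\rangle$. Fix $\mathcal I_0\in\operatorname{NND}(n)$ and $\beta>0$. Let $\Psi:\operatorname{Sym}(n)\to\mathbb R\cup\{+\infty\}$ satisfy: (A1) $\{\Psi<\infty\}=\operatorname{PD}(n)$;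 (A2) $\Psi$ is continuously differentiable on $\operatorname{PD}(n)$; (A3) $\Psi\ge0$ on $\operatorname{NND}(n)$; (A4) $\Psi$ is lower semicontinuous and convex on $\operatorname{NND}(n)$; (A5) $N_1\le_LN_2\Rightarrow\Psi(N_1)\ge\Psi(N_2)$ for $N_1,N_2\in\operatorname{NND}(n)$. Assume moreover that $\Psi'$ is Lipschitz continuous on every compact subset of $\operatorname{PD}(n)$. Put $\psi(\omega)=\Psi(\mathcal I(\omega)+\mathcal I_0)$, $\operatorname{dom}_{M^+(\Omega_o)}\psi=\{\omega\in M^+(\Omega_o):\psi(\omega)<\infty\}$, $F(\omega)=\psi(\omega)+\beta\|\omega\|_{M(\Omega_o)}$. Problem $(P_\beta)$: minimize $F$ over $M^+(\Omega_o)$. For $\omega\in\operatorname{dom}_{M^+(\Omega_o)}\psi$ the derivative $\psi'(\omega)$ is identified with the continuous function $\psi'(\omega)(x)=\partial S[\hat q](x)^\top\Psi'(\mathcal I(\omega)+\mathcal I_0)\,\partial S[\hat q](x)$. Set $r_F(\omega)=F(\omega)-\min_{M^+(\Omega_o)}F$ and $E_{\omega^1}=\{\omega\in M^+(\Omega_o):F(\omega)\le F(\omega^1)\}$. Algorithm. Choose $\omega^1\in\operatorname{dom}_{M^+(\Omega_o)}\psi$ with $\#\operatorname{supp}\omega^1\le n(n+1)/2$ and set $M_0=F(\omega^1)/\beta>0$. Let $\varphi_{M_0}(t)=t$ for $0\le t\le M_0$ and $\varphi_{M_0}(t)=\frac1{2M_0}(t^2+M_0^2)$ for $t>M_0$;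 $F_{M_0}(\omega)=\psi(\omega)+\beta\varphi_{M_0}(\|\omega\|_{M(\Omega_o)})$; and $$\Phi(\omega)=\sup_{v\in M^+(\Omega_o)}\big[\langle\psi'(\omega),\omega-v\rangle+\beta\|\omega\|_{M(\Omega_o)}-\beta\varphi_{M_0}(\|v\|_{M(\Omega_o)})\big].$$ For $k=1,2,\dots$, as long as $\Phi(\omega^k)>0$ (if $\Phi(\omega^k)=0$ the algorithm stops and the sequence is continued constantly): choose $\hat x^k\in\arg\min_{x\in\Omega_o}\psi'(\omega^k)(x)$; set $v^k=\theta^k\delta_{\hat x^k}$ with $\theta^k=0$ if $\psi'(\omega^k)(\hat x^k)\ge-\beta$ and $\theta^k=-(M_0/\beta)\psi'(\omega^k)(\hat x^k)$ otherwise; set $s^k=\gamma^{n_k}$ with $n_k$ the smallest non-negative integer such that (quasi-Armijo-Goldstein condition) $$\alpha s^k\Phi(\omega^k)\le F_{M_0}(\omega^k)-F_{M_0}(\omega^k+s^k(v^k-\omega^k));$$ set $\omega^{k+1/2}=(1-s^k)\omega^k+s^kv^k$; choose any $\omega^{k+1}\in M^+(\Omega_o)$ with $\operatorname{supp}\omega^{k+1}\subseteq\operatorname{supp}\omega^{k+1/2}$ and $F(\omega^{k+1})\le F(\omega^{k+1/2})$. *)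

theory Defs
  imports "HOL-Analysis.Analysis"
begin

section \<open>Signed measures on a set\<close>

text \<open>
  The elements of \<open>M(X)\<close> are real-valued, countably additive set functions on the Borel sets of
  \<open>X\<close>. They are normalised to be 0 on all other sets, so that equality of functions is equality of
  measures, and the linear structure is the pointwise one. Regularity is not imposed: on a compact
  subset \<open>X\<close> of Euclidean space every finite Borel measure is regular.
\<close>

abbreviation borel_sets :: "'a::topological_space set \<Rightarrow> 'a set set" where
  "borel_sets X \<equiv> sets (restrict_space borel X)"

definition signed_measures :: "'a::topological_space set \<Rightarrow> ('a set \<Rightarrow> real) set" where
  "signed_measures X =
    {\<mu>. (\<forall>A. A \<notin> borel_sets X \<longrightarrow> \<mu> A = 0) \<and>
        (\<forall>A :: nat \<Rightarrow> 'a set. range A \<subseteq> borel_sets X \<longrightarrow> disjoint_family A \<longrightarrow>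
           (\<lambda>i. \<mu> (A i)) sums \<mu> (\<Union>i. A i))}"

definition pos_measures :: "'a::topological_space set \<Rightarrow> ('a set \<Rightarrow> real) set" where
  "pos_measures X = {\<mu> \<in> signed_measures X. \<forall>A. 0 \<le> \<mu> A}"

definition variation :: "'a::topological_space set \<Rightarrow> ('a set \<Rightarrow> real) \<Rightarrow> 'a set \<Rightarrow> real" where
  "variation X \<mu> A =
    (SUP P \<in> {P. finite P \<and> disjoint P \<and> P \<subseteq> borel_sets X \<and> \<Union>P = A}. \<Sum>B\<in>P. \<bar>\<mu> B\<bar>)"

definition tv_norm :: "'a::topological_space set \<Rightarrow> ('a set \<Rightarrow> real) \<Rightarrow> real" where
  "tv_norm X \<mu> = variation X \<mu> X"

text \<open>The Jordan decomposition \<open>\<mu> = \<mu>\<^sup>+ - \<mu>\<^sup>-\<close> with \<open>\<mu>\<^sup>\<plusminus> = (\<bar>\<mu>\<bar> \<plusminus> \<mu>) / 2\<close>, as library measures.\<close>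

definition pos_part :: "'a::topological_space set \<Rightarrow> ('a set \<Rightarrow> real) \<Rightarrow> 'a measure" where
  "pos_part X \<mu> = measure_of X (borel_sets X) (\<lambda>A. ennreal ((variation X \<mu> A + \<mu> A) / 2))"

definition neg_part :: "'a::topological_space set \<Rightarrow> ('a set \<Rightarrow> real) \<Rightarrow> 'a measure" where
  "neg_part X \<mu> = measure_of X (borel_sets X) (\<lambda>A. ennreal ((variation X \<mu> A - \<mu> A) / 2))"

text \<open>The duality pairing of \<open>f \<in> C(X)\<close> and \<open>\<mu> \<in> M(X)\<close>.\<close>

definition pairing :: "'a::topological_space set \<Rightarrow> ('a \<Rightarrow> real) \<Rightarrow> ('a set \<Rightarrow> real) \<Rightarrow> real" where
  "pairing X f \<mu> = (\<integral>x. f x \<partial>pos_part X \<mu>) - (\<integral>x. f x \<partial>neg_part X \<mu>)"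

definition supp :: "'a::topological_space set \<Rightarrow> ('a set \<Rightarrow> real) \<Rightarrow> 'a set" where
  "supp X \<mu> = {x \<in> X. \<forall>U. open U \<and> x \<in> U \<longrightarrow> 0 < variation X \<mu> (U \<inter> X)}"

definition dirac :: "'a::topological_space set \<Rightarrow> 'a \<Rightarrow> 'a set \<Rightarrow> real" where
  "dirac X x A = (if A \<in> borel_sets X \<and> x \<in> A then 1 else 0)"

definition weak_star :: "'a::topological_space set \<Rightarrow> ('a set \<Rightarrow> real) topology" where
  "weak_star X = topology_generated_by
     {{\<mu> \<in> signed_measures X. pairing X f \<mu> \<in> U} | f U. continuous_on X f \<and> open U}"

text \<open>Accumulation points of a sequence indexed from 1 (terms counted with multiplicity, so that an
  eventually constant sequence accumulates at its final value).\<close>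

definition weak_star_accumulation_point ::
    "'a::topological_space set \<Rightarrow> (nat \<Rightarrow> 'a set \<Rightarrow> real) \<Rightarrow> ('a set \<Rightarrow> real) \<Rightarrow> bool" where
  "weak_star_accumulation_point X \<omega> \<mu> \<longleftrightarrow>
     \<mu> \<in> signed_measures X \<and>
     (\<forall>V. openin (weak_star X) V \<and> \<mu> \<in> V \<longrightarrow> infinite {k. 1 \<le> k \<and> \<omega> k \<in> V})"

text \<open>The supremum norm on \<open>C(X)\<close> for compact \<open>X\<close>.\<close>

definition sup_norm :: "'a set \<Rightarrow> ('a \<Rightarrow> real) \<Rightarrow> real" where
  "sup_norm X f = (SUP x\<in>X. \<bar>f x\<bar>)"

section \<open>Symmetric matrices\<close>

text \<open>On \<open>real^'n^'n\<close> the library's inner product is \<open>A \<bullet> B = (\<Sum>i j. A$i$j * B$i$j) = Tr(A B\<^sup>T)\<close>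
  and its norm is the Frobenius norm.\<close>

definition Sym :: "(real^'n^'n) set" where
  "Sym = {A. transpose A = A}"

definition NND :: "(real^'n^'n) set" where
  "NND = {A \<in> Sym. \<forall>x. 0 \<le> x \<bullet> (A *v x)}"

definition PD :: "(real^'n^'n) set" where
  "PD = {A \<in> Sym. \<forall>x. x \<noteq> 0 \<longrightarrow> 0 < x \<bullet> (A *v x)}"

definition loewner_le :: "real^'n^'n \<Rightarrow> real^'n^'n \<Rightarrow> bool" where
  "loewner_le A B \<longleftrightarrow> B - A \<in> NND"

definition lsc_on :: "'a::topological_space set \<Rightarrow> ('a \<Rightarrow> ereal) \<Rightarrow> bool" where
  "lsc_on K f \<longleftrightarrow> (\<forall>x\<in>K. \<forall>c. c < f x \<longrightarrow> (\<forall>\<^sub>F y in at x within K. c < f y))"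

definition ereal_convex_on :: "'a::real_vector set \<Rightarrow> ('a \<Rightarrow> ereal) \<Rightarrow> bool" where
  "ereal_convex_on K f \<longleftrightarrow> convex K \<and>
     (\<forall>x\<in>K. \<forall>y\<in>K. \<forall>t\<in>{0<..<1::real}.
        f ((1 - t) *\<^sub>R x + t *\<^sub>R y) \<le> ereal (1 - t) * f x + ereal t * f y)"

text \<open>\<open>\<Psi>'\<close> is the Frobenius gradient of \<open>\<Psi>\<close>, an element of the space of symmetric matrices. The set
  \<open>PD\<close> is open in \<open>Sym\<close>, so a derivative within \<open>PD\<close> is a derivative on the space \<open>Sym\<close>.\<close>

definition C1_on_PD :: "(real^'n^'n \<Rightarrow> ereal) \<Rightarrow> (real^'n^'n \<Rightarrow> real^'n^'n) \<Rightarrow> bool" where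
  "C1_on_PD \<Psi> \<Psi>' \<longleftrightarrow>
     (\<forall>N\<in>PD. \<Psi>' N \<in> Sym \<and>
        ((\<lambda>A. real_of_ereal (\<Psi> A)) has_derivative (\<lambda>H. \<Psi>' N \<bullet> H)) (at N within PD)) \<and>
     continuous_on PD \<Psi>'"

section \<open>The parameter-to-state map\<close>

text \<open>\<open>q \<mapsto> S q\<close> is a continuously differentiable map from the open set \<open>U\<close> into the Banach space
  \<open>C(X)\<close>, \<open>X\<close> compact, and \<open>dS q x\<close> is the vector of the values at \<open>x\<close> of its partial derivatives at
  \<open>q\<close>. Convergence in \<open>C(X)\<close> is uniform convergence on \<open>X\<close>: the third conjunct is Frechet
  differentiability in the supremum norm, the last is continuity of the partial derivatives
  as maps from \<open>U\<close> to \<open>C(X)\<close>.\<close>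

definition C1_state_map ::
    "(real^'n) set \<Rightarrow> 'a::topological_space set \<Rightarrow> (real^'n \<Rightarrow> 'a \<Rightarrow> real) \<Rightarrow>
     (real^'n \<Rightarrow> 'a \<Rightarrow> real^'n) \<Rightarrow> bool" where
  "C1_state_map U X S dS \<longleftrightarrow>
     (\<forall>q\<in>U. continuous_on X (S q) \<and> continuous_on X (dS q) \<and>
        uniform_limit X (\<lambda>h x. (S (q + h) x - S q x - dS q x \<bullet> h) / norm h) (\<lambda>x. 0) (at 0) \<and>
        uniform_limit X dS (dS q) (at q))"

section \<open>The optimisation problem\<close>

text \<open>In the following \<open>D\<close> stands for the vector of partial derivatives of \<open>S\<close> at the fixed
  parameter.\<close>

definition fisher :: "'a::topological_space set \<Rightarrow> ('a \<Rightarrow> real^'n) \<Rightarrow> ('a set \<Rightarrow> real) \<Rightarrow> real^'n^'n" where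
  "fisher X D \<omega> = (\<chi> k l. pairing X (\<lambda>x. D x $ k * D x $ l) \<omega>)"

definition psi ::
    "'a::topological_space set \<Rightarrow> ('a \<Rightarrow> real^'n) \<Rightarrow> real^'n^'n \<Rightarrow> (real^'n^'n \<Rightarrow> ereal) \<Rightarrow>
     ('a set \<Rightarrow> real) \<Rightarrow> ereal" where
  "psi X D I0 \<Psi> \<omega> = \<Psi> (fisher X D \<omega> + I0)"

definition dom_psi ::
    "'a::topological_space set \<Rightarrow> ('a \<Rightarrow> real^'n) \<Rightarrow> real^'n^'n \<Rightarrow> (real^'n^'n \<Rightarrow> ereal) \<Rightarrow>
     ('a set \<Rightarrow> real) set" where
  "dom_psi X D I0 \<Psi> = {\<omega> \<in> pos_measures X. psi X D I0 \<Psi> \<omega> < \<infinity>}"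

definition dpsi ::
    "'a::topological_space set \<Rightarrow> ('a \<Rightarrow> real^'n) \<Rightarrow> real^'n^'n \<Rightarrow> (real^'n^'n \<Rightarrow> real^'n^'n) \<Rightarrow>
     ('a set \<Rightarrow> real) \<Rightarrow> 'a \<Rightarrow> real" where
  "dpsi X D I0 \<Psi>' \<omega> x = D x \<bullet> (\<Psi>' (fisher X D \<omega> + I0) *v D x)"

definition obj ::
    "'a::topological_space set \<Rightarrow> ('a \<Rightarrow> real^'n) \<Rightarrow> real^'n^'n \<Rightarrow> (real^'n^'n \<Rightarrow> ereal) \<Rightarrow> real \<Rightarrow>
     ('a set \<Rightarrow> real) \<Rightarrow> ereal" where
  "obj X D I0 \<Psi> \<beta> \<omega> = psi X D I0 \<Psi> \<omega> + ereal (\<beta> * tv_norm X \<omega>)"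

text \<open>\<open>r\<^sub>F\<close>; the infimum is attained whenever the problem has a feasible point of finite value.\<close>

definition residual ::
    "'a::topological_space set \<Rightarrow> ('a \<Rightarrow> real^'n) \<Rightarrow> real^'n^'n \<Rightarrow> (real^'n^'n \<Rightarrow> ereal) \<Rightarrow> real \<Rightarrow>
     ('a set \<Rightarrow> real) \<Rightarrow> ereal" where
  "residual X D I0 \<Psi> \<beta> \<omega> = obj X D I0 \<Psi> \<beta> \<omega> - (INF v\<in>pos_measures X. obj X D I0 \<Psi> \<beta> v)"

definition sublevel ::
    "'a::topological_space set \<Rightarrow> ('a \<Rightarrow> real^'n) \<Rightarrow> real^'n^'n \<Rightarrow> (real^'n^'n \<Rightarrow> ereal) \<Rightarrow> real \<Rightarrow>
     ('a set \<Rightarrow> real) \<Rightarrow> ('a set \<Rightarrow> real) set" where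
  "sublevel X D I0 \<Psi> \<beta> \<omega>\<^sub>1 = {\<omega> \<in> pos_measures X. obj X D I0 \<Psi> \<beta> \<omega> \<le> obj X D I0 \<Psi> \<beta> \<omega>\<^sub>1}"

definition lipschitz_const_dpsi ::
    "'a::topological_space set \<Rightarrow> ('a \<Rightarrow> real^'n) \<Rightarrow> real^'n^'n \<Rightarrow> (real^'n^'n \<Rightarrow> real^'n^'n) \<Rightarrow>
     ('a set \<Rightarrow> real) set \<Rightarrow> real \<Rightarrow> bool" where
  "lipschitz_const_dpsi X D I0 \<Psi>' E L \<longleftrightarrow> 0 < L \<and>
     (\<forall>\<mu>\<in>E. \<forall>\<nu>\<in>E. sup_norm X (\<lambda>x. dpsi X D I0 \<Psi>' \<mu> x - dpsi X D I0 \<Psi>' \<nu> x)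
                     \<le> L * tv_norm X (\<lambda>A. \<mu> A - \<nu> A))"

section \<open>The successive point insertion algorithm\<close>

definition phi :: "real \<Rightarrow> real \<Rightarrow> real" where
  "phi M t = (if t \<le> M then t else (t\<^sup>2 + M\<^sup>2) / (2 * M))"

definition obj_M ::
    "'a::topological_space set \<Rightarrow> ('a \<Rightarrow> real^'n) \<Rightarrow> real^'n^'n \<Rightarrow> (real^'n^'n \<Rightarrow> ereal) \<Rightarrow> real \<Rightarrow>
     real \<Rightarrow> ('a set \<Rightarrow> real) \<Rightarrow> ereal" where
  "obj_M X D I0 \<Psi> \<beta> M \<omega> = psi X D I0 \<Psi> \<omega> + ereal (\<beta> * phi M (tv_norm X \<omega>))"

definition gap ::
    "'a::topological_space set \<Rightarrow> ('a \<Rightarrow> real^'n) \<Rightarrow> real^'n^'n \<Rightarrow> (real^'n^'n \<Rightarrow> real^'n^'n) \<Rightarrow> real \<Rightarrow>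
     real \<Rightarrow> ('a set \<Rightarrow> real) \<Rightarrow> ereal" where
  "gap X D I0 \<Psi>' \<beta> M \<omega> =
     (SUP v\<in>pos_measures X.
        ereal (pairing X (dpsi X D I0 \<Psi>' \<omega>) (\<lambda>A. \<omega> A - v A)
               + \<beta> * tv_norm X \<omega> - \<beta> * phi M (tv_norm X v)))"

text \<open>The point measure \<open>v = \<theta> \<delta>\<^sub>y\<close> inserted at \<open>y\<close> when the current iterate is \<open>\<omega>\<close>.\<close>

definition insertion ::
    "'a::topological_space set \<Rightarrow> ('a \<Rightarrow> real^'n) \<Rightarrow> real^'n^'n \<Rightarrow> (real^'n^'n \<Rightarrow> real^'n^'n) \<Rightarrow> real \<Rightarrow>
     real \<Rightarrow> ('a set \<Rightarrow> real) \<Rightarrow> 'a \<Rightarrow> 'a set \<Rightarrow> real" where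
  "insertion X D I0 \<Psi>' \<beta> M \<omega> y =
     (let p = dpsi X D I0 \<Psi>' \<omega> y;
          \<theta> = (if p \<ge> - \<beta> then 0 else - (M / \<beta>) * p)
      in (\<lambda>A. \<theta> * dirac X y A))"

definition move :: "real \<Rightarrow> ('a set \<Rightarrow> real) \<Rightarrow> ('a set \<Rightarrow> real) \<Rightarrow> 'a set \<Rightarrow> real" where
  "move s \<omega> v = (\<lambda>A. (1 - s) * \<omega> A + s * v A)"

definition armijo ::
    "'a::topological_space set \<Rightarrow> ('a \<Rightarrow> real^'n) \<Rightarrow> real^'n^'n \<Rightarrow> (real^'n^'n \<Rightarrow> ereal) \<Rightarrow>
     (real^'n^'n \<Rightarrow> real^'n^'n) \<Rightarrow> real \<Rightarrow> real \<Rightarrow> real \<Rightarrow> ('a set \<Rightarrow> real) \<Rightarrow> ('a set \<Rightarrow> real) \<Rightarrow> real \<Rightarrow> bool" where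
  "armijo X D I0 \<Psi> \<Psi>' \<beta> \<alpha> M \<omega> v s \<longleftrightarrow>
     ereal (\<alpha> * s) * gap X D I0 \<Psi>' \<beta> M \<omega>
       \<le> obj_M X D I0 \<Psi> \<beta> M \<omega> - obj_M X D I0 \<Psi> \<beta> M (move s \<omega> v)"

definition insertion_step ::
    "'a::topological_space set \<Rightarrow> ('a \<Rightarrow> real^'n) \<Rightarrow> real^'n^'n \<Rightarrow> (real^'n^'n \<Rightarrow> ereal) \<Rightarrow>
     (real^'n^'n \<Rightarrow> real^'n^'n) \<Rightarrow> real \<Rightarrow> real \<Rightarrow> real \<Rightarrow> real \<Rightarrow> ('a set \<Rightarrow> real) \<Rightarrow> 'a \<Rightarrow>
     ('a set \<Rightarrow> real) \<Rightarrow> bool" where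
  "insertion_step X D I0 \<Psi> \<Psi>' \<beta> \<gamma> \<alpha> M \<omega> y \<omega>' \<longleftrightarrow>
     is_arg_min (dpsi X D I0 \<Psi>' \<omega>) (\<lambda>x. x \<in> X) y \<and>
     (let v = insertion X D I0 \<Psi>' \<beta> M \<omega> y in
        \<exists>n::nat. armijo X D I0 \<Psi> \<Psi>' \<beta> \<alpha> M \<omega> v (\<gamma> ^ n) \<and>
          (\<forall>m<n. \<not> armijo X D I0 \<Psi> \<Psi>' \<beta> \<alpha> M \<omega> v (\<gamma> ^ m)) \<and>
          \<omega>' \<in> pos_measures X \<and>
          supp X \<omega>' \<subseteq> supp X (move (\<gamma> ^ n) \<omega> v) \<and>
          obj X D I0 \<Psi> \<beta> \<omega>' \<le> obj X D I0 \<Psi> \<beta> (move (\<gamma> ^ n) \<omega> v))"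

definition M_init ::
    "'a::topological_space set \<Rightarrow> ('a \<Rightarrow> real^'n) \<Rightarrow> real^'n^'n \<Rightarrow> (real^'n^'n \<Rightarrow> ereal) \<Rightarrow> real \<Rightarrow>
     ('a set \<Rightarrow> real) \<Rightarrow> real" where
  "M_init X D I0 \<Psi> \<beta> \<omega>\<^sub>1 = real_of_ereal (obj X D I0 \<Psi> \<beta> \<omega>\<^sub>1) / \<beta>"

text \<open>\<open>(\<omega> k)\<close>, \<open>k \<ge> 1\<close>, is generated by the algorithm with insertion points \<open>y k\<close>; \<open>\<omega> 0\<close> and those
  \<open>y k\<close> for which the algorithm has already stopped are irrelevant.\<close>

definition generated ::
    "'a::topological_space set \<Rightarrow> ('a \<Rightarrow> real^'n) \<Rightarrow> real^'n^'n \<Rightarrow> (real^'n^'n \<Rightarrow> ereal) \<Rightarrow>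
     (real^'n^'n \<Rightarrow> real^'n^'n) \<Rightarrow> real \<Rightarrow> real \<Rightarrow> real \<Rightarrow> (nat \<Rightarrow> 'a set \<Rightarrow> real) \<Rightarrow> (nat \<Rightarrow> 'a) \<Rightarrow> bool" where
  "generated X D I0 \<Psi> \<Psi>' \<beta> \<gamma> \<alpha> \<omega> y \<longleftrightarrow>
     \<omega> 1 \<in> dom_psi X D I0 \<Psi> \<and>
     finite (supp X (\<omega> 1)) \<and> card (supp X (\<omega> 1)) \<le> CARD('n) * (CARD('n) + 1) div 2 \<and>
     (let M = M_init X D I0 \<Psi> \<beta> (\<omega> 1) in
        0 < M \<and>
        (\<forall>k\<ge>1.
           (0 < gap X D I0 \<Psi>' \<beta> M (\<omega> k) \<longrightarrow>
              insertion_step X D I0 \<Psi> \<Psi>' \<beta> \<gamma> \<alpha> M (\<omega> k) (y k) (\<omega> (k + 1))) \<and>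
           (gap X D I0 \<Psi>' \<beta> M (\<omega> k) = 0 \<longrightarrow> \<omega> (k + 1) = \<omega> k)))"

text \<open>\<open>c\<^sub>2\<close> bounds the norms of the inserted point measures \<open>v k\<close>, which exist for those \<open>k\<close> at which
  the algorithm has not stopped.\<close>

definition insertion_bound ::
    "'a::topological_space set \<Rightarrow> ('a \<Rightarrow> real^'n) \<Rightarrow> real^'n^'n \<Rightarrow> (real^'n^'n \<Rightarrow> ereal) \<Rightarrow>
     (real^'n^'n \<Rightarrow> real^'n^'n) \<Rightarrow> real \<Rightarrow> (nat \<Rightarrow> 'a set \<Rightarrow> real) \<Rightarrow> (nat \<Rightarrow> 'a) \<Rightarrow> real \<Rightarrow> bool" where
  "insertion_bound X D I0 \<Psi> \<Psi>' \<beta> \<omega> y c\<^sub>2 \<longleftrightarrow> 0 < c\<^sub>2 \<and>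
     (let M = M_init X D I0 \<Psi> \<beta> (\<omega> 1) in
        \<forall>k\<ge>1. 0 < gap X D I0 \<Psi>' \<beta> M (\<omega> k) \<longrightarrow>
          tv_norm X (insertion X D I0 \<Psi>' \<beta> M (\<omega> k) (y k)) \<le> c\<^sub>2)"

end

theory Submission
  imports Defs "HOL-Probability.Helly_Selection"
begin

text \<open>
  The algorithm is a conditional gradient method for the convex objective \<open>F\<close>. The gap \<open>\<Phi>(\<omega>)\<close> is the
  supremum of the linearised decrease over all competitors; it majorises the residual \<open>r\<^sub>F(\<omega>)\<close> by
  convexity (\<open>residual_le_gap\<close>), and it is attained at the inserted point measure, because among
  measures of a given mass the pairing with \<open>\<psi>'(\<omega>)\<close> is least at a minimiser of that function
  (\<open>gap_attained\<close>).

  Along the segment from \<open>\<omega>\<close> to the inserted measure \<open>v\<close> the objective starts with slope at most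
  \<open>-\<Phi>(\<omega>)\<close>, and a Lipschitz constant \<open>L\<close> of \<open>\<psi>'\<close> bounds its curvature by \<open>L \<parallel>v - \<omega>\<parallel>\<^sup>2\<close>. Every step length
  \<open>s \<le> 1\<close> with \<open>L \<parallel>v - \<omega>\<parallel>\<^sup>2 s \<le> 2 (1 - \<alpha>) \<Phi>(\<omega>)\<close> therefore passes the Armijo test. The constant is valid on
  the sublevel set of \<open>F\<close> only, but the segment cannot leave this set before the bounding parabola is back
  at its initial value (\<open>sufficient_decrease\<close>, \<open>armijo_sufficient\<close>). So backtracking accepts a step of
  length at least a constant times the relative residual \<open>\<rho>\<^sub>k = r\<^sub>F(\<omega>\<^sup>k) / r\<^sub>F(\<omega>\<^sup>1)\<close>, capped at 1, whence
  \<open>\<rho>\<^sub>k\<^sub>+\<^sub>1 \<le> \<rho>\<^sub>k - q \<rho>\<^sub>k\<^sup>2\<close> (\<open>residual_decrease\<close>). This recursion has the asserted rate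
  (\<open>sublinear_recursion\<close>). The constants \<open>L\<close> and \<open>c\<^sub>2\<close> exist because the information matrices of the
  sublevel set lie in a compact set of positive definite matrices (\<open>compact_sublevel\<close>).

  The iterates have bounded mass, so a weak-* accumulation point exists by compactness
  (\<open>pos_measures_weak_star_compact\<close>). That theorem is reduced to Helly's selection theorem on the real
  line: a continuous curve through a cube, with a Borel right inverse, lets measures on \<open>X\<close> be moved to
  the line and weak limits back. An accumulation point is a positive measure
  (\<open>weak_star_accumulation_point_pos\<close>). Since \<open>F\<close> depends lower semicontinuously on the mass and on finitely
  many pairings, its value there is at most the limit of \<open>F(\<omega>\<^sup>k)\<close>, which is the infimum by the rate
  (\<open>accumulation_point_optimal\<close>).

  Signed measures are handled through the Hahn and Jordan decompositions: the Jordan parts represent the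
  duality pairing as a difference of two integrals and the norm as a sum of two masses.
\<close>

section \<open>Signed measures and the Jordan decomposition\<close>

lemma space_borel_sets [simp]: "space (restrict_space borel X) = X"
  by (simp add: space_restrict_space)

lemma borel_sets_subset: "A \<in> borel_sets X \<Longrightarrow> A \<subseteq> X"
  using sets.sets_into_space by fastforce

lemma borel_sets_top [simp]: "X \<in> borel_sets X"
  using sets.top[of "restrict_space borel X"] by simp

lemma signed_measure_sums:
  assumes "\<mu> \<in> signed_measures X" "range A \<subseteq> borel_sets X" "disjoint_family A"
  shows "(\<lambda>i. \<mu> (A i)) sums \<mu> (\<Union>i. A i)"
  using assms by (auto simp: signed_measures_def)

lemma signed_measure_outside: "\<mu> \<in> signed_measures X \<Longrightarrow> A \<notin> borel_sets X \<Longrightarrow> \<mu> A = 0"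
  by (auto simp: signed_measures_def)

lemma signed_measure_empty [simp]:
  assumes "\<mu> \<in> signed_measures X" shows "\<mu> {} = 0"
proof -
  have "(\<lambda>i::nat. \<mu> {}) sums \<mu> (\<Union>i::nat. {})"
    by (rule signed_measure_sums[OF assms]) (auto simp: disjoint_family_on_def)
  then have "summable (\<lambda>i::nat. \<mu> {})" by (rule sums_summable)
  then show ?thesis by (simp add: summable_const_iff)
qed

lemma signed_measure_Un:
  assumes \<mu>: "\<mu> \<in> signed_measures X" and A: "A \<in> borel_sets X" and B: "B \<in> borel_sets X"
    and disj: "A \<inter> B = {}"
  shows "\<mu> (A \<union> B) = \<mu> A + \<mu> B"
proof -
  have "(\<lambda>i. \<mu> (binaryset A B i)) sums \<mu> (\<Union>i. binaryset A B i)"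
  proof (rule signed_measure_sums[OF \<mu>])
    show "range (binaryset A B) \<subseteq> borel_sets X" using A B by (auto simp: range_binaryset_eq)
    show "disjoint_family (binaryset A B)"
      using disj by (auto simp: disjoint_family_on_def binaryset_def)
  qed
  moreover have "(\<lambda>i. \<mu> (binaryset A B i)) sums (\<mu> A + \<mu> B)"
    by (rule binaryset_sums) (rule signed_measure_empty[OF \<mu>])
  ultimately show ?thesis by (simp add: sums_iff UN_binaryset_eq)
qed

lemma signed_measure_Diff:
  assumes \<mu>: "\<mu> \<in> signed_measures X" and A: "A \<in> borel_sets X" and B: "B \<in> borel_sets X"
    and sub: "B \<subseteq> A"
  shows "\<mu> (A - B) = \<mu> A - \<mu> B"
  using signed_measure_Un[OF \<mu> B, of "A - B"] A B sub by (auto simp: Un_absorb1)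

lemma signed_measure_Int_Diff:
  assumes \<mu>: "\<mu> \<in> signed_measures X" and A: "A \<in> borel_sets X" and B: "B \<in> borel_sets X"
  shows "\<mu> A = \<mu> (A \<inter> B) + \<mu> (A - B)"
  using signed_measure_Un[OF \<mu>, of "A \<inter> B" "A - B"] A B by (auto simp: Int_Diff_Un Int_Diff_disjoint)

lemma signed_measure_Union:
  assumes \<mu>: "\<mu> \<in> signed_measures X" and P: "finite P" "disjoint P" "P \<subseteq> borel_sets X"
  shows "\<mu> (\<Union>P) = (\<Sum>B\<in>P. \<mu> B)"
  using P
proof (induction P rule: finite_induct)
  case empty then show ?case using \<mu> by simp
next
  case (insert B P)
  have "disjoint P" using insert.prems(1) by (auto simp: disjoint_def)
  moreover have "B \<inter> \<Union>P = {}"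
    using insert.prems(1) insert.hyps(2) by (fastforce simp: disjoint_def)
  moreover have "\<Union>P \<in> borel_sets X"
    using insert.hyps(1) insert.prems(2) by (intro sets.finite_Union) auto
  ultimately show ?case using insert signed_measure_Un[OF \<mu>, of B "\<Union>P"] by simp
qed

lemma signed_measure_incseq:
  assumes \<mu>: "\<mu> \<in> signed_measures X" and A: "range A \<subseteq> borel_sets X" "incseq A"
  shows "(\<lambda>n. \<mu> (A n)) \<longlonglongrightarrow> \<mu> (\<Union>n. A n)"
proof -
  have rng: "range (disjointed A) \<subseteq> borel_sets X"
    using sets.range_disjointed_sets[OF A(1)] .
  have "(\<lambda>i. \<mu> (disjointed A i)) sums \<mu> (\<Union>i. A i)"
    using signed_measure_sums[OF \<mu> rng disjoint_family_disjointed] by (simp add: UN_disjointed_eq)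
  moreover have "(\<Sum>i<Suc n. \<mu> (disjointed A i)) = \<mu> (A n)" for n
  proof (induction n)
    case (Suc n)
    have "\<mu> (disjointed A (Suc n)) = \<mu> (A (Suc n)) - \<mu> (A n)"
      using A by (subst disjointed_mono, simp)
        (intro signed_measure_Diff[OF \<mu>], auto simp: incseq_Suc_iff)
    then show ?case using Suc by simp
  qed simp
  ultimately show ?thesis
    unfolding sums_def by (subst (asm) filterlim_sequentially_Suc[symmetric]) simp
qed

lemma signed_measure_decseq:
  assumes \<mu>: "\<mu> \<in> signed_measures X" and A: "range A \<subseteq> borel_sets X" "decseq A"
  shows "(\<lambda>n. \<mu> (A n)) \<longlonglongrightarrow> \<mu> (\<Inter>n. A n)"
proof -
  have AX: "A n \<subseteq> X" for n using A(1) borel_sets_subset by blast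
  have Int: "(\<Inter>n. A n) \<in> borel_sets X" using A(1) by (intro sets.countable_INT) auto
  have sub: "(\<Inter>n. A n) \<subseteq> X" using AX by blast
  have eq: "(\<Union>n. X - A n) = X - (\<Inter>n. A n)" by auto
  have "(\<lambda>n. \<mu> (X - A n)) \<longlonglongrightarrow> \<mu> (\<Union>n. X - A n)"
    using A by (intro signed_measure_incseq[OF \<mu>])
      (auto simp: incseq_def decseq_def intro!: sets.Diff)
  then have "(\<lambda>n. \<mu> X - \<mu> (A n)) \<longlonglongrightarrow> \<mu> X - \<mu> (\<Inter>n. A n)"
    unfolding eq signed_measure_Diff[OF \<mu> borel_sets_top Int sub]
    using A(1) AX by (simp add: signed_measure_Diff[OF \<mu> borel_sets_top] image_subset_iff)
  from tendsto_diff[OF tendsto_const[of "\<mu> X"] this] show ?thesis by simp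
qed

text \<open>Were \<open>\<mu>\<close> unbounded, a set of very large measure would cut the space into two pieces, both of
  measure at least 1 in absolute value and one of them again with subsets of arbitrarily large measure.
  Cutting that piece again and again produces infinitely many disjoint sets of measure at least 1 in
  absolute value, which contradicts the convergence of the series of their measures.\<close>

lemma signed_measure_bounded:
  assumes \<mu>: "\<mu> \<in> signed_measures X"
  shows "\<exists>C. \<forall>A\<in>borel_sets X. \<bar>\<mu> A\<bar> \<le> C"
proof (rule ccontr)
  define unb where "unb E \<longleftrightarrow> E \<in> borel_sets X \<and> (\<forall>C. \<exists>A\<in>borel_sets X. A \<subseteq> E \<and> C < \<bar>\<mu> A\<bar>)" for E
  assume "\<not> ?thesis"
  then have "unb X" using borel_sets_subset unfolding unb_def by (metis borel_sets_top not_le)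
  have step: "\<exists>E'. unb E' \<and> E' \<subseteq> E \<and> 1 \<le> \<bar>\<mu> (E - E')\<bar>" if E: "unb E" for E
  proof -
    have EB: "E \<in> borel_sets X" using E by (simp add: unb_def)
    obtain A where A: "A \<in> borel_sets X" "A \<subseteq> E" "\<bar>\<mu> E\<bar> + 1 < \<bar>\<mu> A\<bar>"
      using E unfolding unb_def by blast
    have diff: "\<mu> (E - A) = \<mu> E - \<mu> A" by (rule signed_measure_Diff[OF \<mu> EB A(1,2)])
    have EA: "E - A \<in> borel_sets X" using EB A by auto
    have "unb A \<or> unb (E - A)"
    proof (rule ccontr)
      assume "\<not> ?thesis"
      then obtain C D where C: "\<And>B. B \<in> borel_sets X \<Longrightarrow> B \<subseteq> A \<Longrightarrow> \<bar>\<mu> B\<bar> \<le> C"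
        and D: "\<And>B. B \<in> borel_sets X \<Longrightarrow> B \<subseteq> E - A \<Longrightarrow> \<bar>\<mu> B\<bar> \<le> D"
        using A(1) EA unfolding unb_def by (metis not_le)
      obtain B where B: "B \<in> borel_sets X" "B \<subseteq> E" "C + D < \<bar>\<mu> B\<bar>"
        using E unfolding unb_def by blast
      have "\<mu> B = \<mu> (B \<inter> A) + \<mu> (B - A)" by (rule signed_measure_Int_Diff[OF \<mu> B(1) A(1)])
      moreover have "\<bar>\<mu> (B \<inter> A)\<bar> \<le> C" using A B by (intro C) auto
      moreover have "\<bar>\<mu> (B - A)\<bar> \<le> D" using A B by (intro D) auto
      ultimately show False using B(3) by linarith
    qed
    then show ?thesis
    proof
      assume "unb A" then show ?thesis using A diff by (intro exI[of _ A]) auto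
    next
      assume "unb (E - A)"
      moreover have "E - (E - A) = A" using A(2) by auto
      ultimately show ?thesis using A by (intro exI[of _ "E - A"]) auto
    qed
  qed
  obtain E where E: "\<And>n::nat. unb (E n)" "\<And>n. E (Suc n) \<subseteq> E n" "\<And>n. 1 \<le> \<bar>\<mu> (E n - E (Suc n))\<bar>"
    using dependent_nat_choice[of "\<lambda>_. unb" "\<lambda>_ E E'. E' \<subseteq> E \<and> 1 \<le> \<bar>\<mu> (E - E')\<bar>"] \<open>unb X\<close> step by metis
  have dec: "E m \<subseteq> E n" if "n \<le> m" for n m using E(2) that by (rule lift_Suc_antimono_le)
  have "(\<lambda>n. \<mu> (E n - E (Suc n))) sums \<mu> (\<Union>n. E n - E (Suc n))"
  proof (rule signed_measure_sums[OF \<mu>])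
    show "range (\<lambda>n. E n - E (Suc n)) \<subseteq> borel_sets X" using E(1) by (auto simp: unb_def)
    have "(E m - E (Suc m)) \<inter> (E n - E (Suc n)) = {}" if "m < n" for m n
      using dec[of "Suc m" n] that by auto
    then show "disjoint_family (\<lambda>n. E n - E (Suc n))"
      unfolding disjoint_family_on_def by (metis Int_commute linorder_neqE_nat)
  qed
  then have "(\<lambda>n. \<mu> (E n - E (Suc n))) \<longlonglongrightarrow> 0"
    using sums_summable summable_LIMSEQ_zero by blast
  then have "(\<lambda>n. \<bar>\<mu> (E n - E (Suc n))\<bar>) \<longlonglongrightarrow> 0" by (simp add: tendsto_rabs_zero)
  then have "1 \<le> (0::real)" by (rule LIMSEQ_le_const) (use E(3) in auto)
  then show False by simp
qed

text \<open>The positive set is the limit superior of sets whose measures approach the supremum geometrically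
  fast. It attains the supremum, so that neither removing a subset nor adding a disjoint set can
  increase the measure.\<close>

lemma Hahn_decomposition:
  assumes \<mu>: "\<mu> \<in> signed_measures X"
  obtains P where "P \<in> borel_sets X"
    "\<And>A. A \<in> borel_sets X \<Longrightarrow> A \<subseteq> P \<Longrightarrow> 0 \<le> \<mu> A"
    "\<And>A. A \<in> borel_sets X \<Longrightarrow> A \<inter> P = {} \<Longrightarrow> \<mu> A \<le> 0"
proof -
  obtain C where C: "\<And>A. A \<in> borel_sets X \<Longrightarrow> \<bar>\<mu> A\<bar> \<le> C" using signed_measure_bounded[OF \<mu>] by blast
  define s where "s = (SUP A\<in>borel_sets X. \<mu> A)"
  have bdd: "bdd_above (\<mu> ` borel_sets X)" using C by (force intro!: bdd_aboveI2[where M=C])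
  have le: "\<mu> A \<le> s" if "A \<in> borel_sets X" for A
    unfolding s_def using that bdd by (rule cSUP_upper)
  have "\<exists>A\<in>borel_sets X. s - (1/2) ^ n < \<mu> A" for n
    using less_cSUP_iff[of "borel_sets X" \<mu> "s - (1/2)^n", OF _ bdd] unfolding s_def[symmetric]
    by (metis diff_less_eq empty_iff borel_sets_top less_add_same_cancel1 zero_less_divide_1_iff zero_less_numeral zero_less_power)
  then obtain A where A: "\<And>n. A n \<in> borel_sets X" "\<And>n. s - (1/2) ^ n < \<mu> (A n)" by metis
  \<comment> \<open>Since \<open>\<mu> (A \<inter> B) \<le> s\<close>, the union of two sets falls short of \<open>s\<close> by at most the sum of their defects.\<close>
  define B where "B n m = (\<Union>k\<in>{n..n+m}. A k)" for n m
  have B: "B n m \<in> borel_sets X" for n m unfolding B_def using A(1) by auto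
  have Bge: "s - 2 * (1/2) ^ n + (1/2)^(n+m) \<le> \<mu> (B n m)" for n m
  proof (induction m)
    case 0 then show ?case using A(2)[of n] by (simp add: B_def)
  next
    case (Suc m)
    let ?D = "A (n + Suc m)"
    have "{n..n + Suc m} = insert (n + Suc m) {n..n+m}" by auto
    then have eq: "B n (Suc m) = B n m \<union> (?D - B n m)" unfolding B_def by auto
    have "\<mu> (B n (Suc m)) = \<mu> (B n m) + \<mu> (?D - B n m)"
      unfolding eq by (rule signed_measure_Un[OF \<mu>]) (use A B in auto)
    moreover have "\<mu> ?D = \<mu> (?D \<inter> B n m) + \<mu> (?D - B n m)"
      by (rule signed_measure_Int_Diff[OF \<mu>]) (use A B in auto)
    moreover have "\<mu> (?D \<inter> B n m) \<le> s" using A B by (intro le) auto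
    moreover have "(1/2::real) ^ (n + Suc m) = (1/2) ^ (n + m) / 2" by simp
    ultimately show ?case using Suc A(2)[of "n + Suc m"] by linarith
  qed
  have Bmono: "m \<le> m' \<Longrightarrow> B n m \<subseteq> B n m'" for n m m' unfolding B_def by (rule UN_mono) auto
  define U where "U n = (\<Union>m. B n m)" for n
  have U: "U n \<in> borel_sets X" for n unfolding U_def using B by auto
  have Uge: "s - 2 * (1/2) ^ n \<le> \<mu> (U n)" for n
  proof (rule LIMSEQ_le_const)
    show "(\<lambda>m. \<mu> (B n m)) \<longlonglongrightarrow> \<mu> (U n)" unfolding U_def
      using B by (intro signed_measure_incseq[OF \<mu>]) (auto simp: incseq_def dest: Bmono)
    have "s - 2 * (1/2) ^ n \<le> \<mu> (B n m)" for m
      using Bge[of n m] zero_le_power[of "1/2::real" "n+m"] by linarith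
    then show "\<exists>N. \<forall>m\<ge>N. s - 2 * (1/2) ^ n \<le> \<mu> (B n m)" by blast
  qed
  define P where "P = (\<Inter>n. U n)"
  have P: "P \<in> borel_sets X" unfolding P_def using U by auto
  have Ueq: "U n = (\<Union>k\<in>{n..}. A k)" for n
    unfolding U_def B_def by (auto, metis add.commute atLeastAtMost_iff le_Suc_ex order_refl)
  have "decseq U" unfolding decseq_def Ueq by (intro allI impI UN_mono) auto
  then have lim: "(\<lambda>n. \<mu> (U n)) \<longlonglongrightarrow> \<mu> P" unfolding P_def
    using U by (intro signed_measure_decseq[OF \<mu>]) auto
  have "(\<lambda>n. s - 2 * (1/2) ^ n) \<longlonglongrightarrow> s - 2 * (0::real)"
    by (intro tendsto_intros LIMSEQ_power_zero) auto
  then have "s - 2 * 0 \<le> \<mu> P" using lim by (rule LIMSEQ_le) (use Uge in blast)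
  then have Ps: "\<mu> P = s" using le[OF P] by simp
  show thesis
  proof (rule that[OF P])
    fix A assume A: "A \<in> borel_sets X" "A \<subseteq> P"
    then show "0 \<le> \<mu> A"
      using le[of "P - A"] P Ps signed_measure_Diff[OF \<mu> P A] by auto
  next
    fix A assume A: "A \<in> borel_sets X" "A \<inter> P = {}"
    then show "\<mu> A \<le> 0"
      using le[of "A \<union> P"] P Ps signed_measure_Un[OF \<mu> A(1) P A(2)] by auto
  qed
qed

text \<open>The two parts are the restrictions to a Hahn set \<open>P\<close> and to its complement. The partition of \<open>A\<close> into
  \<open>A \<inter> P\<close> and \<open>A - P\<close> attains the supremum that defines the variation, and no partition exceeds it.\<close>

lemma Jordan_decomposition:
  assumes \<mu>: "\<mu> \<in> signed_measures X"
  obtains \<nu>\<^sub>1 \<nu>\<^sub>2 where "\<nu>\<^sub>1 \<in> pos_measures X" "\<nu>\<^sub>2 \<in> pos_measures X"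
    "\<And>A. \<mu> A = \<nu>\<^sub>1 A - \<nu>\<^sub>2 A"
    "\<And>A. A \<in> borel_sets X \<Longrightarrow> variation X \<mu> A = \<nu>\<^sub>1 A + \<nu>\<^sub>2 A"
proof -
  obtain P where P: "P \<in> borel_sets X"
    and pos: "\<And>A. A \<in> borel_sets X \<Longrightarrow> A \<subseteq> P \<Longrightarrow> 0 \<le> \<mu> A"
    and neg: "\<And>A. A \<in> borel_sets X \<Longrightarrow> A \<inter> P = {} \<Longrightarrow> \<mu> A \<le> 0"
    using Hahn_decomposition[OF \<mu>] by blast
  define \<nu>\<^sub>1 where "\<nu>\<^sub>1 A = (if A \<in> borel_sets X then \<mu> (A \<inter> P) else 0)" for A
  define \<nu>\<^sub>2 where "\<nu>\<^sub>2 A = (if A \<in> borel_sets X then - \<mu> (A - P) else 0)" for A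
  have sums1: "(\<lambda>i. \<mu> (A i \<inter> P)) sums \<mu> ((\<Union>i. A i) \<inter> P)"
    if "range A \<subseteq> borel_sets X" "disjoint_family A" for A :: "nat \<Rightarrow> 'a set"
  proof -
    have "(\<lambda>i. \<mu> (A i \<inter> P)) sums \<mu> (\<Union>i. A i \<inter> P)"
      using that P by (intro signed_measure_sums[OF \<mu>]) (auto simp: disjoint_family_on_def)
    then show ?thesis by simp
  qed
  have sums2: "(\<lambda>i. \<mu> (A i - P)) sums \<mu> ((\<Union>i. A i) - P)"
    if "range A \<subseteq> borel_sets X" "disjoint_family A" for A :: "nat \<Rightarrow> 'a set"
  proof -
    have "(\<lambda>i. \<mu> (A i - P)) sums \<mu> (\<Union>i. A i - P)"
      using that P by (intro signed_measure_sums[OF \<mu>]) (auto simp: disjoint_family_on_def)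
    then show ?thesis by simp
  qed
  have \<nu>1: "\<nu>\<^sub>1 \<in> pos_measures X"
    unfolding pos_measures_def signed_measures_def \<nu>\<^sub>1_def
    using sums1 P by (auto simp: image_subset_iff intro!: pos)
  have \<nu>2: "\<nu>\<^sub>2 \<in> pos_measures X"
    unfolding pos_measures_def signed_measures_def \<nu>\<^sub>2_def
    using sums_minus[OF sums2] P by (auto simp: image_subset_iff intro!: neg)
  have diff: "\<mu> A = \<nu>\<^sub>1 A - \<nu>\<^sub>2 A" for A
    using signed_measure_Int_Diff[OF \<mu> _ P, of A] signed_measure_outside[OF \<mu>, of A]
    by (auto simp: \<nu>\<^sub>1_def \<nu>\<^sub>2_def)
  have "variation X \<mu> A = \<nu>\<^sub>1 A + \<nu>\<^sub>2 A" if A: "A \<in> borel_sets X" for A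
    unfolding variation_def
  proof (rule cSup_eq_maximum)
    let ?Q = "{A \<inter> P, A - P} - {{}}"
    have "(\<Sum>B\<in>?Q. \<bar>\<mu> B\<bar>) = (\<Sum>B\<in>{A \<inter> P, A - P}. \<bar>\<mu> B\<bar>)"
      by (rule sum.mono_neutral_left) (auto simp: signed_measure_empty[OF \<mu>])
    also have "\<dots> = \<bar>\<mu> (A \<inter> P)\<bar> + \<bar>\<mu> (A - P)\<bar>"
    proof (cases "A \<inter> P = A - P")
      case True
      then have "A = {}" by auto
      then show ?thesis by (simp add: signed_measure_empty[OF \<mu>])
    qed simp
    also have "\<dots> = \<nu>\<^sub>1 A + \<nu>\<^sub>2 A"
      using pos[of "A \<inter> P"] neg[of "A - P"] A P by (simp add: \<nu>\<^sub>1_def \<nu>\<^sub>2_def Diff_Int_distrib2)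
    finally have eq: "(\<Sum>B\<in>?Q. \<bar>\<mu> B\<bar>) = \<nu>\<^sub>1 A + \<nu>\<^sub>2 A" .
    have "?Q \<in> {Q. finite Q \<and> disjoint Q \<and> Q \<subseteq> borel_sets X \<and> \<Union>Q = A}"
      using A P by (auto simp: disjoint_def)
    then show "\<nu>\<^sub>1 A + \<nu>\<^sub>2 A \<in> (\<lambda>Q. \<Sum>B\<in>Q. \<bar>\<mu> B\<bar>) `
        {Q. finite Q \<and> disjoint Q \<and> Q \<subseteq> borel_sets X \<and> \<Union>Q = A}"
      unfolding eq[symmetric] by (rule imageI)
  next
    fix x assume "x \<in> (\<lambda>Q. \<Sum>B\<in>Q. \<bar>\<mu> B\<bar>) `
        {Q. finite Q \<and> disjoint Q \<and> Q \<subseteq> borel_sets X \<and> \<Union>Q = A}"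
    then obtain Q where Q: "finite Q" "disjoint Q" "Q \<subseteq> borel_sets X" "\<Union>Q = A"
      and x: "x = (\<Sum>B\<in>Q. \<bar>\<mu> B\<bar>)" by blast
    have "x \<le> (\<Sum>B\<in>Q. \<nu>\<^sub>1 B + \<nu>\<^sub>2 B)"
      unfolding x
    proof (rule sum_mono)
      fix B
      have "0 \<le> \<nu>\<^sub>1 B" "0 \<le> \<nu>\<^sub>2 B" using \<nu>1 \<nu>2 by (auto simp: pos_measures_def)
      then show "\<bar>\<mu> B\<bar> \<le> \<nu>\<^sub>1 B + \<nu>\<^sub>2 B" using diff[of B] by linarith
    qed
    also have "\<dots> = \<nu>\<^sub>1 A + \<nu>\<^sub>2 A"
      using \<nu>1 \<nu>2 signed_measure_Union[of _ X Q] Q by (auto simp: sum.distrib pos_measures_def)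
    finally show "x \<le> \<nu>\<^sub>1 A + \<nu>\<^sub>2 A" .
  qed
  with \<nu>1 \<nu>2 diff show thesis by (rule that)
qed

lemma pos_measures_nonneg: "\<mu> \<in> pos_measures X \<Longrightarrow> 0 \<le> \<mu> A"
  by (auto simp: pos_measures_def)

lemma pos_measures_signed: "\<mu> \<in> pos_measures X \<Longrightarrow> \<mu> \<in> signed_measures X"
  by (auto simp: pos_measures_def)

lemma signed_measures_diff:
  "\<mu> \<in> signed_measures X \<Longrightarrow> \<nu> \<in> signed_measures X \<Longrightarrow> (\<lambda>A. \<mu> A - \<nu> A) \<in> signed_measures X"
  by (auto simp: signed_measures_def intro!: sums_diff)

lemma pos_measures_comb:
  assumes "\<mu> \<in> pos_measures X" "\<nu> \<in> pos_measures X" "0 \<le> a" "0 \<le> b"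
  shows "(\<lambda>A. a * \<mu> A + b * \<nu> A) \<in> pos_measures X"
  using assms by (auto simp: pos_measures_def signed_measures_def intro!: sums_add sums_mult)

lemma pos_measures_scale:
  assumes "\<mu> \<in> pos_measures X" "0 \<le> a"
  shows "(\<lambda>A. a * \<mu> A) \<in> pos_measures X"
  using pos_measures_comb[OF assms(1,1) assms(2), of 0] by simp

lemma pos_measures_zero: "(\<lambda>A. 0) \<in> pos_measures X"
  by (auto simp: pos_measures_def signed_measures_def)

lemma measure_in_pos_measures:
  assumes "finite_measure N" "sets N = borel_sets X"
  shows "measure N \<in> pos_measures X"
proof -
  interpret finite_measure N by fact
  show ?thesis
    using assms(2) by (auto simp: pos_measures_def signed_measures_def measure_notin_sets
        intro!: finite_measure_UNION)
qed

definition as_measure :: "'a::topological_space set \<Rightarrow> ('a set \<Rightarrow> real) \<Rightarrow> 'a measure" where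
  "as_measure X \<mu> = measure_of X (borel_sets X) (\<lambda>A. ennreal (\<mu> A))"

lemma space_as_measure [simp]: "space (as_measure X \<mu>) = X"
  unfolding as_measure_def by (rule space_measure_of) (auto dest: borel_sets_subset)

lemma sets_as_measure [simp, measurable_cong]: "sets (as_measure X \<mu>) = borel_sets X"
proof -
  have "sigma_sets X (borel_sets X) = borel_sets X"
    using sets.sigma_sets_eq[of "restrict_space borel X"] by simp
  then show ?thesis unfolding as_measure_def by (subst sets_measure_of) (auto dest: borel_sets_subset)
qed

lemma emeasure_as_measure:
  assumes \<mu>: "\<mu> \<in> pos_measures X" and A: "A \<in> borel_sets X"
  shows "emeasure (as_measure X \<mu>) A = ennreal (\<mu> A)"
proof (rule emeasure_measure_of[OF as_measure_def])
  show "borel_sets X \<subseteq> Pow X" by (auto dest: borel_sets_subset)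
  show "A \<in> sets (as_measure X \<mu>)" using A by simp
  show "positive (sets (as_measure X \<mu>)) (\<lambda>A. ennreal (\<mu> A))"
    using signed_measure_empty[OF pos_measures_signed[OF \<mu>]] by (simp add: positive_def)
  show "countably_additive (sets (as_measure X \<mu>)) (\<lambda>A. ennreal (\<mu> A))"
    unfolding countably_additive_def
  proof (intro allI impI)
    fix B :: "nat \<Rightarrow> 'a set"
    assume B: "range B \<subseteq> sets (as_measure X \<mu>)" "disjoint_family B"
    have "(\<lambda>i. \<mu> (B i)) sums \<mu> (\<Union>i. B i)"
      using B by (intro signed_measure_sums[OF pos_measures_signed[OF \<mu>]]) auto
    then show "(\<Sum>i. ennreal (\<mu> (B i))) = ennreal (\<mu> (\<Union>i. B i))"
      by (intro suminf_ennreal_eq pos_measures_nonneg[OF \<mu>])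
  qed
qed

lemma measure_as_measure:
  assumes \<mu>: "\<mu> \<in> pos_measures X"
  shows "measure (as_measure X \<mu>) = \<mu>"
proof
  fix A show "measure (as_measure X \<mu>) A = \<mu> A"
  proof (cases "A \<in> borel_sets X")
    case True then show ?thesis
      by (simp add: measure_def emeasure_as_measure[OF \<mu>] pos_measures_nonneg[OF \<mu>])
  next
    case False then show ?thesis
      by (simp add: measure_notin_sets signed_measure_outside[OF pos_measures_signed[OF \<mu>]])
  qed
qed

lemma finite_measure_as_measure: "\<mu> \<in> pos_measures X \<Longrightarrow> finite_measure (as_measure X \<mu>)"
  by (rule finite_measureI) (simp add: emeasure_as_measure)

lemma as_measure_measure:
  assumes "finite_measure N" "sets N = borel_sets X"
  shows "as_measure X (measure N) = N"
proof (rule measure_eqI)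
  interpret finite_measure N by fact
  show "sets (as_measure X (measure N)) = sets N" using assms(2) by simp
  fix A assume "A \<in> sets (as_measure X (measure N))"
  then show "emeasure (as_measure X (measure N)) A = emeasure N A"
    using assms by (simp add: emeasure_as_measure[OF measure_in_pos_measures] emeasure_eq_measure)
qed


text \<open>By additivity all partition sums of a positive measure agree.\<close>

lemma variation_pos:
  assumes \<mu>: "\<mu> \<in> pos_measures X" and A: "A \<in> borel_sets X"
  shows "variation X \<mu> A = \<mu> A"
proof -
  let ?Q = "{Q. finite Q \<and> disjoint Q \<and> Q \<subseteq> borel_sets X \<and> \<Union>Q = A}"
  have "variation X \<mu> A = (SUP Q\<in>?Q. \<mu> A)"
    unfolding variation_def
  proof (rule SUP_cong[OF refl])
    fix Q assume "Q \<in> ?Q"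
    then show "(\<Sum>B\<in>Q. \<bar>\<mu> B\<bar>) = \<mu> A"
      using signed_measure_Union[OF pos_measures_signed[OF \<mu>], of Q] pos_measures_nonneg[OF \<mu>]
      by (auto simp: abs_of_nonneg)
  qed
  also have "\<dots> = \<mu> A"
  proof (rule cSUP_const)
    have "{A} \<in> ?Q" using A by (auto simp: disjoint_def)
    then show "?Q \<noteq> {}" by blast
  qed
  finally show ?thesis .
qed

lemma tv_norm_pos: "\<mu> \<in> pos_measures X \<Longrightarrow> tv_norm X \<mu> = \<mu> X"
  by (simp add: tv_norm_def variation_pos)

lemma tv_norm_nonneg_pos: "\<mu> \<in> pos_measures X \<Longrightarrow> 0 \<le> tv_norm X \<mu>"
  by (simp add: tv_norm_pos pos_measures_nonneg)

lemma tv_norm_diff_le: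
  assumes \<mu>: "\<mu> \<in> pos_measures X" and \<nu>: "\<nu> \<in> pos_measures X"
  shows "tv_norm X (\<lambda>A. \<mu> A - \<nu> A) \<le> \<mu> X + \<nu> X"
  unfolding tv_norm_def variation_def
proof (rule cSUP_least)
  have "{X} \<in> {Q. finite Q \<and> disjoint Q \<and> Q \<subseteq> borel_sets X \<and> \<Union>Q = X}"
    by (auto simp: disjoint_def)
  then show "{Q. finite Q \<and> disjoint Q \<and> Q \<subseteq> borel_sets X \<and> \<Union>Q = X} \<noteq> {}" by blast
next
  fix Q assume Q: "Q \<in> {Q. finite Q \<and> disjoint Q \<and> Q \<subseteq> borel_sets X \<and> \<Union>Q = X}"
  have "(\<Sum>B\<in>Q. \<bar>\<mu> B - \<nu> B\<bar>) \<le> (\<Sum>B\<in>Q. \<mu> B + \<nu> B)"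
  proof (rule sum_mono)
    fix B show "\<bar>\<mu> B - \<nu> B\<bar> \<le> \<mu> B + \<nu> B"
      using pos_measures_nonneg[OF \<mu>, of B] pos_measures_nonneg[OF \<nu>, of B] by linarith
  qed
  also have "\<dots> = \<mu> X + \<nu> X"
    using Q signed_measure_Union[OF pos_measures_signed[OF \<mu>], of Q]
      signed_measure_Union[OF pos_measures_signed[OF \<nu>], of Q] by (simp add: sum.distrib)
  finally show "(\<Sum>B\<in>Q. \<bar>\<mu> B - \<nu> B\<bar>) \<le> \<mu> X + \<nu> X" .
qed

section \<open>The duality pairing\<close>

lemma measure_of_borel_sets_cong:
  assumes "\<And>A. A \<in> borel_sets X \<Longrightarrow> f A = g A"
  shows "measure_of X (borel_sets X) f = measure_of X (borel_sets X) g"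
proof (rule measure_of_eq)
  show "borel_sets X \<subseteq> Pow X" by (auto dest: borel_sets_subset)
  fix A assume "A \<in> sigma_sets X (borel_sets X)"
  then have "A \<in> borel_sets X" using sets.sigma_sets_eq[of "restrict_space borel X"] by simp
  then show "f A = g A" by (rule assms)
qed

lemma pairing_Jordan:
  assumes \<mu>: "\<mu> \<in> signed_measures X"
  obtains \<nu>\<^sub>1 \<nu>\<^sub>2 where "\<nu>\<^sub>1 \<in> pos_measures X" "\<nu>\<^sub>2 \<in> pos_measures X"
    "\<And>A. \<mu> A = \<nu>\<^sub>1 A - \<nu>\<^sub>2 A" "tv_norm X \<mu> = \<nu>\<^sub>1 X + \<nu>\<^sub>2 X"
    "\<And>f. pairing X f \<mu> = (\<integral>x. f x \<partial>as_measure X \<nu>\<^sub>1) - (\<integral>x. f x \<partial>as_measure X \<nu>\<^sub>2)"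
proof -
  obtain \<nu>\<^sub>1 \<nu>\<^sub>2 where \<nu>: "\<nu>\<^sub>1 \<in> pos_measures X" "\<nu>\<^sub>2 \<in> pos_measures X"
    and diff: "\<And>A. \<mu> A = \<nu>\<^sub>1 A - \<nu>\<^sub>2 A"
    and var: "\<And>A. A \<in> borel_sets X \<Longrightarrow> variation X \<mu> A = \<nu>\<^sub>1 A + \<nu>\<^sub>2 A"
    using Jordan_decomposition[OF \<mu>] by metis
  have "pos_part X \<mu> = as_measure X \<nu>\<^sub>1" "neg_part X \<mu> = as_measure X \<nu>\<^sub>2"
    unfolding pos_part_def neg_part_def as_measure_def
    by (rule measure_of_borel_sets_cong, simp add: var diff)+
  moreover have "tv_norm X \<mu> = \<nu>\<^sub>1 X + \<nu>\<^sub>2 X" by (simp add: tv_norm_def var)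
  ultimately show thesis using that[OF \<nu> diff] by (simp add: pairing_def)
qed

lemma pairing_pos:
  assumes \<mu>: "\<mu> \<in> pos_measures X"
  shows "pairing X f \<mu> = (\<integral>x. f x \<partial>as_measure X \<mu>)"
proof -
  have "pos_part X \<mu> = as_measure X \<mu>" "neg_part X \<mu> = as_measure X (\<lambda>A. 0)"
    unfolding pos_part_def neg_part_def as_measure_def
    by (rule measure_of_borel_sets_cong, simp add: variation_pos[OF \<mu>])+
  moreover have "(\<integral>x. f x \<partial>as_measure X (\<lambda>A. 0)) = 0"
  proof -
    have "AE x in as_measure X (\<lambda>A. 0). f x = 0"
      by (rule AE_I[where N=X]) (auto simp: emeasure_as_measure[OF pos_measures_zero])
    then show ?thesis by (rule integral_eq_zero_AE)
  qed
  ultimately show ?thesis by (simp add: pairing_def)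
qed

lemma measurable_continuous_as_measure:
  fixes f :: "'a::topological_space \<Rightarrow> real"
  shows "continuous_on X f \<Longrightarrow> f \<in> borel_measurable (as_measure X \<mu>)"
  using borel_measurable_continuous_on_restrict[of X f]
  by (simp cong: measurable_cong_sets)

lemma continuous_compact_bounded:
  fixes f :: "'a::topological_space \<Rightarrow> real"
  assumes "compact X" "continuous_on X f"
  obtains B where "0 < B" "\<And>x. x \<in> X \<Longrightarrow> \<bar>f x\<bar> \<le> B"
  using compact_imp_bounded[OF compact_continuous_image[OF assms(2,1)]]
  unfolding bounded_pos by auto

lemma integrable_as_measure:
  fixes f :: "'a::topological_space \<Rightarrow> real"
  assumes "compact X" "continuous_on X f" "\<mu> \<in> pos_measures X"
  shows "integrable (as_measure X \<mu>) f"
proof -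
  interpret finite_measure "as_measure X \<mu>" by (rule finite_measure_as_measure) fact
  obtain B where "\<And>x. x \<in> X \<Longrightarrow> \<bar>f x\<bar> \<le> B" using continuous_compact_bounded[OF assms(1,2)] by metis
  then show ?thesis
    by (intro integrable_const_bound[where B=B] measurable_continuous_as_measure assms) auto
qed

text \<open>Additivity in the measure holds for indicators by definition and passes to sums, multiples and
  monotone limits.\<close>

lemma nn_integral_as_measure_comb:
  assumes \<mu>: "\<mu> \<in> pos_measures X" and \<nu>: "\<nu> \<in> pos_measures X" and ab: "0 \<le> a" "0 \<le> b"
    and f: "f \<in> borel_measurable (restrict_space borel X)"
  shows "(\<integral>\<^sup>+x. f x \<partial>as_measure X (\<lambda>A. a * \<mu> A + b * \<nu> A)) =
     ennreal a * (\<integral>\<^sup>+x. f x \<partial>as_measure X \<mu>) + ennreal b * (\<integral>\<^sup>+x. f x \<partial>as_measure X \<nu>)"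
  (is "?I f = ?J f")
proof -
  note [measurable_cong] = sets_as_measure
  note comb = pos_measures_comb[OF \<mu> \<nu> ab]
  show ?thesis using f
  proof (induction rule: borel_measurable_induct)
    case (cong f g)
    have "integral\<^sup>N (as_measure X \<sigma>) f = integral\<^sup>N (as_measure X \<sigma>) g" for \<sigma>
      by (rule nn_integral_cong) (use cong in auto)
    then show ?case using cong by simp
  next
    case (set A)
    then show ?case
      using pos_measures_nonneg[OF \<mu>] pos_measures_nonneg[OF \<nu>] ab
      by (simp add: emeasure_as_measure[OF \<mu>] emeasure_as_measure[OF \<nu>] emeasure_as_measure[OF comb]
          ennreal_mult[symmetric] ennreal_plus[symmetric] del: ennreal_plus)
  next
    case (mult u c)
    then show ?case by (simp add: nn_integral_cmult algebra_simps)
  next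
    case (add u v)
    then show ?case by (simp add: nn_integral_add algebra_simps)
  next
    case (seq U)
    have lim: "integral\<^sup>N (as_measure X \<sigma>) (SUP i. U i) = (SUP i. integral\<^sup>N (as_measure X \<sigma>) (U i))" for \<sigma>
      using seq by (subst nn_integral_monotone_convergence_SUP[symmetric])
        (auto simp: image_comp cong: nn_integral_cong)
    have inc: "incseq (\<lambda>i. integral\<^sup>N (as_measure X \<sigma>) (U i))" for \<sigma>
      using seq by (auto simp: mono_def le_fun_def intro!: nn_integral_mono)
    show ?case
      unfolding lim
      by (subst SUP_mult_left_ennreal, subst SUP_mult_left_ennreal, subst ennreal_SUP_add[symmetric])
        (use inc seq in \<open>auto simp: incseq_def intro!: mult_left_mono\<close>)
  qed
qed

lemma integral_as_measure_comb:
  fixes f :: "'a::topological_space \<Rightarrow> real"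
  assumes X: "compact X" and f: "continuous_on X f"
    and \<mu>: "\<mu> \<in> pos_measures X" and \<nu>: "\<nu> \<in> pos_measures X" and ab: "0 \<le> a" "0 \<le> b"
  shows "(\<integral>x. f x \<partial>as_measure X (\<lambda>A. a * \<mu> A + b * \<nu> A)) =
     a * (\<integral>x. f x \<partial>as_measure X \<mu>) + b * (\<integral>x. f x \<partial>as_measure X \<nu>)"
proof -
  have fm: "f \<in> borel_measurable (restrict_space borel X)"
    by (rule borel_measurable_continuous_on_restrict[OF f])
  note int = integrable_as_measure[OF X f]
  have comb: "enn2real (\<integral>\<^sup>+x. g x \<partial>as_measure X (\<lambda>A. a * \<mu> A + b * \<nu> A)) =
     a * enn2real (\<integral>\<^sup>+x. g x \<partial>as_measure X \<mu>) + b * enn2real (\<integral>\<^sup>+x. g x \<partial>as_measure X \<nu>)"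
    if g: "g \<in> borel_measurable (restrict_space borel X)"
      "(\<integral>\<^sup>+x. g x \<partial>as_measure X \<mu>) < \<infinity>" "(\<integral>\<^sup>+x. g x \<partial>as_measure X \<nu>) < \<infinity>" for g
    unfolding nn_integral_as_measure_comb[OF \<mu> \<nu> ab g(1)]
    using g(2,3) ab by (subst enn2real_plus) (auto simp: enn2real_mult ennreal_mult_less_top)
  show ?thesis
    using int[OF \<mu>] int[OF \<nu>] int[OF pos_measures_comb[OF \<mu> \<nu> ab]] fm
    by (simp add: real_lebesgue_integral_def comb real_integrable_def less_top algebra_simps)
qed

text \<open>The Jordan parts of a difference of positive measures need not be the two given measures, but
  they differ from them by a common positive measure, which cancels in the integral.\<close>

lemma pairing_diff:
  fixes f :: "'a::topological_space \<Rightarrow> real"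
  assumes X: "compact X" and f: "continuous_on X f"
    and \<mu>: "\<mu> \<in> pos_measures X" and \<nu>: "\<nu> \<in> pos_measures X"
  shows "pairing X f (\<lambda>A. \<mu> A - \<nu> A) = pairing X f \<mu> - pairing X f \<nu>"
proof -
  obtain \<nu>\<^sub>1 \<nu>\<^sub>2 where \<nu>12: "\<nu>\<^sub>1 \<in> pos_measures X" "\<nu>\<^sub>2 \<in> pos_measures X"
    and diff: "\<And>A. \<mu> A - \<nu> A = \<nu>\<^sub>1 A - \<nu>\<^sub>2 A"
    and pair: "\<And>f. pairing X f (\<lambda>A. \<mu> A - \<nu> A)
      = (\<integral>x. f x \<partial>as_measure X \<nu>\<^sub>1) - (\<integral>x. f x \<partial>as_measure X \<nu>\<^sub>2)"
    using pairing_Jordan[OF signed_measures_diff[OF \<mu>[THEN pos_measures_signed] \<nu>[THEN pos_measures_signed]]]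
    by metis
  have "(\<lambda>A. 1 * \<mu> A + 1 * \<nu>\<^sub>2 A) = (\<lambda>A. 1 * \<nu>\<^sub>1 A + 1 * \<nu> A)" using diff by (auto simp: fun_eq_iff algebra_simps)
  then have "1 * (\<integral>x. f x \<partial>as_measure X \<mu>) + 1 * (\<integral>x. f x \<partial>as_measure X \<nu>\<^sub>2)
      = 1 * (\<integral>x. f x \<partial>as_measure X \<nu>\<^sub>1) + 1 * (\<integral>x. f x \<partial>as_measure X \<nu>)"
    using integral_as_measure_comb[OF X f \<mu> \<nu>12(2), of 1 1]
      integral_as_measure_comb[OF X f \<nu>12(1) \<nu>, of 1 1] by simp
  then show ?thesis unfolding pair pairing_pos[OF \<mu>] pairing_pos[OF \<nu>] by simp
qed

lemma pairing_comb:
  fixes f :: "'a::topological_space \<Rightarrow> real"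
  assumes X: "compact X" and f: "continuous_on X f"
    and \<mu>: "\<mu> \<in> pos_measures X" and \<nu>: "\<nu> \<in> pos_measures X" and ab: "0 \<le> a" "0 \<le> b"
  shows "pairing X f (\<lambda>A. a * \<mu> A + b * \<nu> A) = a * pairing X f \<mu> + b * pairing X f \<nu>"
  by (simp add: pairing_pos assms pos_measures_comb integral_as_measure_comb)

lemma pairing_pos_mono:
  fixes f :: "'a::topological_space \<Rightarrow> real"
  assumes X: "compact X" and fg: "continuous_on X f" "continuous_on X g" "\<And>x. x \<in> X \<Longrightarrow> f x \<le> g x"
    and \<mu>: "\<mu> \<in> pos_measures X"
  shows "pairing X f \<mu> \<le> pairing X g \<mu>"
  unfolding pairing_pos[OF \<mu>] by (intro integral_mono integrable_as_measure assms) simp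

lemma pairing_const: "\<mu> \<in> pos_measures X \<Longrightarrow> pairing X (\<lambda>x. c) \<mu> = c * \<mu> X"
  by (simp add: pairing_pos measure_as_measure)

lemma pairing_bound:
  fixes f :: "'a::topological_space \<Rightarrow> real"
  assumes X: "compact X" and f: "continuous_on X f" "\<And>x. x \<in> X \<Longrightarrow> \<bar>f x\<bar> \<le> B"
    and \<mu>: "\<mu> \<in> signed_measures X"
  shows "\<bar>pairing X f \<mu>\<bar> \<le> B * tv_norm X \<mu>"
proof -
  obtain \<nu>\<^sub>1 \<nu>\<^sub>2 where \<nu>: "\<nu>\<^sub>1 \<in> pos_measures X" "\<nu>\<^sub>2 \<in> pos_measures X" and tv: "tv_norm X \<mu> = \<nu>\<^sub>1 X + \<nu>\<^sub>2 X"
    and pair: "\<And>f. pairing X f \<mu> = (\<integral>x. f x \<partial>as_measure X \<nu>\<^sub>1) - (\<integral>x. f x \<partial>as_measure X \<nu>\<^sub>2)"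
    using pairing_Jordan[OF \<mu>] by metis
  have "\<bar>pairing X f \<nu>\<bar> \<le> B * \<nu> X" if \<nu>: "\<nu> \<in> pos_measures X" for \<nu>
  proof -
    have "f x \<le> B" "- B \<le> f x" if "x \<in> X" for x using f(2)[OF that] by auto
    then have "pairing X f \<nu> \<le> pairing X (\<lambda>x. B) \<nu>" "pairing X (\<lambda>x. - B) \<nu> \<le> pairing X f \<nu>"
      by (auto intro!: pairing_pos_mono X f(1) \<nu>)
    then show ?thesis by (auto simp: pairing_const[OF \<nu>])
  qed
  from this[OF \<nu>(1)] this[OF \<nu>(2)] show ?thesis
    unfolding pair tv pairing_pos[OF \<nu>(1)] pairing_pos[OF \<nu>(2)] by (simp add: algebra_simps abs_le_iff)
qed

section \<open>A continuous curve through a cube\<close>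

text \<open>A cosine clipped to \<open>[0, 1]\<close>: it is continuous, has period 2, vanishes on \<open>[0, 1/3]\<close> and equals 1 on
  \<open>[2/3, 1]\<close>, which is all that reading off ternary digits requires.\<close>

definition square_wave :: "real \<Rightarrow> real" where
  "square_wave s = max 0 (min 1 ((1 - 2 * cos (pi * s)) / 2))"

lemma square_wave_range: "0 \<le> square_wave s" "square_wave s \<le> 1"
  by (auto simp: square_wave_def)

lemma continuous_on_square_wave [continuous_intros]:
  fixes f :: "real \<Rightarrow> real"
  shows "continuous_on A f \<Longrightarrow> continuous_on A (\<lambda>t. square_wave (f t))"
  unfolding square_wave_def by (intro continuous_intros) auto

lemma square_wave_shift: "square_wave (2 * of_int k + u) = square_wave u"
proof -
  have "cos (pi * (2 * of_int k + u)) = cos (pi * u)"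
    using cos_int_2pin[of k] sin_int_2pin[of k] by (simp add: distrib_left cos_add ac_simps)
  then show ?thesis by (simp add: square_wave_def)
qed

lemma square_wave_eq_0: "0 \<le> u \<Longrightarrow> u \<le> 1/3 \<Longrightarrow> square_wave u = 0"
proof -
  assume u: "0 \<le> u" "u \<le> 1/3"
  have "cos (pi / 3) \<le> cos (pi * u)"
    using u by (intro cos_monotone_0_pi_le) (auto simp: field_simps)
  then show ?thesis by (simp add: square_wave_def cos_60)
qed

lemma square_wave_eq_1: "2/3 \<le> u \<Longrightarrow> u \<le> 1 \<Longrightarrow> square_wave u = 1"
proof -
  assume u: "2/3 \<le> u" "u \<le> 1"
  have "cos (pi * u) \<le> cos (2 / 3 * pi)"
    using u by (intro cos_monotone_0_pi_le) (auto simp: field_simps)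
  also have "cos (2 / 3 * pi) = - 1 / 2"
    using cos_double_cos[of "pi/3"] by (simp add: cos_60 power2_eq_square)
  finally show ?thesis by (simp add: square_wave_def)
qed

lemma ternary_summable:
  fixes a :: "nat \<Rightarrow> real"
  assumes "\<And>m. a m \<in> {0, 1}"
  shows "summable (\<lambda>m. 2 * a m / 3 ^ (m + 1))"
proof (rule summable_comparison_test')
  show "summable (\<lambda>m. 2 * (1/3) ^ m :: real)" by (intro summable_mult summable_geometric) simp
  show "norm (2 * a m / 3 ^ (m + 1)) \<le> 2 * (1/3) ^ m" if "0 \<le> m" for m
    using assms[of m] by (auto simp: power_divide field_simps)
qed

text \<open>Multiplication by \<open>3 ^ m\<close> turns the digits before the \<open>m\<close>-th into an even integer, which the period
  absorbs, puts the \<open>m\<close>-th digit right behind the point, and leaves a remainder of at most \<open>1/3\<close>.\<close>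

lemma square_wave_ternary:
  fixes a :: "nat \<Rightarrow> real"
  assumes a: "\<And>m. a m \<in> {0, 1}"
  shows "square_wave (3 ^ m * (\<Sum>j. 2 * a j / 3 ^ (j + 1))) = a m"
proof -
  let ?f = "\<lambda>j. 2 * a j / 3 ^ (j + 1)"
  define k :: int where "k = (\<Sum>j<m. \<lfloor>a j\<rfloor> * 3 ^ (m - 1 - j))"
  define r where "r = 3 ^ m * (\<Sum>j. ?f (j + Suc m))"
  have sf: "summable (\<lambda>j. ?f (j + Suc m))"
    using ternary_summable[OF a] by (subst summable_iff_shift)
  have "3 ^ m * (\<Sum>j. ?f j) = r + 3 ^ m * (\<Sum>j<Suc m. ?f j)"
    using suminf_split_initial_segment[OF ternary_summable[of a, OF a], where k = "Suc m"]
    by (simp add: r_def algebra_simps)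
  also have "3 ^ m * (\<Sum>j<Suc m. ?f j) = 2 * a m / 3 + (\<Sum>j<m. 3 ^ m * ?f j)"
    by (simp add: sum_distrib_left algebra_simps)
  also have "(\<Sum>j<m. 3 ^ m * ?f j) = (\<Sum>j<m. 2 * (of_int \<lfloor>a j\<rfloor> * 3 ^ (m - 1 - j)))"
  proof (rule sum.cong[OF refl])
    fix j assume "j \<in> {..<m}"
    then have pow: "(3::real) ^ m = 3 ^ (m - 1 - j) * 3 ^ (j + 1)"
      by (subst power_add[symmetric]) simp
    have digit: "of_int \<lfloor>a j\<rfloor> = a j"
    proof -
      consider "a j = 0" | "a j = 1" using a[of j] by auto
      then show ?thesis by cases simp_all
    qed
    show "3 ^ m * ?f j = 2 * (of_int \<lfloor>a j\<rfloor> * 3 ^ (m - 1 - j))" unfolding digit using pow by simp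
  qed
  also have "\<dots> = 2 * of_int k" by (simp add: k_def sum_distrib_left)
  finally have eq: "3 ^ m * (\<Sum>j. ?f j) = 2 * of_int k + (2 * a m / 3 + r)" by simp
  have "0 \<le> r"
    unfolding r_def
  proof (intro mult_nonneg_nonneg suminf_nonneg sf)
    fix j show "0 \<le> ?f (j + Suc m)" using a[of "j + Suc m"] by auto
  qed simp
  have g: "(\<lambda>j. 2 / 3 ^ (m + 2) * (1/3) ^ j) sums (2 / 3 ^ (m + 2) * (1 / (1 - 1/3)) :: real)"
    by (intro sums_mult geometric_sums) simp
  have "(\<Sum>j. ?f (j + Suc m)) \<le> (\<Sum>j. 2 / 3 ^ (m + 2) * (1/3) ^ j)"
  proof (rule suminf_le[OF _ sf sums_summable[OF g]])
    fix j
    have "?f (j + Suc m) \<le> 2 / 3 ^ (j + Suc m + 1)"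
      using a[of "j + Suc m"] by (intro divide_right_mono) auto
    also have "\<dots> = 2 / 3 ^ (m + 2) * (1/3) ^ j" by (simp add: power_add power_divide)
    finally show "?f (j + Suc m) \<le> 2 / 3 ^ (m + 2) * (1/3) ^ j" .
  qed
  also have "\<dots> = 1 / 3 ^ (m + 1)" using sums_unique[OF g] by simp
  finally have "r \<le> 3 ^ m * (1 / 3 ^ (m + 1))" unfolding r_def by (intro mult_left_mono) auto
  then have "r \<le> 1 / 3" by simp
  consider "a m = 0" | "a m = 1" using a[of m] by auto
  then show ?thesis
  proof cases
    case 1
    then show ?thesis unfolding eq square_wave_shift
      using square_wave_eq_0[OF \<open>0 \<le> r\<close> \<open>r \<le> 1 / 3\<close>] by simp
  next
    case 2
    then show ?thesis unfolding eq square_wave_shift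
      using square_wave_eq_1[of "2 / 3 + r"] \<open>0 \<le> r\<close> \<open>r \<le> 1 / 3\<close> by simp
  qed
qed

definition binary_digit :: "nat \<Rightarrow> real \<Rightarrow> real" where
  "binary_digit n x = of_int (\<lfloor>2 ^ Suc n * x\<rfloor> - 2 * \<lfloor>2 ^ n * x\<rfloor>)"

lemma binary_digit_cases: "binary_digit n x \<in> {0, 1}"
proof -
  have "\<lfloor>2 ^ Suc n * x\<rfloor> - 2 * \<lfloor>2 ^ n * x\<rfloor> \<in> {0, 1}"
  proof -
    have "2 * \<lfloor>2 ^ n * x\<rfloor> \<le> \<lfloor>2 ^ Suc n * x\<rfloor>" "\<lfloor>2 ^ Suc n * x\<rfloor> < 2 * \<lfloor>2 ^ n * x\<rfloor> + 2"
      unfolding le_floor_iff floor_less_iff power_Suc using floor_correct[of "2 ^ n * x"]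
      by (auto simp: algebra_simps)
    then show ?thesis by auto
  qed
  then show ?thesis unfolding binary_digit_def by (metis insertE insertI1 insertI2 of_int_0 of_int_1 singletonD)
qed

text \<open>The partial sums telescope to \<open>\<lfloor>2 ^ N * x\<rfloor> / 2 ^ N\<close>.\<close>

lemma binary_expansion:
  assumes "0 \<le> x" "x < 1"
  shows "(\<lambda>n. binary_digit n x / 2 ^ Suc n) sums x"
proof -
  have partial: "(\<Sum>n<N. binary_digit n x / 2 ^ Suc n) = of_int \<lfloor>2 ^ N * x\<rfloor> / 2 ^ N" for N
  proof (induction N)
    case 0
    have "\<lfloor>x\<rfloor> = 0" using assms by (simp add: floor_eq_iff)
    then show ?case by simp
  next
    case (Suc N)
    then show ?case by (simp add: binary_digit_def field_simps)
  qed
  have "(\<lambda>N. of_int \<lfloor>2 ^ N * x\<rfloor> / 2 ^ N) \<longlonglongrightarrow> x"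
  proof (rule real_tendsto_sandwich)
    show "(\<lambda>N. x - (1/2) ^ N) \<longlonglongrightarrow> x"
      using tendsto_diff[OF tendsto_const[of x] LIMSEQ_power_zero[of "1/2::real"]] by simp
    show "\<forall>\<^sub>F N in sequentially. x - (1/2) ^ N \<le> of_int \<lfloor>2 ^ N * x\<rfloor> / 2 ^ N"
    proof (intro always_eventually allI)
      fix N
      have "(x - (1/2) ^ N) * 2 ^ N = 2 ^ N * x - 1"
        by (simp add: algebra_simps power_mult_distrib[symmetric])
      also have "\<dots> \<le> of_int \<lfloor>2 ^ N * x\<rfloor>" by linarith
      finally show "x - (1/2) ^ N \<le> of_int \<lfloor>2 ^ N * x\<rfloor> / 2 ^ N" by (simp add: pos_le_divide_eq)
    qed
    show "\<forall>\<^sub>F N in sequentially. of_int \<lfloor>2 ^ N * x\<rfloor> / 2 ^ N \<le> x"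
      by (intro always_eventually allI) (simp add: pos_divide_le_eq mult.commute)
  qed simp
  then show ?thesis unfolding sums_def partial .
qed

text \<open>Schoenberg's construction: the binary digits of all coordinates of a point are interleaved into
  the ternary digits 0 and 2 of one real number \<open>t\<close>, and the wave recovers the \<open>m\<close>-th of
  them continuously from \<open>3^m * t\<close>.\<close>

lemma Schoenberg_curve:
  obtains h :: "real \<Rightarrow> real^'d" and s :: "real^'d \<Rightarrow> real"
  where "continuous_on UNIV h" "s \<in> borel_measurable borel"
    "\<And>x. 0 \<le> s x \<and> s x \<le> 1"
    "\<And>x. (\<And>i. 0 \<le> x $ i \<and> x $ i < 1) \<Longrightarrow> h (s x) = x"
proof -
  let ?c = "CARD('d)"
  obtain e :: "'d \<Rightarrow> nat" where e: "bij_betw e UNIV {0..<?c}"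
    using ex_bij_betw_finite_nat[of "UNIV :: 'd set"] by auto
  define g where "g = inv_into UNIV e"
  have g: "g (e i) = i" for i unfolding g_def using e by (simp add: bij_betw_def)
  have ec: "e i < ?c" for i using bij_betwE[OF e] by auto
  define a where "a m x = binary_digit (m div ?c) (x $ g (m mod ?c))" for m and x :: "real^'d"
  have a01: "a m x \<in> {0, 1}" for m x unfolding a_def by (rule binary_digit_cases)
  define s where "s x = (\<Sum>m. 2 * a m x / 3 ^ (m + 1))" for x
  define h where "h t = (\<chi> i. \<Sum>n. square_wave (3 ^ (n * ?c + e i) * t) / 2 ^ Suc n)" for t
  show thesis
  proof (rule that)
    show "continuous_on UNIV h"
      unfolding h_def
    proof (rule continuous_on_vec_lambda)
      fix i
      show "continuous_on UNIV (\<lambda>t. \<Sum>n. square_wave (3 ^ (n * ?c + e i) * t) / 2 ^ Suc n)"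
      proof (rule uniform_limit_theorem)
        show "uniform_limit UNIV (\<lambda>N t. \<Sum>n<N. square_wave (3 ^ (n * ?c + e i) * t) / 2 ^ Suc n)
            (\<lambda>t. \<Sum>n. square_wave (3 ^ (n * ?c + e i) * t) / 2 ^ Suc n) sequentially"
        proof (rule Weierstrass_m_test)
          show "summable (\<lambda>n. (1/2) ^ n :: real)" by (rule summable_geometric) simp
          show "norm (square_wave (3 ^ (n * ?c + e i) * t) / 2 ^ Suc n) \<le> (1/2) ^ n" for n t
          proof -
            have "norm (square_wave (3 ^ (n * ?c + e i) * t) / 2 ^ Suc n) \<le> 1 / 2 ^ n"
              using square_wave_range[of "3 ^ (n * ?c + e i) * t"] by (auto simp: field_simps)
            then show ?thesis by (simp add: power_divide)
          qed
        qed
        show "\<forall>\<^sub>F N in sequentially. continuous_on UNIV (\<lambda>t. \<Sum>n<N. square_wave (3 ^ (n * ?c + e i) * t) / 2 ^ Suc n)"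
          by (intro always_eventually allI continuous_intros) auto
      qed simp
    qed
    have [measurable]: "(\<lambda>x. x $ i) \<in> borel_measurable borel" for i :: 'd
      by (intro borel_measurable_continuous_onI continuous_intros)
    show "s \<in> borel_measurable borel"
      unfolding s_def a_def binary_digit_def by measurable
    show "0 \<le> s x \<and> s x \<le> 1" for x
    proof
      have nn: "0 \<le> a m x" "a m x \<le> 1" for m using a01[of m x] by auto
      show "0 \<le> s x" unfolding s_def using nn by (intro suminf_nonneg ternary_summable a01) simp
      have gs: "(\<lambda>m. 2 / 3 * (1/3) ^ m) sums (2 / 3 * (1 / (1 - 1/3)) :: real)"
        by (intro sums_mult geometric_sums) simp
      have "s x \<le> (\<Sum>m. 2 / 3 * (1/3) ^ m)"
        unfolding s_def
      proof (rule suminf_le[OF _ ternary_summable[OF a01] sums_summable[OF gs]])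
        show "2 * a m x / 3 ^ (m + 1) \<le> 2 / 3 * (1/3) ^ m" for m
          using nn(2)[of m] by (simp add: power_divide field_simps)
      qed
      then show "s x \<le> 1" using sums_unique[OF gs] by simp
    qed
    show "h (s x) = x" if x: "\<And>i. 0 \<le> x $ i \<and> x $ i < 1" for x
    proof -
      have "(\<Sum>n. square_wave (3 ^ (n * ?c + e i) * s x) / 2 ^ Suc n) = x $ i" for i
      proof -
        have "square_wave (3 ^ (n * ?c + e i) * s x) = binary_digit n (x $ i)" for n
          unfolding s_def square_wave_ternary[OF a01] using ec[of i] by (simp add: a_def g)
        then show ?thesis using binary_expansion[of "x $ i"] x by (simp add: sums_iff)
      qed
      then show ?thesis by (simp add: h_def vec_eq_iff)
    qed
  qed
qed

lemma bounded_set_on_curve: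
  fixes X :: "(real^'d) set"
  assumes "bounded X"
  obtains h :: "real \<Rightarrow> real^'d" and s :: "real^'d \<Rightarrow> real"
  where "continuous_on UNIV h" "s \<in> borel_measurable borel"
    "\<And>x. 0 \<le> s x \<and> s x \<le> 1" "\<And>x. x \<in> X \<Longrightarrow> h (s x) = x"
proof -
  obtain R where R: "0 < R" "\<And>x. x \<in> X \<Longrightarrow> norm x \<le> R" using assms by (auto simp: bounded_pos)
  obtain h :: "real \<Rightarrow> real^'d" and s :: "real^'d \<Rightarrow> real"
    where h: "continuous_on UNIV h" and s: "s \<in> borel_measurable borel" "\<And>x. 0 \<le> s x \<and> s x \<le> 1"
    and hs: "\<And>x. (\<And>i. 0 \<le> x $ i \<and> x $ i < 1) \<Longrightarrow> h (s x) = x"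
    using Schoenberg_curve by metis
  \<comment> \<open>Scaling by \<open>1 / (4 R)\<close> and shifting by \<open>b\<close> moves \<open>X\<close> into the cube \<open>[1/4, 3/4]\<^sup>d\<close>.\<close>
  define b :: "real^'d" where "b = (\<chi> i. 1/2)"
  show thesis
  proof (rule that[of "\<lambda>t. (4 * R) *\<^sub>R (h t - b)" "\<lambda>x. s ((1 / (4 * R)) *\<^sub>R x + b)"])
    show "continuous_on UNIV (\<lambda>t. (4 * R) *\<^sub>R (h t - b))" using h by (intro continuous_intros)
    have [measurable]: "(\<lambda>x. (1 / (4 * R)) *\<^sub>R x + b) \<in> borel \<rightarrow>\<^sub>M borel"
      by (intro borel_measurable_continuous_onI continuous_intros)
    show "(\<lambda>x. s ((1 / (4 * R)) *\<^sub>R x + b)) \<in> borel_measurable borel" using s(1) by measurable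
    show "0 \<le> s ((1 / (4 * R)) *\<^sub>R x + b) \<and> s ((1 / (4 * R)) *\<^sub>R x + b) \<le> 1" for x by (rule s(2))
    fix x assume x: "x \<in> X"
    have "h (s ((1 / (4 * R)) *\<^sub>R x + b)) = (1 / (4 * R)) *\<^sub>R x + b"
    proof (rule hs)
      fix i
      have "\<bar>x $ i\<bar> \<le> R" using R(2)[OF x] component_le_norm_cart[of x i] by linarith
      then have "- (1/4) \<le> x $ i / (4 * R)" "x $ i / (4 * R) \<le> 1/4" using R(1) by (auto simp: field_simps)
      then show "0 \<le> ((1 / (4 * R)) *\<^sub>R x + b) $ i \<and> ((1 / (4 * R)) *\<^sub>R x + b) $ i < 1"
        by (auto simp: b_def)
    qed
    then show "(4 * R) *\<^sub>R (h (s ((1 / (4 * R)) *\<^sub>R x + b)) - b) = x" using R(1) by simp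
  qed
qed

section \<open>Weak-* sequential compactness\<close>

lemma dirac_in_pos_measures: "dirac X x \<in> pos_measures X"
proof -
  have "(\<lambda>i. dirac X x (A i)) sums dirac X x (\<Union>i. A i)"
    if A: "range A \<subseteq> borel_sets X" "disjoint_family A" for A :: "nat \<Rightarrow> 'a set"
  proof (cases "x \<in> (\<Union>i. A i)")
    case True
    then obtain j where j: "x \<in> A j" by blast
    have "dirac X x (A i) = (if i = j then 1 else 0)" for i
      using A j by (auto simp: dirac_def disjoint_family_on_def image_subset_iff)
    moreover have "dirac X x (\<Union>i. A i) = 1"
      using True A(1) by (auto simp: dirac_def)
    ultimately show ?thesis using sums_single[of j "\<lambda>_. 1::real"] by simp
  next
    case False
    then have "dirac X x (A i) = 0" for i by (auto simp: dirac_def)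
    moreover have "dirac X x (\<Union>i. A i) = 0" using False by (auto simp: dirac_def)
    ultimately show ?thesis by simp
  qed
  then show ?thesis by (auto simp: pos_measures_def signed_measures_def dirac_def)
qed

lemma dirac_mass: "x \<in> X \<Longrightarrow> dirac X x X = 1"
  by (simp add: dirac_def)

lemma pairing_scale:
  fixes f :: "'a::topological_space \<Rightarrow> real"
  assumes "compact X" "continuous_on X f" "\<mu> \<in> pos_measures X" "0 \<le> a"
  shows "pairing X f (\<lambda>A. a * \<mu> A) = a * pairing X f \<mu>"
  using pairing_comb[OF assms(1-3,3,4), of 0] by simp

lemma pos_measures_mono:
  assumes \<mu>: "\<mu> \<in> pos_measures X" and "A \<in> borel_sets X"
  shows "\<mu> A \<le> \<mu> X"
  using signed_measure_Diff[OF pos_measures_signed[OF \<mu>] borel_sets_top assms(2)]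
    borel_sets_subset[OF assms(2)] pos_measures_nonneg[OF \<mu>, of "X - A"] by simp

text \<open>Normalise to total mass 1, with an arbitrary point mass standing in for the zero measure.\<close>

lemma pos_measure_normalise:
  assumes \<mu>: "\<mu> \<in> pos_measures X" and "X \<noteq> {}"
  obtains p where "p \<in> pos_measures X" "p X = 1" "\<mu> = (\<lambda>A. \<mu> X * p A)"
proof (cases "\<mu> X = 0")
  case True
  obtain x where "x \<in> X" using assms by blast
  moreover have "\<mu> A = 0" for A
    using pos_measures_mono[OF \<mu>, of A] pos_measures_nonneg[OF \<mu>, of A] True
      signed_measure_outside[OF pos_measures_signed[OF \<mu>], of A] by fastforce
  ultimately show ?thesis using that[of "dirac X x"] dirac_in_pos_measures dirac_mass by fastforce
next
  case False
  then show ?thesis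
    using that[OF pos_measures_scale[OF \<mu>, of "1 / \<mu> X"]] pos_measures_nonneg[OF \<mu>] by auto
qed

lemma prob_space_as_measure: "\<mu> \<in> pos_measures X \<Longrightarrow> \<mu> X = 1 \<Longrightarrow> prob_space (as_measure X \<mu>)"
  by (rule prob_spaceI) (simp add: emeasure_as_measure)

text \<open>Pushing the normalised measures to the line by a Borel right inverse of the curve reduces the
  claim to Helly's theorem; the weak limit on the line is brought back by the curve itself. It lies on
  \<open>X\<close> because the continuous function measuring the distance to \<open>X\<close> has integral 0 along the sequence.\<close>

theorem pos_measures_weak_star_compact:
  fixes X :: "(real^'d) set" and \<omega> :: "nat \<Rightarrow> (real^'d) set \<Rightarrow> real"
  assumes X: "compact X" "X \<noteq> {}" and \<omega>: "\<And>k. \<omega> k \<in> pos_measures X" "\<And>k. \<omega> k X \<le> C"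
  obtains r :: "nat \<Rightarrow> nat" and \<mu> where "strict_mono r" "\<mu> \<in> pos_measures X"
    "\<And>f. continuous_on X f \<Longrightarrow> (\<lambda>k. pairing X f (\<omega> (r k))) \<longlonglongrightarrow> pairing X f \<mu>"
proof -
  have "\<exists>p. p \<in> pos_measures X \<and> p X = 1 \<and> \<omega> k = (\<lambda>A. \<omega> k X * p A)" for k
    using pos_measure_normalise[OF \<omega>(1) X(2)] by metis
  then obtain p where p: "\<And>k. p k \<in> pos_measures X" "\<And>k. p k X = 1" "\<And>k. \<omega> k = (\<lambda>A. \<omega> k X * p k A)"
    by metis
  obtain h :: "real \<Rightarrow> real^'d" and s :: "real^'d \<Rightarrow> real"
    where h: "continuous_on UNIV h" and s[measurable]: "s \<in> borel_measurable borel"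
    and s01: "\<And>x. 0 \<le> s x \<and> s x \<le> 1" and hs: "\<And>x. x \<in> X \<Longrightarrow> h (s x) = x"
    using bounded_set_on_curve[OF compact_imp_bounded[OF X(1)]] by metis
  have h_meas[measurable]: "h \<in> borel \<rightarrow>\<^sub>M borel" by (rule borel_measurable_continuous_onI[OF h])
  have Xb[measurable]: "X \<in> sets borel" using X(1) by (simp add: borel_compact)
  have s_meas: "s \<in> borel_measurable (as_measure X \<mu>)" for \<mu>
    using measurable_restrict_space1[OF s, of X] by (simp cong: measurable_cong_sets)
  define N where "N k = distr (as_measure X (p k)) borel s" for k
  have prob: "prob_space (as_measure X (p k))" for k using p by (intro prob_space_as_measure)
  have N: "real_distribution (N k)" for k
    unfolding N_def by (rule prob_space.real_distribution_distr[OF prob s_meas])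
  have "tight N"
    unfolding tight_def
  proof (intro conjI allI impI N)
    fix \<epsilon> :: real assume "0 < \<epsilon>"
    have "measure (N k) {-1<..1} = 1" for k
    proof -
      have "s -` {-1<..1} \<inter> X = X" using s01 by (force simp: intro: less_le_trans[of "-1" 0])
      then show ?thesis
        using p(2)[of k] by (simp add: N_def measure_distr[OF s_meas] measure_as_measure[OF p(1)])
    qed
    then show "\<exists>a b. a < b \<and> (\<forall>k. 1 - \<epsilon> < measure (N k) {a<..b})"
      using \<open>0 < \<epsilon>\<close> by (intro exI[of _ "-1"] exI[of _ 1]) auto
  qed
  have "compact {0..C}" by simp
  moreover have "\<forall>k. \<omega> k X \<in> {0..C}" using \<omega>(2) pos_measures_nonneg[OF \<omega>(1)] by auto
  ultimately obtain m r1 where m: "m \<in> {0..C}" and r1: "strict_mono (r1 :: nat \<Rightarrow> nat)"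
    and mlim: "((\<lambda>k. \<omega> k X) \<circ> r1) \<longlonglongrightarrow> m"
    unfolding compact_eq_seq_compact_metric seq_compact_def by metis
  obtain r2 M where r2: "strict_mono (r2 :: nat \<Rightarrow> nat)" and M: "real_distribution M"
    and weak: "weak_conv_m (N \<circ> r1 \<circ> r2) M"
    using tight_imp_convergent_subsubsequence[OF \<open>tight N\<close> r1] by blast
  define r where "r = r1 \<circ> r2"
  have r: "strict_mono r" unfolding r_def by (rule strict_mono_o[OF r1 r2])
  have mlim': "(\<lambda>k. \<omega> (r k) X) \<longlonglongrightarrow> m"
    using LIMSEQ_subseq_LIMSEQ[OF mlim r2] by (simp add: r_def comp_def)
  interpret M: real_distribution M by fact
  have lim: "(\<lambda>k. \<integral>x. g x \<partial>as_measure X (p (r k))) \<longlonglongrightarrow> (\<integral>t. g (h t) \<partial>M)"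
    if g: "continuous_on UNIV g" "\<And>x. \<bar>g x\<bar> \<le> B" for g :: "real^'d \<Rightarrow> real" and B
  proof -
    have gh: "continuous_on UNIV (\<lambda>t. g (h t))"
      using continuous_on_compose2[OF g(1) h] by simp
    have "(\<lambda>k. \<integral>t. g (h t) \<partial>(N \<circ> r1 \<circ> r2) k) \<longlonglongrightarrow> (\<integral>t. g (h t) \<partial>M)"
    proof (rule weak_conv_imp_integral_bdd_continuous_conv[OF _ M weak, where B=B])
      show "real_distribution ((N \<circ> r1 \<circ> r2) n)" for n using N by simp
      show "isCont (\<lambda>t. g (h t)) x" for x using gh by (simp add: continuous_on_eq_continuous_at)
      show "norm (g (h x)) \<le> B" for x using g(2) by simp
    qed
    moreover have "(\<integral>t. g (h t) \<partial>N k) = (\<integral>x. g x \<partial>as_measure X (p k))" for k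
    proof -
      have "(\<integral>t. g (h t) \<partial>N k) = (\<integral>x. g (h (s x)) \<partial>as_measure X (p k))"
        unfolding N_def by (rule integral_distr[OF s_meas borel_measurable_continuous_onI[OF gh]])
      also have "\<dots> = (\<integral>x. g x \<partial>as_measure X (p k))"
        by (rule Bochner_Integration.integral_cong) (auto simp: hs)
      finally show ?thesis .
    qed
    ultimately show ?thesis by (simp add: r_def)
  qed
  have hX: "AE t in M. h t \<in> X"
  proof -
    let ?d = "\<lambda>x. min 1 (infdist x X)"
    have d: "continuous_on UNIV ?d" by (intro continuous_intros)
    have "(\<integral>x. ?d x \<partial>as_measure X (p k)) = 0" for k
    proof -
      have "(\<integral>x. ?d x \<partial>as_measure X (p k)) = (\<integral>x. 0 \<partial>as_measure X (p k))"
        by (rule Bochner_Integration.integral_cong) auto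
      then show ?thesis by simp
    qed
    then have "(\<lambda>k. 0) \<longlonglongrightarrow> (\<integral>t. ?d (h t) \<partial>M)"
      using lim[OF d, of 1] infdist_nonneg[of _ X] by simp
    then have "(\<integral>t. ?d (h t) \<partial>M) = 0" using LIMSEQ_unique[OF tendsto_const] by metis
    moreover have "integrable M (\<lambda>t. ?d (h t))"
    proof (rule M.integrable_const_bound[where B=1])
      have "continuous_on UNIV (\<lambda>t. ?d (h t))" using continuous_on_compose2[OF d h] by simp
      then show "(\<lambda>t. ?d (h t)) \<in> borel_measurable M"
        using borel_measurable_continuous_onI by (simp cong: measurable_cong_sets add: M.M_is_borel)
    qed (use infdist_nonneg[of _ X] in auto)
    ultimately have "AE t in M. ?d (h t) = 0"
      by (subst (asm) integral_nonneg_eq_0_iff_AE) (auto simp: infdist_nonneg)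
    then show ?thesis
    proof (rule AE_mp, intro AE_I2 impI)
      fix t assume "?d (h t) = 0"
      then have "infdist (h t) X = 0" by (auto simp: min_def split: if_splits)
      then show "h t \<in> X" using X in_closed_iff_infdist_zero[of X "h t"] compact_imp_closed by blast
    qed
  qed
  have hM: "h \<in> M \<rightarrow>\<^sub>M borel" by simp
  define N' where "N' = restrict_space (distr M borel h) X"
  have N'_sets: "sets N' = borel_sets X"
    unfolding N'_def sets_restrict_space by simp
  have N'_fin: "finite_measure N'"
    unfolding N'_def using M.finite_measure_distr[OF hM]
    by (intro finite_measure_restrict_space) auto
  define q where "q = measure N'"
  have q: "q \<in> pos_measures X" unfolding q_def by (rule measure_in_pos_measures[OF N'_fin N'_sets])
  have lib_q: "as_measure X q = N'" unfolding q_def by (rule as_measure_measure[OF N'_fin N'_sets])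
  have conv: "(\<lambda>k. pairing X f (p (r k))) \<longlonglongrightarrow> pairing X f q" if f: "continuous_on X f" for f
  proof -
    obtain B where B: "0 < B" "\<And>x. x \<in> X \<Longrightarrow> \<bar>f x\<bar> \<le> B"
      using continuous_compact_bounded[OF X(1) f] by metis
    obtain g where g: "continuous_on UNIV g" "\<And>x. x \<in> X \<Longrightarrow> g x = f x" "\<And>x. norm (g x) \<le> B"
    proof (rule Tietze[OF f, of UNIV B])
      show "closedin (top_of_set UNIV) X" using compact_imp_closed[OF X(1)] by simp
    qed (use B in auto)
    have [measurable]: "g \<in> borel_measurable borel" by (rule borel_measurable_continuous_onI[OF g(1)])
    have "pairing X f q = (\<integral>x. f x \<partial>N')" by (simp add: pairing_pos[OF q] lib_q)
    also have "\<dots> = (\<integral>x. g x \<partial>N')"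
      by (rule Bochner_Integration.integral_cong) (auto simp: N'_def space_restrict_space g(2))
    also have "\<dots> = (\<integral>x. indicator X x *\<^sub>R g x \<partial>distr M borel h)"
      unfolding N'_def by (rule integral_restrict_space) simp
    also have "\<dots> = (\<integral>t. indicator X (h t) *\<^sub>R g (h t) \<partial>M)"
      by (rule integral_distr[OF hM]) simp
    also have "\<dots> = (\<integral>t. g (h t) \<partial>M)"
      by (rule integral_cong_AE) (use hX in auto)
    finally have eq: "pairing X f q = (\<integral>t. g (h t) \<partial>M)" .
    have "pairing X f (p k) = (\<integral>x. g x \<partial>as_measure X (p k))" for k
      unfolding pairing_pos[OF p(1)] by (rule Bochner_Integration.integral_cong) (auto simp: g(2))
    then show ?thesis unfolding eq using lim[OF g(1), of B] g(3) by simp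
  qed
  show thesis
  proof (rule that[OF r pos_measures_scale[OF q, of m]])
    show "0 \<le> m" using m by simp
    fix f :: "real^'d \<Rightarrow> real" assume f: "continuous_on X f"
    have "pairing X f (\<omega> k) = \<omega> k X * pairing X f (p k)" for k
      using pairing_scale[OF X(1) f p(1), of "\<omega> k X" k] p(3)[of k] pos_measures_nonneg[OF \<omega>(1)] by metis
    moreover have "pairing X f (\<lambda>A. m * q A) = m * pairing X f q"
      using m by (intro pairing_scale X f q) auto
    ultimately show "(\<lambda>k. pairing X f (\<omega> (r k))) \<longlonglongrightarrow> pairing X f (\<lambda>A. m * q A)"
      using tendsto_mult[OF mlim' conv[OF f]] by simp
  qed
qed

section \<open>Weak-* accumulation points\<close>

text \<open>The open sets that contain a tail of the subsequence as soon as they contain \<open>\<mu>\<close> include the subbasic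
  ones and are stable under unions and finite intersections.\<close>

lemma weak_star_accumulation_pointI:
  assumes r: "strict_mono r" and \<omega>: "\<And>k. \<omega> (r k) \<in> signed_measures X" and \<mu>: "\<mu> \<in> signed_measures X"
    and lim: "\<And>f. continuous_on X f \<Longrightarrow> (\<lambda>k. pairing X f (\<omega> (r k))) \<longlonglongrightarrow> pairing X f \<mu>"
  shows "weak_star_accumulation_point X \<omega> \<mu>"
  unfolding weak_star_accumulation_point_def
proof (intro conjI \<mu> allI impI)
  fix V assume V: "openin (weak_star X) V \<and> \<mu> \<in> V"
  let ?S = "{{\<mu> \<in> signed_measures X. pairing X f \<mu> \<in> U} | f U. continuous_on X f \<and> open U}"
  have "generate_topology_on ?S V"
    using V by (auto simp: weak_star_def openin_topology_generated_by_iff)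
  then have "\<mu> \<in> V \<longrightarrow> (\<forall>\<^sub>F k in sequentially. \<omega> (r k) \<in> V)"
  proof induction
    case (UN K)
    show ?case
    proof
      assume "\<mu> \<in> \<Union>K"
      then obtain W where W: "W \<in> K" "\<mu> \<in> W" by blast
      have "\<forall>\<^sub>F k in sequentially. \<omega> (r k) \<in> W" using UN.IH[OF W(1)] W(2) by simp
      then show "\<forall>\<^sub>F k in sequentially. \<omega> (r k) \<in> \<Union>K"
        by eventually_elim (rule UnionI[OF W(1)])
    qed
  next
    case (Basis V)
    then obtain f U where V: "V = {\<mu> \<in> signed_measures X. pairing X f \<mu> \<in> U}"
      and fU: "continuous_on X f" "open U" by blast
    show ?case
    proof
      assume "\<mu> \<in> V"
      then have "\<forall>\<^sub>F k in sequentially. pairing X f (\<omega> (r k)) \<in> U"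
        using lim[OF fU(1)] fU(2) V by (auto simp: tendsto_def)
      then show "\<forall>\<^sub>F k in sequentially. \<omega> (r k) \<in> V" by (rule eventually_mono) (simp add: V \<omega>)
    qed
  qed (auto elim: eventually_elim2)
  then obtain K where K: "\<And>k. K \<le> k \<Longrightarrow> \<omega> (r k) \<in> V" using V by (auto simp: eventually_sequentially)
  have "r ` {Suc K..} \<subseteq> {k. 1 \<le> k \<and> \<omega> k \<in> V}"
  proof (clarify)
    fix k assume "Suc K \<le> k"
    then show "1 \<le> r k \<and> \<omega> (r k) \<in> V" using K[of k] seq_suble[OF r, of k] by simp
  qed
  moreover have "infinite (r ` {Suc K..})"
    using r by (simp add: finite_image_iff strict_mono_imp_inj_on infinite_Ici)
  ultimately show "infinite {k. 1 \<le> k \<and> \<omega> k \<in> V}" using finite_subset by blast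
qed

lemma openin_weak_star_finite:
  assumes "finite G" "\<And>f. f \<in> G \<Longrightarrow> continuous_on X f"
  shows "openin (weak_star X) {\<nu> \<in> signed_measures X. \<forall>f\<in>G. \<bar>pairing X f \<nu> - c f\<bar> < \<epsilon>}"
  using assms
proof (induction G rule: finite_induct)
  case empty
  have "\<exists>f U. {\<nu> \<in> signed_measures X. True} = {\<mu> \<in> signed_measures X. pairing X f \<mu> \<in> U}
      \<and> continuous_on X f \<and> open U"
    by (rule exI[of _ "\<lambda>x. 0"], rule exI[of _ UNIV]) simp
  then show ?case
    unfolding weak_star_def openin_topology_generated_by_iff
    by (intro generate_topology_on.Basis) simp
next
  case (insert g G)
  have "{\<nu> \<in> signed_measures X. \<bar>pairing X g \<nu> - c g\<bar> < \<epsilon>} = {\<nu> \<in> signed_measures X. pairing X g \<nu> \<in> ball (c g) \<epsilon>}"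
    by (auto simp: dist_real_def)
  then have "openin (weak_star X) {\<nu> \<in> signed_measures X. \<bar>pairing X g \<nu> - c g\<bar> < \<epsilon>}"
    unfolding weak_star_def openin_topology_generated_by_iff
    using insert.prems by (intro generate_topology_on.Basis) blast
  then have "openin (weak_star X) ({\<nu> \<in> signed_measures X. \<bar>pairing X g \<nu> - c g\<bar> < \<epsilon>}
      \<inter> {\<nu> \<in> signed_measures X. \<forall>f\<in>G. \<bar>pairing X f \<nu> - c f\<bar> < \<epsilon>})"
    using insert by (intro openin_Int) auto
  then show ?case by (rule back_subst[of "openin (weak_star X)"]) auto
qed

lemma weak_star_accumulation_frequently:
  assumes acc: "weak_star_accumulation_point X \<omega> \<mu>" and G: "finite G" "\<And>f. f \<in> G \<Longrightarrow> continuous_on X f"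
    and "0 < \<epsilon>"
  shows "infinite {k. 1 \<le> k \<and> (\<forall>f\<in>G. \<bar>pairing X f (\<omega> k) - pairing X f \<mu>\<bar> < \<epsilon>)}"
proof -
  let ?V = "{\<nu> \<in> signed_measures X. \<forall>f\<in>G. \<bar>pairing X f \<nu> - pairing X f \<mu>\<bar> < \<epsilon>}"
  have "openin (weak_star X) ?V" by (rule openin_weak_star_finite[OF G])
  moreover have "\<mu> \<in> ?V" using acc \<open>0 < \<epsilon>\<close> by (simp add: weak_star_accumulation_point_def)
  ultimately have "infinite {k. 1 \<le> k \<and> \<omega> k \<in> ?V}"
    using acc unfolding weak_star_accumulation_point_def by blast
  moreover have "{k. 1 \<le> k \<and> \<omega> k \<in> ?V} \<subseteq> {k. 1 \<le> k \<and> (\<forall>f\<in>G. \<bar>pairing X f (\<omega> k) - pairing X f \<mu>\<bar> < \<epsilon>)}"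
    by blast
  ultimately show ?thesis using finite_subset by blast
qed

lemma integral_tent_limit:
  fixes X F :: "(real^'d) set"
  assumes X: "compact X" and F: "closed F" "F \<noteq> {}" "F \<subseteq> X" and \<nu>: "\<nu> \<in> pos_measures X"
  shows "(\<lambda>n. \<integral>x. max 0 (1 - real n * infdist x F) \<partial>as_measure X \<nu>) \<longlonglongrightarrow> \<nu> F"
proof -
  interpret finite_measure "as_measure X \<nu>" by (rule finite_measure_as_measure[OF \<nu>])
  have F_sets: "F \<in> borel_sets X" using F by (auto simp: sets_restrict_space)
  have "(\<lambda>n. \<integral>x. max 0 (1 - real n * infdist x F) \<partial>as_measure X \<nu>)
      \<longlonglongrightarrow> (\<integral>x. indicator F x \<partial>as_measure X \<nu>)"
  proof (rule integral_dominated_convergence[where w="\<lambda>x. 1"])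
    show "(indicator F :: _ \<Rightarrow> real) \<in> borel_measurable (as_measure X \<nu>)"
      using F_sets by (intro borel_measurable_indicator) simp
    show "(\<lambda>x. max 0 (1 - real n * infdist x F)) \<in> borel_measurable (as_measure X \<nu>)" for n
      by (intro measurable_continuous_as_measure continuous_intros)
    show "AE x in as_measure X \<nu>. (\<lambda>n. max 0 (1 - real n * infdist x F)) \<longlonglongrightarrow> indicator F x"
    proof (rule AE_I2)
      fix x
      show "(\<lambda>n. max 0 (1 - real n * infdist x F)) \<longlonglongrightarrow> indicator F x"
      proof (cases "x \<in> F")
        case True then show ?thesis by simp
      next
        case False
        then have pos: "0 < infdist x F" by (rule infdist_pos_not_in_closed[OF F(1,2)])
        obtain K where K: "1 < real K * infdist x F" using ex_less_of_nat_mult[OF pos] by blast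
        have "max 0 (1 - real n * infdist x F) = 0" if "K \<le> n" for n
        proof -
          have "real K * infdist x F \<le> real n * infdist x F" using pos that by (intro mult_right_mono) auto
          then show ?thesis using K by linarith
        qed
        then have "\<forall>\<^sub>F n in sequentially. max 0 (1 - real n * infdist x F) = indicator F x"
          using False by (auto simp: eventually_sequentially)
        then show ?thesis by (rule tendsto_eventually)
      qed
    qed
    show "AE x in as_measure X \<nu>. norm (max 0 (1 - real n * infdist x F)) \<le> 1" for n
      by (rule AE_I2) (auto simp: infdist_nonneg)
  qed simp
  also have "(\<integral>x. indicator F x \<partial>as_measure X \<nu>) = \<nu> F"
    using F(3) by (simp add: measure_as_measure[OF \<nu>] Int_absorb2)
  finally show ?thesis .
qed

text \<open>Tent functions decrease to the indicator of a closed set, which settles closed sets; a Borel set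
  is filled up to a small error of the negative Jordan part by a compact subset.\<close>

lemma signed_measure_pos_if_pairing_nonneg:
  fixes X :: "(real^'d) set"
  assumes X: "compact X" and \<mu>: "\<mu> \<in> signed_measures X"
    and nonneg: "\<And>f. continuous_on X f \<Longrightarrow> (\<And>x. x \<in> X \<Longrightarrow> 0 \<le> f x) \<Longrightarrow> 0 \<le> pairing X f \<mu>"
  shows "\<mu> \<in> pos_measures X"
proof -
  obtain \<nu>\<^sub>1 \<nu>\<^sub>2 where \<nu>: "\<nu>\<^sub>1 \<in> pos_measures X" "\<nu>\<^sub>2 \<in> pos_measures X"
    and diff: "\<And>A. \<mu> A = \<nu>\<^sub>1 A - \<nu>\<^sub>2 A"
    and pair: "\<And>f. pairing X f \<mu> = (\<integral>x. f x \<partial>as_measure X \<nu>\<^sub>1) - (\<integral>x. f x \<partial>as_measure X \<nu>\<^sub>2)"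
    using pairing_Jordan[OF \<mu>] by metis
  have closed: "0 \<le> \<mu> F" if F: "closed F" "F \<subseteq> X" for F
  proof (cases "F = {}")
    case True then show ?thesis using \<mu> by simp
  next
    case False
    note lim = integral_tent_limit[OF X F(1) False F(2)]
    have "(\<lambda>n. pairing X (\<lambda>x. max 0 (1 - real n * infdist x F)) \<mu>) \<longlonglongrightarrow> \<mu> F"
      unfolding pair diff by (intro tendsto_diff lim \<nu>)
    then show ?thesis
      by (rule LIMSEQ_le_const) (auto intro!: exI[of _ 0] nonneg continuous_intros)
  qed
  have "0 \<le> \<mu> A" for A
  proof (cases "A \<in> borel_sets X")
    case False then show ?thesis using signed_measure_outside[OF \<mu>] by simp
  next
    case True
    have Xb: "X \<in> sets borel" using X by (simp add: borel_compact)
    have id: "(\<lambda>x. x) \<in> as_measure X \<nu>\<^sub>2 \<rightarrow>\<^sub>M borel"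
    proof -
      have "(\<lambda>x. x) \<in> restrict_space borel X \<rightarrow>\<^sub>M borel"
        by (rule measurable_restrict_space1) simp
      then show ?thesis by (simp cong: measurable_cong_sets)
    qed
    define M where "M = distr (as_measure X \<nu>\<^sub>2) borel (\<lambda>x. x)"
    have em: "emeasure M B = ennreal (\<nu>\<^sub>2 B)" if "B \<in> sets borel" "B \<subseteq> X" for B
    proof -
      have "B \<in> borel_sets X" using that by (auto simp: sets_restrict_space)
      then show ?thesis
        unfolding M_def using that
        by (subst emeasure_distr[OF id]) (auto simp: Int_absorb2 emeasure_as_measure[OF \<nu>(2)])
    qed
    have A: "A \<in> sets borel" "A \<subseteq> X"
      using True Xb borel_sets_subset[OF True] by (auto simp: sets_restrict_space_iff)
    have fin: "emeasure M (space M) \<noteq> \<infinity>"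
      unfolding M_def by (subst emeasure_distr[OF id]) (auto simp: emeasure_as_measure[OF \<nu>(2)])
    have reg: "emeasure M A = (SUP K \<in> {K. K \<subseteq> A \<and> compact K}. emeasure M K)"
      by (rule inner_regular[OF _ fin A(1)]) (simp add: M_def)
    show ?thesis
    proof (rule field_le_epsilon[of 0 "\<mu> A", simplified])
      fix \<epsilon> :: real assume "0 < \<epsilon>"
      have "\<exists>K. K \<subseteq> A \<and> compact K \<and> \<nu>\<^sub>2 A - \<epsilon> \<le> \<nu>\<^sub>2 K"
      proof (cases "\<nu>\<^sub>2 A = 0")
        case True
        then show ?thesis
          using \<open>0 < \<epsilon>\<close> pos_measures_nonneg[OF \<nu>(2), of "{}"] by (intro exI[of _ "{}"]) auto
      next
        case False
        then have "0 < \<nu>\<^sub>2 A" using pos_measures_nonneg[OF \<nu>(2), of A] by simp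
        then have "ennreal (\<nu>\<^sub>2 A - \<epsilon>) < ennreal (\<nu>\<^sub>2 A)" using \<open>0 < \<epsilon>\<close> by (simp add: ennreal_lessI)
        then obtain K where K: "K \<subseteq> A" "compact K" "ennreal (\<nu>\<^sub>2 A - \<epsilon>) < emeasure M K"
          using reg em[OF A] by (auto simp: less_SUP_iff)
        then have "ennreal (\<nu>\<^sub>2 A - \<epsilon>) < ennreal (\<nu>\<^sub>2 K)" using em[of K] A(2) by (auto simp: borel_compact)
        then have "\<not> \<nu>\<^sub>2 K \<le> \<nu>\<^sub>2 A - \<epsilon>" using ennreal_leI[of "\<nu>\<^sub>2 K" "\<nu>\<^sub>2 A - \<epsilon>"] by auto
        then have "\<nu>\<^sub>2 A - \<epsilon> \<le> \<nu>\<^sub>2 K" by simp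
        with K show ?thesis by blast
      qed
      then obtain K where K: "K \<subseteq> A" "compact K" "\<nu>\<^sub>2 A - \<epsilon> \<le> \<nu>\<^sub>2 K" by blast
      have Kb: "K \<in> borel_sets X" using K A Xb by (auto simp: sets_restrict_space_iff borel_compact)
      have "0 \<le> \<mu> K" using K A by (intro closed) (auto simp: compact_imp_closed)
      moreover have "\<nu>\<^sub>1 K \<le> \<nu>\<^sub>1 A"
        using signed_measure_Diff[OF pos_measures_signed[OF \<nu>(1)] True Kb K(1)]
          pos_measures_nonneg[OF \<nu>(1), of "A - K"] by linarith
      ultimately show "0 \<le> \<mu> A + \<epsilon>" using K(3) diff[of A] diff[of K] by linarith
    qed
  qed
  then show ?thesis using \<mu> by (simp add: pos_measures_def)
qed

lemma weak_star_accumulation_point_pos: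
  fixes X :: "(real^'d) set"
  assumes X: "compact X" and \<omega>: "\<And>k. 1 \<le> k \<Longrightarrow> \<omega> k \<in> pos_measures X"
    and acc: "weak_star_accumulation_point X \<omega> \<mu>"
  shows "\<mu> \<in> pos_measures X"
proof (rule signed_measure_pos_if_pairing_nonneg[OF X])
  show "\<mu> \<in> signed_measures X" using acc by (simp add: weak_star_accumulation_point_def)
  fix f :: "real^'d \<Rightarrow> real"
  assume f: "continuous_on X f" "\<And>x. x \<in> X \<Longrightarrow> 0 \<le> f x"
  show "0 \<le> pairing X f \<mu>"
  proof (rule field_le_epsilon[of 0 "pairing X f \<mu>", simplified])
    fix \<epsilon> :: real assume "0 < \<epsilon>"
    then have "infinite {k. 1 \<le> k \<and> (\<forall>g\<in>{f}. \<bar>pairing X g (\<omega> k) - pairing X g \<mu>\<bar> < \<epsilon>)}"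
      using f by (intro weak_star_accumulation_frequently[OF acc]) auto
    then have "{k. 1 \<le> k \<and> (\<forall>g\<in>{f}. \<bar>pairing X g (\<omega> k) - pairing X g \<mu>\<bar> < \<epsilon>)} \<noteq> {}"
      by (rule infinite_imp_nonempty)
    then obtain k where k: "1 \<le> k" "\<bar>pairing X f (\<omega> k) - pairing X f \<mu>\<bar> < \<epsilon>"
      by auto
    have "pairing X (\<lambda>x. 0) (\<omega> k) \<le> pairing X f (\<omega> k)"
      using f by (intro pairing_pos_mono X \<omega> k) auto
    then show "0 \<le> pairing X f \<mu> + \<epsilon>" using k(2) pairing_const[OF \<omega>[OF k(1)], of 0] by linarith
  qed
qed

section \<open>Semidefinite matrices\<close>

definition outer :: "real^'n \<Rightarrow> real^'n^'n" where
  "outer z = (\<chi> k l. z $ k * z $ l)"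

lemma inner_outer: "A \<bullet> outer z = z \<bullet> (A *v z)"
  by (simp add: outer_def inner_vec_def matrix_vector_mult_def sum_distrib_left algebra_simps)

lemma continuous_on_outer [continuous_intros]:
  "continuous_on S f \<Longrightarrow> continuous_on S (\<lambda>x. outer (f x))"
  unfolding outer_def by (intro continuous_intros)

lemma norm_matrix_le:
  fixes A :: "real^'n^'m"
  assumes "\<And>k l. \<bar>A $ k $ l\<bar> \<le> c"
  shows "norm A \<le> real CARD('m) * (real CARD('n) * c)"
proof -
  have "norm A \<le> (\<Sum>k\<in>UNIV. norm (A $ k))"
    unfolding norm_vec_def[of A] by (rule L2_set_le_sum) simp
  also have "\<dots> \<le> (\<Sum>k\<in>(UNIV :: 'm set). real CARD('n) * c)"
  proof (rule sum_mono)
    fix k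
    have "norm (A $ k) \<le> (\<Sum>l\<in>UNIV. \<bar>A $ k $ l\<bar>)" by (rule norm_le_l1_cart)
    also have "\<dots> \<le> (\<Sum>l\<in>(UNIV :: 'n set). c)" by (rule sum_mono) (rule assms)
    finally show "norm (A $ k) \<le> real CARD('n) * c" by simp
  qed
  finally show ?thesis by simp
qed

lemma Sym_iff: "A \<in> Sym \<longleftrightarrow> (\<forall>k l. A $ k $ l = A $ l $ k)"
  by (auto simp: Sym_def transpose_def vec_eq_iff)

lemma NND_iff: "A \<in> NND \<longleftrightarrow> A \<in> Sym \<and> (\<forall>z. 0 \<le> A \<bullet> outer z)"
  by (simp add: NND_def inner_outer)

lemma PD_iff: "A \<in> PD \<longleftrightarrow> A \<in> Sym \<and> (\<forall>z. z \<noteq> 0 \<longrightarrow> 0 < A \<bullet> outer z)"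
  by (simp add: PD_def inner_outer)

lemma PD_subset_NND: "PD \<subseteq> NND"
proof
  fix A :: "real^'n^'n" assume A: "A \<in> PD"
  have "A \<bullet> outer 0 = 0" by (simp add: inner_outer)
  then have "0 \<le> A \<bullet> outer z" for z using A by (cases "z = 0") (auto simp: PD_iff less_imp_le)
  then show "A \<in> NND" using A by (simp add: NND_iff PD_iff)
qed

lemma Sym_comb: "A \<in> Sym \<Longrightarrow> B \<in> Sym \<Longrightarrow> a *\<^sub>R A + b *\<^sub>R B \<in> Sym"
  by (simp add: Sym_iff)

lemma NND_comb: "A \<in> NND \<Longrightarrow> B \<in> NND \<Longrightarrow> 0 \<le> a \<Longrightarrow> 0 \<le> b \<Longrightarrow> a *\<^sub>R A + b *\<^sub>R B \<in> NND"
  by (auto simp: NND_iff Sym_comb inner_add_left)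

lemma PD_NND_comb: "A \<in> PD \<Longrightarrow> B \<in> NND \<Longrightarrow> 0 < a \<Longrightarrow> 0 \<le> b \<Longrightarrow> a *\<^sub>R A + b *\<^sub>R B \<in> PD"
  by (auto simp: NND_iff PD_iff Sym_comb inner_add_left intro!: add_pos_nonneg)

lemma closed_NND: "closed (NND :: (real^'n^'n) set)"
proof -
  have eq: "(NND :: (real^'n^'n) set) = (\<Inter>k. \<Inter>l. {A. A $ k $ l = A $ l $ k}) \<inter> (\<Inter>z. {A. 0 \<le> A \<bullet> outer z})"
    by (auto simp: NND_iff Sym_iff)
  show ?thesis
    unfolding eq by (intro closed_Int closed_INT ballI closed_Collect_eq closed_Collect_le continuous_intros)
qed

section \<open>Line search\<close>

text \<open>The bound on the slope is available only where the function does not exceed its initial value. By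
  continuity the graph cannot climb back to that value before the parabola bounding it does.\<close>

lemma sufficient_decrease:
  fixes h h' :: "real \<Rightarrow> real"
  assumes s: "0 \<le> s" and deriv: "\<And>t. t \<in> {0..s} \<Longrightarrow> (h has_real_derivative h' t) (at t within {0..s})"
    and h'0: "h' 0 = - P" and P: "0 < P" and \<alpha>: "0 < \<alpha>" and K: "0 \<le> K"
    and slope: "\<And>t. t \<in> {0..s} \<Longrightarrow> h t \<le> h 0 \<Longrightarrow> h' t \<le> - P + K * t"
    and sK: "K * s \<le> 2 * (1 - \<alpha>) * P"
  shows "h s \<le> h 0 - \<alpha> * s * P"
proof -
  have cont: "continuous_on {0..s} h"
    using deriv by (intro DERIV_continuous_on)
  have descend: "h t \<le> h 0 - \<alpha> * t * P" if t: "t \<in> {0..s}" and below: "\<And>\<tau>. \<tau> \<in> {0..t} \<Longrightarrow> h \<tau> \<le> h 0" for t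
  proof -
    define u where "u \<tau> = h \<tau> + P * \<tau> - K * \<tau>\<^sup>2 / 2" for \<tau>
    have "u t \<le> u 0"
    proof (rule DERIV_nonpos_imp_decreasing_open[where f=u and a=0 and b=t])
      show "0 \<le> t" using t by simp
      show "continuous_on {0..t} u"
        unfolding u_def by (intro continuous_intros continuous_on_subset[OF cont]) (use t in auto)
      fix \<tau> assume \<tau>: "0 < \<tau>" "\<tau> < t"
      have "(h has_real_derivative h' \<tau>) (at \<tau>)"
        using deriv[of \<tau>] \<tau> t by (simp add: at_within_Icc_at)
      then have "(u has_real_derivative h' \<tau> + P - K * \<tau>) (at \<tau>)"
        unfolding u_def by (auto intro!: derivative_eq_intros)
      moreover have "h' \<tau> + P - K * \<tau> \<le> 0" using slope[of \<tau>] below[of \<tau>] \<tau> t by simp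
      ultimately show "\<exists>y. (u has_real_derivative y) (at \<tau>) \<and> y \<le> 0" by blast
    qed
    moreover have "K * t\<^sup>2 / 2 \<le> (1 - \<alpha>) * P * t"
    proof -
      have "K * t \<le> K * s" using t K by (intro mult_left_mono) auto
      then have "K * t * t \<le> 2 * (1 - \<alpha>) * P * t" using sK t by (intro mult_right_mono) auto
      then show ?thesis by (simp add: power2_eq_square algebra_simps)
    qed
    ultimately show ?thesis by (simp add: u_def algebra_simps)
  qed
  have "h t \<le> h 0" if t: "t \<in> {0..s}" for t
  proof (rule ccontr)
    assume "\<not> ?thesis"
    define B where "B = {t \<in> {0..s}. h 0 < h t}"
    have ne: "B \<noteq> {}" using t \<open>\<not> h t \<le> h 0\<close> by (auto simp: B_def)
    have bdd: "bdd_below B" by (rule bdd_belowI[of _ 0]) (auto simp: B_def)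
    \<comment> \<open>Up to \<open>t0\<close> the slope bound is available, so \<open>h t0\<close> lies strictly below \<open>h 0\<close> (or \<open>t0 = 0\<close>, where
      \<open>h\<close> decreases); either way \<open>h\<close> stays below \<open>h 0\<close> for a while after \<open>t0\<close>.\<close>
    define t0 where "t0 = Inf B"
    have lower: "t0 \<le> b" if "b \<in> B" for b unfolding t0_def by (rule cInf_lower[OF that bdd])
    have "0 \<le> t0" unfolding t0_def by (rule cInf_greatest[OF ne]) (auto simp: B_def)
    have near: "\<exists>b\<in>B. b < c" if "t0 < c" for c
      using that cInf_less_iff[OF ne bdd] unfolding t0_def by blast
    obtain b0 where "b0 \<in> B" using ne by blast
    then have t0: "t0 \<in> {0..s}" using lower[of b0] \<open>0 \<le> t0\<close> by (auto simp: B_def)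
    have before: "h \<tau> \<le> h 0" if "0 \<le> \<tau>" "\<tau> < t0" for \<tau>
    proof -
      have "\<tau> \<notin> B" using lower[of \<tau>] that by auto
      then show ?thesis using that t0 by (auto simp: B_def)
    qed
    have at_t0: "h t0 \<le> h 0"
    proof (rule ccontr)
      assume *: "\<not> h t0 \<le> h 0"
      then have "0 < t0" using \<open>0 \<le> t0\<close> by (cases "t0 = 0") auto
      obtain \<delta> where \<delta>: "0 < \<delta>" "\<And>\<tau>. \<tau> \<in> {0..s} \<Longrightarrow> dist \<tau> t0 < \<delta> \<Longrightarrow> dist (h \<tau>) (h t0) < h t0 - h 0"
        using cont t0 * unfolding continuous_on_iff by (metis diff_gt_0_iff_gt not_le)
      define \<tau> where "\<tau> = max 0 (t0 - \<delta> / 2)"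
      have \<tau>: "0 \<le> \<tau>" "\<tau> < t0" "dist \<tau> t0 < \<delta>"
        using \<open>0 < t0\<close> \<delta>(1) by (auto simp: \<tau>_def dist_real_def)
      then have "dist (h \<tau>) (h t0) < h t0 - h 0" using t0 by (intro \<delta>) auto
      then show False using before[OF \<tau>(1,2)] by (simp add: dist_real_def)
    qed
    have below: "h \<tau> \<le> h 0" if "\<tau> \<in> {0..t0}" for \<tau>
      using before[of \<tau>] at_t0 that by (cases "\<tau> = t0") auto
    show False
    proof (cases "t0 = 0")
      case True
      obtain d where d: "0 < d" "\<And>\<epsilon>. 0 < \<epsilon> \<Longrightarrow> 0 + \<epsilon> \<in> {0..s} \<Longrightarrow> \<epsilon> < d \<Longrightarrow> h (0 + \<epsilon>) < h 0"
        using has_real_derivative_neg_dec_right[OF deriv[of 0]] s P h'0 by auto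
      obtain b where b: "b \<in> B" "b < d" using near[of d] d(1) True by auto
      then have "0 < b" using lower[OF b(1)] True by (cases "b = 0") (auto simp: B_def)
      then show False using d(2)[of b] b by (auto simp: B_def)
    next
      case False
      then have "0 < t0" using \<open>0 \<le> t0\<close> by simp
      then have "h t0 < h 0" using descend[OF t0 below] \<alpha> P mult_pos_pos[OF mult_pos_pos[OF \<alpha> \<open>0 < t0\<close>] P] by linarith
      then obtain \<delta> where \<delta>: "0 < \<delta>" "\<And>\<tau>. \<tau> \<in> {0..s} \<Longrightarrow> dist \<tau> t0 < \<delta> \<Longrightarrow> dist (h \<tau>) (h t0) < h 0 - h t0"
        using cont t0 unfolding continuous_on_iff by (metis diff_gt_0_iff_gt)
      obtain b where b: "b \<in> B" "b < t0 + \<delta>" using near[of "t0 + \<delta>"] \<delta>(1) by auto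
      then have "dist (h b) (h t0) < h 0 - h t0"
        using lower[OF b(1)] by (intro \<delta>) (auto simp: B_def dist_real_def)
      then show False using b(1) by (auto simp: B_def dist_real_def)
    qed
  qed
  then show ?thesis using descend[of s] s by auto
qed

lemma phi_eq: "0 < M \<Longrightarrow> phi M t = t + (max 0 (t - M))\<^sup>2 / (2 * M)"
  by (auto simp: phi_def field_simps power2_eq_square)

lemma phi_ge: "0 < M \<Longrightarrow> t \<le> phi M t"
  by (simp add: phi_eq)

text \<open>Convexity of \<open>\<phi>\<close> along chords that start on its linear part: \<open>\<phi>(t)\<close> is \<open>t\<close> plus a multiple of the
  squared excess \<open>max 0 (t - M)\<close>, and the excess at the intermediate point is at most \<open>s\<close> times the
  excess at \<open>b\<close>.\<close>

lemma phi_chord: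
  assumes M: "0 < M" and a: "0 \<le> a" "a \<le> M" and s: "0 \<le> s" "s \<le> 1" and b: "0 \<le> b"
  shows "phi M ((1 - s) * a + s * b) \<le> (1 - s) * a + s * phi M b"
proof (cases "(1 - s) * a + s * b \<le> M")
  case True
  then show ?thesis using phi_ge[OF M, of b] s by (simp add: phi_def mult_left_mono)
next
  case False
  then have c: "0 < (1 - s) * a + s * b - M" by simp
  have "(1 - s) * (a - M) \<le> 0" using a s by (intro mult_nonneg_nonpos) auto
  then have cb: "(1 - s) * a + s * b - M \<le> s * (b - M)" by (simp add: algebra_simps)
  then have bM: "0 < b - M" using c s by (smt (verit) mult_nonneg_nonpos)
  have "((1 - s) * a + s * b - M)\<^sup>2 \<le> (s * (b - M))\<^sup>2"
    using c cb by (intro power_mono) auto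
  also have "\<dots> = s * (s * (b - M)\<^sup>2)" by (simp add: power2_eq_square)
  also have "\<dots> \<le> 1 * (s * (b - M)\<^sup>2)" using s by (intro mult_right_mono) auto
  finally have "((1 - s) * a + s * b - M)\<^sup>2 / (2 * M) \<le> s * (b - M)\<^sup>2 / (2 * M)"
    using M by (intro divide_right_mono) auto
  then show ?thesis using c bM by (simp add: phi_eq[OF M] algebra_simps)
qed

section \<open>The information matrix\<close>

lemma tv_norm_signed_nonneg: "\<mu> \<in> signed_measures X \<Longrightarrow> 0 \<le> tv_norm X \<mu>"
  by (metis add_nonneg_nonneg pairing_Jordan pos_measures_nonneg)

lemma move_in_pos_measures:
  "\<omega> \<in> pos_measures X \<Longrightarrow> v \<in> pos_measures X \<Longrightarrow> 0 \<le> s \<Longrightarrow> s \<le> 1 \<Longrightarrow> move s \<omega> v \<in> pos_measures X"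
  unfolding move_def by (rule pos_measures_comb) auto

text \<open>Here \<open>D\<close> is the vector of partial derivatives of the state, and the objective sees a measure only
  through its total mass and the matrix \<open>info \<omega>\<close>, an affine image of \<open>\<omega>\<close> in the semidefinite cone.\<close>

locale sensor_problem =
  fixes X :: "(real^'d) set" and D :: "real^'d \<Rightarrow> real^'n" and I0 :: "real^'n^'n"
    and \<Psi> :: "real^'n^'n \<Rightarrow> ereal" and \<Psi>' :: "real^'n^'n \<Rightarrow> real^'n^'n" and \<beta> :: real
  assumes compact_X: "compact X" and X_ne: "X \<noteq> {}" and D_cont: "continuous_on X D"
    and I0: "I0 \<in> NND" and \<beta>: "0 < \<beta>"
    and dom: "{N \<in> Sym. \<Psi> N < \<infinity>} = PD" and C1: "C1_on_PD \<Psi> \<Psi>'"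
    and nonneg: "\<And>N. N \<in> NND \<Longrightarrow> 0 \<le> \<Psi> N"
    and lsc: "lsc_on NND \<Psi>" and conv: "ereal_convex_on NND \<Psi>"
    and lip: "\<And>K. compact K \<Longrightarrow> K \<subseteq> PD \<Longrightarrow> \<exists>L. L-lipschitz_on K \<Psi>'"
begin

definition info :: "((real^'d) set \<Rightarrow> real) \<Rightarrow> real^'n^'n" where
  "info \<omega> = fisher X D \<omega> + I0"

definition \<Psi>r :: "real^'n^'n \<Rightarrow> real" where
  "\<Psi>r N = real_of_ereal (\<Psi> N)"

abbreviation "d\<psi> \<equiv> dpsi X D I0 \<Psi>'"
abbreviation "F \<equiv> obj X D I0 \<Psi> \<beta>"

lemma continuous_outer_D [continuous_intros]: "continuous_on X (\<lambda>x. outer (D x))"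
  by (intro continuous_intros D_cont)

text \<open>The adjoint of the information operator sends a matrix \<open>A\<close> to the function \<open>D(x)\<^sup>T A D(x)\<close>. This
  identifies \<open>\<psi>'(\<omega>)\<close> with a continuous function.\<close>

lemma inner_fisher:
  assumes \<omega>: "\<omega> \<in> pos_measures X"
  shows "A \<bullet> fisher X D \<omega> = pairing X (\<lambda>x. A \<bullet> outer (D x)) \<omega>"
proof -
  have int: "integrable (as_measure X \<omega>) (\<lambda>x. D x $ k * D x $ l)" for k l
    by (intro integrable_as_measure compact_X \<omega> continuous_intros D_cont)
  have "pairing X (\<lambda>x. A \<bullet> outer (D x)) \<omega>
      = (\<integral>x. (\<Sum>k\<in>UNIV. \<Sum>l\<in>UNIV. A $ k $ l * (D x $ k * D x $ l)) \<partial>as_measure X \<omega>)"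
    by (simp add: pairing_pos[OF \<omega>] inner_vec_def outer_def)
  also have "\<dots> = (\<Sum>k\<in>UNIV. \<Sum>l\<in>UNIV. A $ k $ l * (\<integral>x. D x $ k * D x $ l \<partial>as_measure X \<omega>))"
    using int by (simp add: Bochner_Integration.integral_sum)
  also have "\<dots> = A \<bullet> fisher X D \<omega>"
    by (simp add: fisher_def pairing_pos[OF \<omega>] inner_vec_def)
  finally show ?thesis by simp
qed

lemma fisher_NND: "\<omega> \<in> pos_measures X \<Longrightarrow> fisher X D \<omega> \<in> NND"
proof -
  assume \<omega>: "\<omega> \<in> pos_measures X"
  have "0 \<le> fisher X D \<omega> \<bullet> outer z" for z
  proof -
    have "outer z \<bullet> outer (D x) = (z \<bullet> D x)\<^sup>2" for x
      by (simp add: outer_def inner_vec_def power2_eq_square sum_product algebra_simps)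
    then have "pairing X (\<lambda>x. 0) \<omega> \<le> pairing X (\<lambda>x. outer z \<bullet> outer (D x)) \<omega>"
      by (intro pairing_pos_mono compact_X \<omega> continuous_intros) auto
    then show ?thesis
      unfolding inner_fisher[OF \<omega>, symmetric] pairing_const[OF \<omega>] by (simp add: inner_commute)
  qed
  moreover have "fisher X D \<omega> \<in> Sym" by (simp add: Sym_iff fisher_def mult.commute)
  ultimately show ?thesis by (simp add: NND_iff)
qed

lemma info_NND: "\<omega> \<in> pos_measures X \<Longrightarrow> info \<omega> \<in> NND"
  using NND_comb[OF fisher_NND I0, of _ 1 1] by (simp add: info_def)

lemma info_move:
  assumes "\<omega> \<in> pos_measures X" "v \<in> pos_measures X" "0 \<le> s" "s \<le> 1"
  shows "info (move s \<omega> v) = (1 - s) *\<^sub>R info \<omega> + s *\<^sub>R info v"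
proof -
  have "fisher X D (move s \<omega> v) = (1 - s) *\<^sub>R fisher X D \<omega> + s *\<^sub>R fisher X D v"
    using assms by (simp add: vec_eq_iff fisher_def move_def pairing_comb compact_X continuous_intros D_cont)
  then show ?thesis by (simp add: info_def algebra_simps)
qed

lemma \<Psi>_real: "N \<in> PD \<Longrightarrow> \<Psi> N = ereal (\<Psi>r N)" "N \<in> PD \<Longrightarrow> 0 \<le> \<Psi>r N"
proof -
  assume N: "N \<in> PD"
  have "\<Psi> N < \<infinity>" "0 \<le> \<Psi> N" using N dom nonneg PD_subset_NND by auto
  then show "\<Psi> N = ereal (\<Psi>r N)" "0 \<le> \<Psi>r N"
    unfolding \<Psi>r_def by (cases "\<Psi> N"; simp)+
qed

lemma \<Psi>_finite_iff: "N \<in> NND \<Longrightarrow> \<Psi> N < \<infinity> \<longleftrightarrow> N \<in> PD"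
  using dom PD_subset_NND by (auto simp: NND_iff)

lemma F_real:
  assumes "\<omega> \<in> pos_measures X" "info \<omega> \<in> PD"
  shows "F \<omega> = ereal (\<Psi>r (info \<omega>) + \<beta> * \<omega> X)"
  using assms by (simp add: obj_def psi_def info_def[symmetric] \<Psi>_real tv_norm_pos)

lemma F_finite:
  assumes \<omega>: "\<omega> \<in> pos_measures X" and "F \<omega> \<le> ereal c"
  shows "info \<omega> \<in> PD" "\<Psi>r (info \<omega>) + \<beta> * \<omega> X \<le> c"
proof -
  have "\<Psi> (info \<omega>) + ereal (\<beta> * \<omega> X) \<le> ereal c"
    using assms by (simp add: obj_def psi_def info_def tv_norm_pos)
  then have "\<Psi> (info \<omega>) < \<infinity>" by (cases "\<Psi> (info \<omega>)") auto
  then show PD: "info \<omega> \<in> PD" using \<Psi>_finite_iff[OF info_NND[OF \<omega>]] by simp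
  show "\<Psi>r (info \<omega>) + \<beta> * \<omega> X \<le> c" using assms(2) F_real[OF \<omega> PD] by simp
qed

lemma dpsi_eq: "d\<psi> \<omega> = (\<lambda>x. \<Psi>' (info \<omega>) \<bullet> outer (D x))"
  by (rule ext) (simp add: dpsi_def info_def inner_outer)

lemma continuous_dpsi: "continuous_on X (d\<psi> \<omega>)"
  unfolding dpsi_eq by (intro continuous_intros)

text \<open>A segment from a positive definite to a semidefinite matrix stays positive definite except possibly
  at its end, which is why the parameter interval is half open.\<close>

lemma \<Psi>_path_derivative:
  assumes N: "N \<in> PD" and W: "W \<in> NND" and t: "t \<in> {0..<1}"
  shows "((\<lambda>t. \<Psi>r ((1 - t) *\<^sub>R N + t *\<^sub>R W)) has_real_derivative
    \<Psi>' ((1 - t) *\<^sub>R N + t *\<^sub>R W) \<bullet> (W - N)) (at t within {0..<1})"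
proof -
  let ?p = "\<lambda>t::real. (1 - t) *\<^sub>R N + t *\<^sub>R W"
  have img: "?p ` {0..<1} \<subseteq> PD" using N W by (auto intro!: PD_NND_comb)
  have "?p = (\<lambda>t. N + t *\<^sub>R (W - N))" by (rule ext) (simp add: algebra_simps)
  moreover have "((\<lambda>t. N + t *\<^sub>R (W - N)) has_derivative (\<lambda>\<tau>. 0 + \<tau> *\<^sub>R (W - N))) (at t within {0..<1})"
    by (intro has_derivative_add has_derivative_const has_derivative_scaleR_left has_derivative_ident)
  ultimately have p: "(?p has_derivative (\<lambda>\<tau>. \<tau> *\<^sub>R (W - N))) (at t within {0..<1})" by simp
  have "?p t \<in> PD" using img t by blast
  moreover have "\<Psi>r = (\<lambda>A. real_of_ereal (\<Psi> A))" by (rule ext) (simp add: \<Psi>r_def)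
  ultimately have "(\<Psi>r has_derivative (\<lambda>H. \<Psi>' (?p t) \<bullet> H)) (at (?p t) within PD)"
    using bspec[OF conjunct1[OF C1[unfolded C1_on_PD_def]], of "?p t"] by simp
  then have "(\<Psi>r has_derivative (\<lambda>H. \<Psi>' (?p t) \<bullet> H)) (at (?p t) within ?p ` {0..<1})"
    by (rule has_derivative_subset[OF _ img])
  note comp = has_derivative_in_compose[OF p this]
  have eq: "(\<lambda>\<tau>. \<Psi>' (?p t) \<bullet> (\<tau> *\<^sub>R (W - N))) = (*) (\<Psi>' (?p t) \<bullet> (W - N))"
    by (rule ext) (simp only: inner_scaleR_right mult.commute)
  show ?thesis unfolding has_field_derivative_def using comp unfolding eq .
qed

text \<open>Otherwise \<open>\<Psi>\<close> minus its chord would have a positive slope at \<open>N\<close> and rise above the chord.\<close>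

lemma \<Psi>_subgradient:
  assumes N: "N \<in> PD" and W: "W \<in> PD"
  shows "\<Psi>r N + \<Psi>' N \<bullet> (W - N) \<le> \<Psi>r W"
proof (rule ccontr)
  assume neg: "\<not> ?thesis"
  have WN: "W \<in> NND" "N \<in> NND" using W N PD_subset_NND by auto
  define k where "k t = \<Psi>r ((1 - t) *\<^sub>R N + t *\<^sub>R W) - t * (\<Psi>r W - \<Psi>r N)" for t
  have k': "(k has_real_derivative \<Psi>' N \<bullet> (W - N) - (\<Psi>r W - \<Psi>r N)) (at 0 within {0..<1})"
    unfolding k_def using \<Psi>_path_derivative[OF N WN(1), of 0]
    by (auto intro!: derivative_eq_intros)
  have "0 < \<Psi>' N \<bullet> (W - N) - (\<Psi>r W - \<Psi>r N)" using neg by simp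
  from has_real_derivative_pos_inc_right[OF k' this]
  obtain d where d: "0 < d" "\<And>h. 0 < h \<Longrightarrow> 0 + h \<in> {0..<1} \<Longrightarrow> h < d \<Longrightarrow> k 0 < k (0 + h)" by blast
  define t where "t = min (1/2) (d/2)"
  have t: "0 < t" "t < 1" "t < d" using d(1) by (auto simp: t_def)
  have "\<Psi> ((1 - t) *\<^sub>R N + t *\<^sub>R W) \<le> ereal (1 - t) * \<Psi> N + ereal t * \<Psi> W"
    using conv WN t unfolding ereal_convex_on_def by auto
  moreover have "(1 - t) *\<^sub>R N + t *\<^sub>R W \<in> PD" using t by (intro PD_NND_comb N WN) auto
  ultimately have "\<Psi>r ((1 - t) *\<^sub>R N + t *\<^sub>R W) \<le> (1 - t) * \<Psi>r N + t * \<Psi>r W"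
    by (simp add: \<Psi>_real N W)
  then have "k t \<le> k 0" by (simp add: k_def algebra_simps)
  then show False using d(2)[of t] t by simp
qed

lemma inner_info_diff:
  assumes "\<omega> \<in> pos_measures X" "v \<in> pos_measures X"
  shows "A \<bullet> (info v - info \<omega>) = pairing X (\<lambda>x. A \<bullet> outer (D x)) v - pairing X (\<lambda>x. A \<bullet> outer (D x)) \<omega>"
  using assms by (simp add: info_def inner_diff_right inner_fisher)

section \<open>Sublevel sets\<close>

text \<open>Lower semicontinuity makes the sublevel sets of \<open>\<Psi>\<close> closed, and finiteness of \<open>\<Psi>\<close> keeps them inside the
  positive definite matrices, so on a bounded sublevel set all constants are uniform.\<close>

lemma compact_sublevel: "compact {N \<in> NND. norm N \<le> R \<and> \<Psi> N \<le> ereal c}"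
proof -
  let ?S = "{N \<in> NND. \<Psi> N \<le> ereal c}"
  have "closed ?S"
    unfolding closed_limpt
  proof (intro allI impI)
    fix N assume N: "N islimpt ?S"
    then have "N islimpt NND" by (rule islimpt_subset) auto
    then have NND: "N \<in> NND" using closed_NND[where 'n='n] unfolding closed_limpt by simp
    show "N \<in> ?S"
    proof (rule ccontr)
      assume "N \<notin> ?S"
      have le: "at N within ?S \<le> at N within NND" by (rule at_le) blast
      from \<open>N \<notin> ?S\<close> have "ereal c < \<Psi> N" using NND by auto
      then have "\<forall>\<^sub>F A in at N within NND. ereal c < \<Psi> A"
        using lsc NND unfolding lsc_on_def by blast
      then have "\<forall>\<^sub>F A in at N within ?S. ereal c < \<Psi> A"
        by (rule filter_leD[OF le])
      moreover have "\<forall>\<^sub>F A in at N within ?S. A \<in> ?S" by (simp add: eventually_at_filter)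
      ultimately have "\<forall>\<^sub>F A in at N within ?S. False" by eventually_elim (use not_le in blast)
      then show False using N trivial_limit_within[of N ?S] unfolding eventually_False by blast
    qed
  qed
  then have "compact (cball 0 R \<inter> ?S)" by (intro compact_Int_closed compact_cball)
  moreover have "cball 0 R \<inter> ?S = {N \<in> NND. norm N \<le> R \<and> \<Psi> N \<le> ereal c}" by auto
  ultimately show ?thesis by simp
qed

lemma sublevel_subset_PD: "{N \<in> NND. norm N \<le> R \<and> \<Psi> N \<le> ereal c} \<subseteq> PD"
proof
  fix N assume "N \<in> {N \<in> NND. norm N \<le> R \<and> \<Psi> N \<le> ereal c}"
  then have "N \<in> NND" "\<Psi> N \<le> ereal c" by auto
  then show "N \<in> PD" using \<Psi>_finite_iff[of N] by (cases "\<Psi> N") auto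
qed

lemma outer_D_bounded:
  obtains B where "0 < B" "\<And>x. x \<in> X \<Longrightarrow> norm (outer (D x)) \<le> B"
  using compact_imp_bounded[OF compact_continuous_image[OF continuous_outer_D compact_X]]
  unfolding bounded_pos by auto

lemma abs_entry_le_norm: "\<bar>A $ k $ l\<bar> \<le> norm (A :: real^'m^'k)"
  using component_le_norm_cart[of "A $ k" l] Finite_Cartesian_Product.norm_nth_le[of A k] by linarith

lemma pairing_entry_bound:
  assumes B: "\<And>x. x \<in> X \<Longrightarrow> norm (outer (D x)) \<le> B" and \<mu>: "\<mu> \<in> signed_measures X"
  shows "\<bar>pairing X (\<lambda>x. D x $ k * D x $ l) \<mu>\<bar> \<le> B * tv_norm X \<mu>"
proof (rule pairing_bound[OF compact_X _ _ \<mu>])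
  show "continuous_on X (\<lambda>x. D x $ k * D x $ l)" by (intro continuous_intros D_cont)
  show "\<bar>D x $ k * D x $ l\<bar> \<le> B" if "x \<in> X" for x
    using abs_entry_le_norm[of "outer (D x)" k l] B[OF that] by (simp add: outer_def)
qed

lemma info_bounded:
  obtains R where "\<And>\<omega>. \<omega> \<in> pos_measures X \<Longrightarrow> \<omega> X \<le> M \<Longrightarrow> norm (info \<omega>) \<le> R"
proof -
  obtain B where B: "0 < B" "\<And>x. x \<in> X \<Longrightarrow> norm (outer (D x)) \<le> B" using outer_D_bounded by metis
  show thesis
  proof (rule that)
    fix \<omega> assume \<omega>: "\<omega> \<in> pos_measures X" "\<omega> X \<le> M"
    have "norm (fisher X D \<omega>) \<le> real CARD('n) * (real CARD('n) * (B * M))"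
    proof (rule norm_matrix_le)
      fix k l
      have "\<bar>fisher X D \<omega> $ k $ l\<bar> \<le> B * \<omega> X"
        using pairing_entry_bound[OF B(2) pos_measures_signed[OF \<omega>(1)]]
        by (simp add: fisher_def tv_norm_pos[OF \<omega>(1)])
      also have "\<dots> \<le> B * M" using B(1) \<omega>(2) by simp
      finally show "\<bar>fisher X D \<omega> $ k $ l\<bar> \<le> B * M" .
    qed
    then show "norm (info \<omega>) \<le> real CARD('n) * (real CARD('n) * (B * M)) + norm I0"
      unfolding info_def by (intro norm_triangle_le) simp
  qed
qed

lemma info_lipschitz:
  obtains C where "0 \<le> C" "\<And>\<mu> \<nu>. \<mu> \<in> pos_measures X \<Longrightarrow> \<nu> \<in> pos_measures X \<Longrightarrow>
    norm (info \<mu> - info \<nu>) \<le> C * tv_norm X (\<lambda>A. \<mu> A - \<nu> A)"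
proof -
  obtain B where B: "0 < B" "\<And>x. x \<in> X \<Longrightarrow> norm (outer (D x)) \<le> B" using outer_D_bounded by metis
  show thesis
  proof (rule that)
    show "0 \<le> real CARD('n) * real CARD('n) * B" using B(1) by simp
    fix \<mu> \<nu> assume \<mu>\<nu>: "\<mu> \<in> pos_measures X" "\<nu> \<in> pos_measures X"
    have "norm (info \<mu> - info \<nu>) \<le> real CARD('n) * (real CARD('n) * (B * tv_norm X (\<lambda>A. \<mu> A - \<nu> A)))"
    proof (rule norm_matrix_le)
      fix k l
      have "(info \<mu> - info \<nu>) $ k $ l = pairing X (\<lambda>x. D x $ k * D x $ l) (\<lambda>A. \<mu> A - \<nu> A)"
        using \<mu>\<nu> by (simp add: info_def fisher_def pairing_diff compact_X continuous_intros D_cont)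
      then show "\<bar>(info \<mu> - info \<nu>) $ k $ l\<bar> \<le> B * tv_norm X (\<lambda>A. \<mu> A - \<nu> A)"
        using pairing_entry_bound[OF B(2) signed_measures_diff[OF \<mu>\<nu>[THEN pos_measures_signed]]] by simp
    qed
    then show "norm (info \<mu> - info \<nu>) \<le> real CARD('n) * real CARD('n) * B * tv_norm X (\<lambda>A. \<mu> A - \<nu> A)"
      by (simp add: mult.assoc)
  qed
qed

lemma sublevel_compact_info:
  assumes "\<omega>\<^sub>1 \<in> pos_measures X" "info \<omega>\<^sub>1 \<in> PD"
  obtains K where "compact K" "K \<subseteq> PD" "\<And>\<omega>. \<omega> \<in> sublevel X D I0 \<Psi> \<beta> \<omega>\<^sub>1 \<Longrightarrow> info \<omega> \<in> K"
proof -
  define c where "c = \<Psi>r (info \<omega>\<^sub>1) + \<beta> * \<omega>\<^sub>1 X"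
  obtain R where R: "\<And>\<omega>. \<omega> \<in> pos_measures X \<Longrightarrow> \<omega> X \<le> c / \<beta> \<Longrightarrow> norm (info \<omega>) \<le> R"
    using info_bounded[of "c / \<beta>"] by metis
  show thesis
  proof (rule that[OF compact_sublevel sublevel_subset_PD])
    fix \<omega> assume "\<omega> \<in> sublevel X D I0 \<Psi> \<beta> \<omega>\<^sub>1"
    then have \<omega>: "\<omega> \<in> pos_measures X" "F \<omega> \<le> ereal c"
      using F_real[OF assms] by (auto simp: sublevel_def c_def)
    note fin = F_finite[OF \<omega>]
    have "0 \<le> \<beta> * \<omega> X" using \<beta> pos_measures_nonneg[OF \<omega>(1), of X] by simp
    then have "\<Psi>r (info \<omega>) \<le> c" "\<beta> * \<omega> X \<le> c" using fin(2) \<Psi>_real(2)[OF fin(1)] by auto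
    moreover from this(2) have "\<omega> X \<le> c / \<beta>" using \<beta> by (simp add: field_simps)
    ultimately show "info \<omega> \<in> {N \<in> NND. norm N \<le> R \<and> \<Psi> N \<le> ereal c}"
      using R[OF \<omega>(1)] info_NND[OF \<omega>(1)] \<Psi>_real(1)[OF fin(1)] by simp
  qed
qed

lemma dpsi_lipschitz_exists:
  assumes \<omega>1: "\<omega>\<^sub>1 \<in> pos_measures X" "info \<omega>\<^sub>1 \<in> PD"
  shows "\<exists>L. lipschitz_const_dpsi X D I0 \<Psi>' (sublevel X D I0 \<Psi> \<beta> \<omega>\<^sub>1) L"
proof -
  obtain K where K: "compact K" "K \<subseteq> PD" "\<And>\<omega>. \<omega> \<in> sublevel X D I0 \<Psi> \<beta> \<omega>\<^sub>1 \<Longrightarrow> info \<omega> \<in> K"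
    using sublevel_compact_info[OF \<omega>1] by metis
  obtain l where l: "l-lipschitz_on K \<Psi>'" using lip[OF K(1,2)] by blast
  obtain B where B: "0 < B" "\<And>x. x \<in> X \<Longrightarrow> norm (outer (D x)) \<le> B" using outer_D_bounded by metis
  obtain C where C: "0 \<le> C" "\<And>\<mu> \<nu>. \<mu> \<in> pos_measures X \<Longrightarrow> \<nu> \<in> pos_measures X \<Longrightarrow>
    norm (info \<mu> - info \<nu>) \<le> C * tv_norm X (\<lambda>A. \<mu> A - \<nu> A)" using info_lipschitz by metis
  have l0: "0 \<le> l" by (rule lipschitz_on_nonneg[OF l])
  have "sup_norm X (\<lambda>x. d\<psi> \<mu> x - d\<psi> \<nu> x) \<le> (l * C * B + 1) * tv_norm X (\<lambda>A. \<mu> A - \<nu> A)"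
    if \<mu>\<nu>: "\<mu> \<in> sublevel X D I0 \<Psi> \<beta> \<omega>\<^sub>1" "\<nu> \<in> sublevel X D I0 \<Psi> \<beta> \<omega>\<^sub>1" for \<mu> \<nu>
    unfolding sup_norm_def
  proof (rule cSUP_least[OF X_ne])
    fix x assume x: "x \<in> X"
    have pos: "\<mu> \<in> pos_measures X" "\<nu> \<in> pos_measures X" using \<mu>\<nu> by (auto simp: sublevel_def)
    define T where "T = tv_norm X (\<lambda>A. \<mu> A - \<nu> A)"
    have "0 \<le> T" unfolding T_def using pos
      by (intro tv_norm_signed_nonneg signed_measures_diff pos_measures_signed)
    have "\<bar>d\<psi> \<mu> x - d\<psi> \<nu> x\<bar> = \<bar>(\<Psi>' (info \<mu>) - \<Psi>' (info \<nu>)) \<bullet> outer (D x)\<bar>"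
      by (simp add: dpsi_eq inner_diff_left)
    also have "\<dots> \<le> norm (\<Psi>' (info \<mu>) - \<Psi>' (info \<nu>)) * norm (outer (D x))"
      by (rule Cauchy_Schwarz_ineq2)
    also have "\<dots> \<le> (l * (C * T)) * B"
    proof (rule mult_mono)
      have "norm (\<Psi>' (info \<mu>) - \<Psi>' (info \<nu>)) \<le> l * norm (info \<mu> - info \<nu>)"
        using lipschitz_onD[OF l K(3)[OF \<mu>\<nu>(1)] K(3)[OF \<mu>\<nu>(2)]] by (simp add: dist_norm)
      also have "\<dots> \<le> l * (C * T)" using l0 C(2)[OF pos] by (intro mult_left_mono) (auto simp: T_def)
      finally show "norm (\<Psi>' (info \<mu>) - \<Psi>' (info \<nu>)) \<le> l * (C * T)" .
    qed (use B x l0 C(1) \<open>0 \<le> T\<close> in auto)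
    also have "\<dots> \<le> (l * C * B + 1) * T" using \<open>0 \<le> T\<close> by (simp add: algebra_simps)
    finally show "\<bar>d\<psi> \<mu> x - d\<psi> \<nu> x\<bar> \<le> (l * C * B + 1) * tv_norm X (\<lambda>A. \<mu> A - \<nu> A)"
      by (simp add: T_def)
  qed
  moreover have "0 < l * C * B + 1" using l0 C(1) B(1) by (simp add: add_nonneg_pos)
  ultimately show ?thesis unfolding lipschitz_const_dpsi_def by blast
qed

lemma dpsi_bounded_on_sublevel:
  assumes \<omega>1: "\<omega>\<^sub>1 \<in> pos_measures X" "info \<omega>\<^sub>1 \<in> PD"
  obtains b where "0 < b"
    "\<And>\<omega> x. \<omega> \<in> sublevel X D I0 \<Psi> \<beta> \<omega>\<^sub>1 \<Longrightarrow> x \<in> X \<Longrightarrow> \<bar>d\<psi> \<omega> x\<bar> \<le> b"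
proof -
  obtain K where K: "compact K" "K \<subseteq> PD" "\<And>\<omega>. \<omega> \<in> sublevel X D I0 \<Psi> \<beta> \<omega>\<^sub>1 \<Longrightarrow> info \<omega> \<in> K"
    using sublevel_compact_info[OF \<omega>1] by metis
  have "continuous_on PD \<Psi>'" using C1 by (simp add: C1_on_PD_def)
  then have "continuous_on K \<Psi>'" by (rule continuous_on_subset[OF _ K(2)])
  from compact_imp_bounded[OF compact_continuous_image[OF this K(1)]]
  obtain b where b: "0 < b" "\<And>N. N \<in> K \<Longrightarrow> norm (\<Psi>' N) \<le> b"
    unfolding bounded_pos by blast
  obtain B where B: "0 < B" "\<And>x. x \<in> X \<Longrightarrow> norm (outer (D x)) \<le> B" using outer_D_bounded by metis
  show thesis
  proof (rule that[of "b * B"])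
    show "0 < b * B" using b(1) B(1) by simp
    fix \<omega> x assume \<omega>: "\<omega> \<in> sublevel X D I0 \<Psi> \<beta> \<omega>\<^sub>1" and x: "x \<in> X"
    have "\<bar>d\<psi> \<omega> x\<bar> \<le> norm (\<Psi>' (info \<omega>)) * norm (outer (D x))"
      unfolding dpsi_eq by (rule Cauchy_Schwarz_ineq2)
    also have "\<dots> \<le> b * B" using b K(3)[OF \<omega>] B x by (intro mult_mono) auto
    finally show "\<bar>d\<psi> \<omega> x\<bar> \<le> b * B" .
  qed
qed

end

section \<open>The inserted point measure\<close>

lemma pairing_dirac:
  fixes f :: "'a::topological_space \<Rightarrow> real"
  assumes f: "continuous_on X f" and y: "y \<in> X"
  shows "pairing X f (dirac X y) = f y"
proof -
  let ?N = "as_measure X (dirac X y)"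
  have fm: "f \<in> borel_measurable ?N" by (rule measurable_continuous_as_measure[OF f])
  have "AE x in ?N. f x = f y"
  proof (rule AE_I)
    have "{x \<in> space ?N. f x \<noteq> f y} \<in> sets ?N" using fm by measurable
    then have S: "{x \<in> X. f x \<noteq> f y} \<in> borel_sets X" by simp
    then show "{x \<in> X. f x \<noteq> f y} \<in> sets ?N" by simp
    show "emeasure ?N {x \<in> X. f x \<noteq> f y} = 0"
      using emeasure_as_measure[OF dirac_in_pos_measures S] by (simp add: dirac_def)
  qed auto
  then have "(\<integral>x. f x \<partial>?N) = (\<integral>x. f y \<partial>?N)" by (intro integral_cong_AE fm) auto
  also have "\<dots> = f y" using y by (simp add: measure_as_measure[OF dirac_in_pos_measures] dirac_mass)
  finally show ?thesis by (simp add: pairing_pos[OF dirac_in_pos_measures])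
qed

text \<open>The coefficient of the inserted measure: the maximiser of \<open>t \<mapsto> - p t - \<beta> \<phi>(t)\<close> over \<open>t \<ge> 0\<close>.\<close>

definition opt_weight :: "real \<Rightarrow> real \<Rightarrow> real \<Rightarrow> real" where
  "opt_weight \<beta> M p = (if p \<ge> - \<beta> then 0 else - (M / \<beta>) * p)"

lemma opt_weight_nonneg: "0 < \<beta> \<Longrightarrow> 0 < M \<Longrightarrow> 0 \<le> opt_weight \<beta> M p"
  by (auto simp: opt_weight_def field_simps intro: mult_nonneg_nonpos)

lemma opt_weight_maximises:
  assumes \<beta>: "0 < \<beta>" and M: "0 < M" and t: "0 \<le> t"
  shows "- p * t - \<beta> * phi M t \<le> - p * opt_weight \<beta> M p - \<beta> * phi M (opt_weight \<beta> M p)"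
proof (cases "p \<ge> - \<beta>")
  case True
  have "- p * t \<le> \<beta> * t" using True t by (intro mult_right_mono) auto
  also have "\<dots> \<le> \<beta> * phi M t" using phi_ge[OF M] \<beta> by (intro mult_left_mono) auto
  finally show ?thesis using True M by (simp add: opt_weight_def phi_def)
next
  case False
  define \<theta> where "\<theta> = - (M / \<beta>) * p"
  have p: "p = - \<beta> * \<theta> / M" using \<beta> M by (simp add: \<theta>_def)
  have "M * \<beta> < M * (- p)" using False M by (intro mult_strict_left_mono) auto
  then have "\<beta> * M < \<beta> * \<theta>" using \<beta> by (simp add: \<theta>_def mult.commute)
  then have \<theta>: "M < \<theta>" using \<beta> by simp
  have "\<theta> * t / M - phi M t \<le> \<theta> * \<theta> / M - phi M \<theta>"
  proof (cases "t \<le> M")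
    case True
    have "2 * t * (\<theta> - M) \<le> (\<theta> + M) * (\<theta> - M)" using True \<theta> by (intro mult_right_mono) auto
    then have "2 * \<theta> * t - 2 * M * t \<le> 2 * \<theta> * \<theta> - (\<theta>\<^sup>2 + M\<^sup>2)" by (simp add: algebra_simps power2_eq_square)
    from divide_right_mono[OF this, of "2 * M"] show ?thesis
      using True \<theta> M by (simp add: phi_def diff_divide_distrib)
  next
    case False
    have "0 \<le> (\<theta> - t)\<^sup>2" by simp
    then have "2 * \<theta> * t - (t\<^sup>2 + M\<^sup>2) \<le> 2 * \<theta> * \<theta> - (\<theta>\<^sup>2 + M\<^sup>2)" by (simp add: algebra_simps power2_eq_square)
    from divide_right_mono[OF this, of "2 * M"] show ?thesis
      using False \<theta> M by (simp add: phi_def diff_divide_distrib)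
  qed
  from mult_left_mono[OF this less_imp_le[OF \<beta>]]
  show ?thesis using False M unfolding opt_weight_def \<theta>_def[symmetric] p by (simp add: algebra_simps)
qed

context sensor_problem
begin

lemma insertion_eq: "insertion X D I0 \<Psi>' \<beta> M \<omega> y = (\<lambda>A. opt_weight \<beta> M (d\<psi> \<omega> y) * dirac X y A)"
  by (simp add: insertion_def opt_weight_def Let_def)

lemma insertion_in_pos_measures: "0 < M \<Longrightarrow> insertion X D I0 \<Psi>' \<beta> M \<omega> y \<in> pos_measures X"
  unfolding insertion_eq by (intro pos_measures_scale dirac_in_pos_measures opt_weight_nonneg \<beta>)

lemma insertion_mass: "y \<in> X \<Longrightarrow> insertion X D I0 \<Psi>' \<beta> M \<omega> y X = opt_weight \<beta> M (d\<psi> \<omega> y)"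
  by (simp add: insertion_eq dirac_mass)

definition gap_at :: "real \<Rightarrow> ((real^'d) set \<Rightarrow> real) \<Rightarrow> ((real^'d) set \<Rightarrow> real) \<Rightarrow> real" where
  "gap_at M \<omega> w = pairing X (d\<psi> \<omega>) \<omega> - pairing X (d\<psi> \<omega>) w + \<beta> * \<omega> X - \<beta> * phi M (w X)"

lemma gap_eq_SUP:
  assumes \<omega>: "\<omega> \<in> pos_measures X"
  shows "gap X D I0 \<Psi>' \<beta> M \<omega> = (SUP w\<in>pos_measures X. ereal (gap_at M \<omega> w))"
  unfolding gap_def
  by (rule SUP_cong[OF refl])
    (simp add: gap_at_def pairing_diff[OF compact_X continuous_dpsi \<omega>] tv_norm_pos \<omega>)

text \<open>Among all competitors of a given mass the point mass at a minimiser of \<open>\<psi>'(\<omega>)\<close> is best, and its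
  mass has been optimised.\<close>

lemma gap_attained:
  assumes \<omega>: "\<omega> \<in> pos_measures X" and M: "0 < M" and y: "is_arg_min (d\<psi> \<omega>) (\<lambda>x. x \<in> X) y"
  shows "gap X D I0 \<Psi>' \<beta> M \<omega> = ereal (gap_at M \<omega> (insertion X D I0 \<Psi>' \<beta> M \<omega> y))"
  unfolding gap_eq_SUP[OF \<omega>]
proof (rule SUP_eqI)
  let ?v = "insertion X D I0 \<Psi>' \<beta> M \<omega> y" and ?p = "d\<psi> \<omega> y"
  have yX: "y \<in> X" and min: "\<And>x. x \<in> X \<Longrightarrow> ?p \<le> d\<psi> \<omega> x"
    using y by (auto simp: is_arg_min_def not_less)
  have pv: "pairing X (d\<psi> \<omega>) ?v = ?p * opt_weight \<beta> M ?p"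
    unfolding insertion_eq using opt_weight_nonneg[OF \<beta> M] yX
    by (simp add: pairing_scale[OF compact_X continuous_dpsi dirac_in_pos_measures]
        pairing_dirac[OF continuous_dpsi])
  fix w assume "w \<in> pos_measures X"
  then have w: "w \<in> pos_measures X" .
  have "?p * w X \<le> pairing X (d\<psi> \<omega>) w"
    unfolding pairing_const[OF w, symmetric]
    by (rule pairing_pos_mono[OF compact_X _ continuous_dpsi min w]) auto
  then show "ereal (gap_at M \<omega> w) \<le> ereal (gap_at M \<omega> ?v)"
    using opt_weight_maximises[OF \<beta> M pos_measures_nonneg[OF w, of X], of ?p] yX
    by (simp add: gap_at_def pv insertion_mass)
next
  fix z assume "\<And>w. w \<in> pos_measures X \<Longrightarrow> ereal (gap_at M \<omega> w) \<le> z"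
  then show "ereal (gap_at M \<omega> (insertion X D I0 \<Psi>' \<beta> M \<omega> y)) \<le> z"
    using insertion_in_pos_measures[OF M] by blast
qed

lemma dpsi_arg_min_exists: "\<exists>y. is_arg_min (d\<psi> \<omega>) (\<lambda>x. x \<in> X) y"
  using continuous_attains_inf[OF compact_X X_ne continuous_dpsi, of \<omega>]
  by (auto simp: is_arg_min_def not_less)

text \<open>The gap majorises the residual: for competitors of mass at most \<open>M\<close> this is the subgradient
  inequality, and the others cost more than \<open>\<beta> M\<close> by their mass alone.\<close>

lemma residual_le_gap:
  assumes \<omega>: "\<omega> \<in> pos_measures X" "info \<omega> \<in> PD" and M: "0 < M"
    and le: "\<Psi>r (info \<omega>) + \<beta> * \<omega> X \<le> \<beta> * M" and P: "gap X D I0 \<Psi>' \<beta> M \<omega> = ereal P"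
  shows "0 \<le> P" and "\<And>w. w \<in> pos_measures X \<Longrightarrow> ereal (\<Psi>r (info \<omega>) + \<beta> * \<omega> X - P) \<le> F w"
proof -
  have gap: "gap_at M \<omega> w \<le> P" if "w \<in> pos_measures X" for w
    using SUP_upper[OF that, of "\<lambda>w. ereal (gap_at M \<omega> w)"] P
    unfolding gap_eq_SUP[OF \<omega>(1)] by simp
  have "\<beta> * \<omega> X \<le> \<beta> * M" using le \<Psi>_real(2)[OF \<omega>(2)] by simp
  then have "\<omega> X \<le> M" using \<beta> by simp
  then show "0 \<le> P" using gap[OF \<omega>(1)] by (simp add: gap_at_def phi_def)
  fix w assume w: "w \<in> pos_measures X"
  show "ereal (\<Psi>r (info \<omega>) + \<beta> * \<omega> X - P) \<le> F w"
  proof (cases "info w \<in> PD")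
    case False
    then have "\<Psi> (info w) = \<infinity>" using \<Psi>_finite_iff[OF info_NND[OF w]] by simp
    then show ?thesis by (simp add: obj_def psi_def info_def)
  next
    case True
    have "\<Psi>r (info \<omega>) + \<beta> * \<omega> X - P \<le> \<Psi>r (info w) + \<beta> * w X"
    proof (cases "w X \<le> M")
      case True
      have "\<Psi>r (info \<omega>) + \<Psi>' (info \<omega>) \<bullet> (info w - info \<omega>) \<le> \<Psi>r (info w)"
        by (rule \<Psi>_subgradient[OF \<omega>(2) \<open>info w \<in> PD\<close>])
      then have "\<Psi>r (info \<omega>) + \<beta> * \<omega> X - gap_at M \<omega> w \<le> \<Psi>r (info w) + \<beta> * w X"
        using True by (simp add: gap_at_def phi_def inner_info_diff[OF \<omega>(1) w] dpsi_eq)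
      then show ?thesis using gap[OF w] by linarith
    next
      case False
      then have "\<beta> * M \<le> \<beta> * w X" using \<beta> by simp
      then show ?thesis using le \<open>0 \<le> P\<close> \<Psi>_real(2)[OF \<open>info w \<in> PD\<close>] by linarith
    qed
    then show ?thesis using F_real[OF w True] by simp
  qed
qed

section \<open>Sufficient decrease of the objective\<close>

lemma pairing_le_sup_norm:
  assumes f: "continuous_on X f" and \<mu>: "\<mu> \<in> signed_measures X"
  shows "pairing X f \<mu> \<le> sup_norm X f * tv_norm X \<mu>"
proof -
  obtain B where B: "\<And>x. x \<in> X \<Longrightarrow> \<bar>f x\<bar> \<le> B" using continuous_compact_bounded[OF compact_X f] by metis
  have "\<bar>f x\<bar> \<le> sup_norm X f" if "x \<in> X" for x
    unfolding sup_norm_def using that B by (intro cSUP_upper bdd_aboveI2[where M=B])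
  from pairing_bound[OF compact_X f this \<mu>] show ?thesis by linarith
qed

text \<open>Along the segment from \<open>\<omega>\<close> to \<open>v\<close> the objective is dominated by \<open>h\<close>, in which \<open>\<phi>\<close> is replaced by its
  chord; \<open>h\<close> starts at the value of the objective with slope \<open>-P\<close>. The Lipschitz bound on \<open>\<psi>'\<close> is
  available at those points of the segment that lie in the sublevel set, and these include the points
  where \<open>h\<close> does not exceed its initial value. This is the situation of the line search lemma. The
  derivative along the segment exists for \<open>s < 1\<close>; at the endpoint \<open>s = 1\<close> lower semicontinuity of \<open>\<Psi>\<close>
  yields the estimate as a limit.\<close>

lemma armijo_sufficient:
  assumes \<omega>: "\<omega> \<in> sublevel X D I0 \<Psi> \<beta> \<omega>\<^sub>1" "info \<omega> \<in> PD" and v: "v \<in> pos_measures X"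
    and M: "0 < M" "\<omega> X \<le> M" and P: "gap_at M \<omega> v = P" "0 < P"
    and L: "lipschitz_const_dpsi X D I0 \<Psi>' (sublevel X D I0 \<Psi> \<beta> \<omega>\<^sub>1) L"
    and B: "\<omega> X + v X \<le> B" and \<alpha>: "0 < \<alpha>"
    and s: "0 < s" "s \<le> 1" "L * B\<^sup>2 * s \<le> 2 * (1 - \<alpha>) * P"
  shows "obj_M X D I0 \<Psi> \<beta> M (move s \<omega> v) \<le> ereal (\<Psi>r (info \<omega>) + \<beta> * \<omega> X - \<alpha> * s * P)"
proof -
  have \<omega>p: "\<omega> \<in> pos_measures X" using \<omega>(1) by (simp add: sublevel_def)
  define N W a b where "N = info \<omega>" and "W = info v" and "a = \<omega> X" and "b = v X"
  have N: "N \<in> PD" and W: "W \<in> NND" using \<omega>(2) info_NND[OF v] by (auto simp: N_def W_def)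
  have ab: "0 \<le> a" "a \<le> M" "0 \<le> b" "a + b \<le> B"
    using M(2) B pos_measures_nonneg[OF \<omega>p] pos_measures_nonneg[OF v] by (auto simp: a_def b_def)
  define p where "p t = (1 - t) *\<^sub>R N + t *\<^sub>R W" for t
  define c where "c t = (1 - t) * a + t * phi M b" for t
  define h where "h t = \<Psi>r (p t) + \<beta> * c t" for t
  define h' where "h' t = \<Psi>' (p t) \<bullet> (W - N) + \<beta> * (phi M b - a)" for t
  have info_t: "info (move t \<omega> v) = p t" if "0 \<le> t" "t \<le> 1" for t
    unfolding p_def N_def W_def by (rule info_move[OF \<omega>p v that])
  have mass_t: "move t \<omega> v X = (1 - t) * a + t * b" for t by (simp add: move_def a_def b_def)
  have pos_t: "move t \<omega> v \<in> pos_measures X" if "0 \<le> t" "t \<le> 1" for t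
    by (rule move_in_pos_measures[OF \<omega>p v that])
  have PD_t: "p t \<in> PD" if "0 \<le> t" "t < 1" for t
    unfolding p_def using that by (intro PD_NND_comb N W) auto
  have h0: "h 0 = \<Psi>r (info \<omega>) + \<beta> * \<omega> X" by (simp add: h_def p_def c_def N_def a_def)
  have phi_t: "phi M ((1 - t) * a + t * b) \<le> c t" if "0 \<le> t" "t \<le> 1" for t
    unfolding c_def using phi_chord[OF M(1) ab(1,2) that ab(3)] .
  have deriv: "(h has_real_derivative h' t) (at t within {0..<1})" if "t \<in> {0..<1}" for t
    unfolding h_def[abs_def] h'_def c_def p_def using \<Psi>_path_derivative[OF N W that]
    by (auto intro!: derivative_eq_intros simp: algebra_simps)
  have h'0: "h' 0 = - P"
    using inner_info_diff[OF \<omega>p v, of "\<Psi>' N"] P(1)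
    by (simp add: h'_def p_def gap_at_def dpsi_eq N_def W_def a_def b_def algebra_simps)
  have L0: "0 < L" using L by (simp add: lipschitz_const_dpsi_def)
  have K: "0 \<le> L * B\<^sup>2" using L0 by simp
  have slope: "h' t \<le> - P + L * B\<^sup>2 * t" if t: "t \<in> {0..<1}" and below: "h t \<le> h 0" for t
  proof -
    let ?\<omega>t = "move t \<omega> v"
    have t01: "0 \<le> t" "t \<le> 1" "t < 1" using t by auto
    have "(1 - t) * a + t * b \<le> c t" using phi_ge[OF M(1), of "(1 - t) * a + t * b"] phi_t[OF t01(1,2)] by linarith
    then have "\<Psi>r (p t) + \<beta> * ((1 - t) * a + t * b) \<le> h 0" using below \<beta> by (simp add: h_def) (smt (verit) mult_left_mono)
    then have "F ?\<omega>t \<le> F \<omega>"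
      using F_real[OF pos_t[OF t01(1,2)]] F_real[OF \<omega>p \<omega>(2)] info_t[OF t01(1,2)] PD_t[OF t01(1,3)] mass_t h0 by simp
    then have "F ?\<omega>t \<le> F \<omega>\<^sub>1" using \<omega>(1) unfolding sublevel_def by (auto intro: order_trans)
    then have mem: "?\<omega>t \<in> sublevel X D I0 \<Psi> \<beta> \<omega>\<^sub>1" using pos_t[OF t01(1,2)] by (simp add: sublevel_def)
    let ?g = "\<lambda>x. d\<psi> ?\<omega>t x - d\<psi> \<omega> x"
    have sg: "(\<lambda>A. v A - \<omega> A) \<in> signed_measures X"
      by (intro signed_measures_diff pos_measures_signed v \<omega>p)
    have tv: "tv_norm X (\<lambda>A. v A - \<omega> A) \<le> B" using tv_norm_diff_le[OF v \<omega>p] ab(4) by (simp add: a_def b_def)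
    have tv': "tv_norm X (\<lambda>A. ?\<omega>t A - \<omega> A) \<le> t * B"
    proof -
      have "(\<lambda>A. ?\<omega>t A - \<omega> A) = (\<lambda>A. t * v A - t * \<omega> A)" by (simp add: move_def algebra_simps)
      then have "tv_norm X (\<lambda>A. ?\<omega>t A - \<omega> A) \<le> t * v X + t * \<omega> X"
        using tv_norm_diff_le[OF pos_measures_scale[OF v t01(1)] pos_measures_scale[OF \<omega>p t01(1)]] by simp
      also have "\<dots> \<le> t * B" using ab(4) t01(1) by (simp add: a_def b_def distrib_left[symmetric] mult_left_mono add.commute)
      finally show ?thesis .
    qed
    have g: "continuous_on X ?g" by (intro continuous_intros continuous_dpsi)
    have "h' t - h' 0 = (\<Psi>' (p t) - \<Psi>' N) \<bullet> (info v - info \<omega>)"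
      by (simp add: h'_def p_def N_def W_def inner_diff_left)
    also have "\<dots> = pairing X ?g v - pairing X ?g \<omega>"
    proof -
      have "?g = (\<lambda>x. (\<Psi>' (p t) - \<Psi>' N) \<bullet> outer (D x))"
        by (simp add: dpsi_eq info_t[OF t01(1,2)] N_def inner_diff_left)
      then show ?thesis by (simp only: inner_info_diff[OF \<omega>p v])
    qed
    also have "\<dots> = pairing X ?g (\<lambda>A. v A - \<omega> A)" by (rule pairing_diff[OF compact_X g v \<omega>p, symmetric])
    also have "\<dots> \<le> sup_norm X ?g * tv_norm X (\<lambda>A. v A - \<omega> A)" by (rule pairing_le_sup_norm[OF g sg])
    also have "\<dots> \<le> (L * (t * B)) * B"
    proof (rule mult_mono)
      have "sup_norm X ?g \<le> L * tv_norm X (\<lambda>A. ?\<omega>t A - \<omega> A)"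
        using L mem \<omega>(1) by (simp add: lipschitz_const_dpsi_def)
      also have "\<dots> \<le> L * (t * B)" using tv' L0 by simp
      finally show "sup_norm X ?g \<le> L * (t * B)" .
      show "0 \<le> L * (t * B)" using L0 t01 ab by simp
      show "0 \<le> tv_norm X (\<lambda>A. v A - \<omega> A)" by (rule tv_norm_signed_nonneg[OF sg])
    qed (rule tv)
    finally show ?thesis using h'0 by (simp add: power2_eq_square algebra_simps)
  qed
  have interior: "\<Psi>r (p t) + \<beta> * c t \<le> h 0 - \<alpha> * t * P" if t: "0 \<le> t" "t < 1" "t \<le> s" for t
  proof -
    have "h t \<le> h 0 - \<alpha> * t * P"
    proof (rule sufficient_decrease[where h'=h' and K="L * B\<^sup>2"])
      show "(h has_real_derivative h' \<tau>) (at \<tau> within {0..t})" if "\<tau> \<in> {0..t}" for \<tau>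
        by (rule DERIV_subset[OF deriv]) (use that t in auto)
      show "L * B\<^sup>2 * t \<le> 2 * (1 - \<alpha>) * P"
        using mult_left_mono[OF t(3) K] s(3) by linarith
    qed (use t h'0 P(2) \<alpha> K slope in auto)
    then show ?thesis by (simp add: h_def)
  qed
  have \<Psi>s: "\<Psi> (p s) \<le> ereal (h 0 - \<alpha> * s * P - \<beta> * c s)"
  proof (cases "s < 1")
    case True
    then show ?thesis using interior[of s] s(1) \<Psi>_real(1)[OF PD_t[of s]] by simp
  next
    case False
    then have s1: "s = 1" using s(2) by simp
    show ?thesis
    proof (rule ccontr)
      assume "\<not> ?thesis"
      then obtain e where e: "ereal (h 0 - \<alpha> * s * P - \<beta> * c s) < ereal e" "ereal e < \<Psi> W"
        unfolding s1 p_def using ereal_dense2 by (metis add_0 cancel_comm_monoid_add_class.diff_cancel not_le scaleR_one scaleR_zero_left)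
      then have "\<forall>\<^sub>F A in at W within NND. ereal e < \<Psi> A" using lsc W unfolding lsc_on_def by blast
      then obtain \<delta> where \<delta>: "0 < \<delta>" "\<And>A. A \<in> NND \<Longrightarrow> A \<noteq> W \<Longrightarrow> dist A W < \<delta> \<Longrightarrow> ereal e < \<Psi> A"
        unfolding eventually_at by blast
      have near: "e < h 0 - \<alpha> * t * P - \<beta> * c t" if t: "0 \<le> t" "t < 1" "(1 - t) * norm (N - W) < \<delta>" for t
      proof -
        have "p t - W = (1 - t) *\<^sub>R (N - W)" by (simp add: p_def algebra_simps)
        then have "dist (p t) W < \<delta>" using t by (simp add: dist_norm)
        then have "ereal e < \<Psi> (p t)" using \<delta>(2)[of "p t"] e(2) PD_t[OF t(1,2)] PD_subset_NND by blast
        then have "e < \<Psi>r (p t)" using \<Psi>_real(1)[OF PD_t[OF t(1,2)]] by simp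
        then show ?thesis using interior[OF t(1,2)] t s1 by simp
      qed
      have lim: "(\<lambda>n. (1 - (1/2) ^ n :: real)) \<longlonglongrightarrow> 1 - 0"
        by (intro tendsto_intros LIMSEQ_power_zero) simp
      have "(\<lambda>n. (1 - (1 - (1/2) ^ n)) * norm (N - W)) \<longlonglongrightarrow> (1 - (1 - 0)) * norm (N - W)"
        by (intro tendsto_intros lim)
      then have "\<forall>\<^sub>F n in sequentially. (1 - (1 - (1/2) ^ n)) * norm (N - W) < \<delta>"
        using \<delta>(1) by (intro order_tendstoD(2)) simp_all
      then have ev: "\<forall>\<^sub>F n in sequentially. e \<le> h 0 - \<alpha> * (1 - (1/2)^n) * P - \<beta> * c (1 - (1/2)^n)"
        by eventually_elim (rule less_imp_le[OF near], auto simp: power_le_one)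
      have "(\<lambda>n. h 0 - \<alpha> * (1 - (1/2)^n) * P - \<beta> * c (1 - (1/2)^n)) \<longlonglongrightarrow> h 0 - \<alpha> * (1 - 0) * P - \<beta> * c (1 - 0)"
        unfolding c_def by (intro tendsto_intros lim)
      from tendsto_lowerbound[OF this ev] have "e \<le> h 0 - \<alpha> * (1 - 0) * P - \<beta> * c (1 - 0)" by simp
      then show False using e(1) by (simp add: s1)
    qed
  qed
  have "\<beta> * phi M ((1 - s) * a + s * b) \<le> \<beta> * c s" using phi_t[of s] s \<beta> by simp
  then have "\<Psi> (p s) + ereal (\<beta> * phi M ((1 - s) * a + s * b)) \<le> ereal (h 0 - \<alpha> * s * P - \<beta> * c s) + ereal (\<beta> * c s)"
    using \<Psi>s by (intro add_mono) auto
  moreover have "obj_M X D I0 \<Psi> \<beta> M (move s \<omega> v) = \<Psi> (p s) + ereal (\<beta> * phi M ((1 - s) * a + s * b))"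
    using s info_t[of s] by (simp add: obj_M_def psi_def info_def tv_norm_pos[OF pos_t] mass_t)
  ultimately show ?thesis by (simp add: h0)
qed

end

section \<open>The rate of convergence\<close>

text \<open>As \<open>q \<le> 1/2\<close>, the map \<open>x \<mapsto> x - q x\<^sup>2\<close> is increasing on \<open>[0, 1]\<close>, so the bound may be inserted into the
  recursion; then \<open>(1 - q x) (1 + q x) \<le> 1\<close> gives \<open>x - q x\<^sup>2 \<le> x / (1 + q x)\<close>, whose reciprocal is
  \<open>1/x + q\<close>.\<close>

lemma sublinear_recursion:
  fixes \<rho> :: "nat \<Rightarrow> real"
  assumes q: "0 \<le> q" "q \<le> 1/2" and \<rho>1: "\<rho> 1 \<le> 1"
    and rec: "\<And>k. 1 \<le> k \<Longrightarrow> \<rho> (k + 1) \<le> \<rho> k - q * (\<rho> k)\<^sup>2"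
    and nonneg: "\<And>k. 1 \<le> k \<Longrightarrow> 0 \<le> \<rho> k"
    and k: "1 \<le> k"
  shows "\<rho> k \<le> 1 / (1 + q * (real k - 1))"
  using k
proof (induction k rule: dec_induct)
  case base
  then show ?case using \<rho>1 by simp
next
  case (step k)
  define x where "x = 1 / (1 + q * (real k - 1))"
  have pos: "0 < 1 + q * (real k - 1)" using q(1) step(1) by (intro add_pos_nonneg mult_nonneg_nonneg) auto
  have x1: "0 < x" "x \<le> 1" using pos q(1) step(1) by (auto simp: x_def)
  have le: "0 \<le> \<rho> k" "\<rho> k \<le> x" using step nonneg by (auto simp: x_def)
  have "\<rho> (k + 1) \<le> \<rho> k - q * (\<rho> k)\<^sup>2" using rec step(1) by simp
  also have "\<dots> \<le> x - q * x\<^sup>2"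
  proof -
    have "q * (x + \<rho> k) \<le> (1/2) * 2" using q x1 le by (intro mult_mono) auto
    then have "0 \<le> (x - \<rho> k) * (1 - q * (x + \<rho> k))" using le by (intro mult_nonneg_nonneg) auto
    then show ?thesis by (simp add: algebra_simps power2_eq_square)
  qed
  also have "\<dots> \<le> x / (1 + q * x)"
  proof -
    have "(x - q * x\<^sup>2) * (1 + q * x) = x - q\<^sup>2 * x ^ 3" by (simp add: algebra_simps power2_eq_square power3_eq_cube)
    also have "\<dots> \<le> x" using x1 by simp
    finally show ?thesis using q(1) x1 by (simp add: pos_le_divide_eq add_pos_nonneg)
  qed
  also have "x / (1 + q * x) = 1 / (1 + q * (real (k + 1) - 1))"
  proof -
    have "1 + q * real k = (1 + q * (real k - 1)) + q" by (simp add: algebra_simps)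
    then have "1 + q * x = (1 + q * real k) / (1 + q * (real k - 1))"
      using pos by (simp add: x_def field_simps)
    then show ?thesis using pos by (simp add: x_def)
  qed
  finally show ?case by simp
qed

context sensor_problem
begin

definition Fr :: "((real^'d) set \<Rightarrow> real) \<Rightarrow> real" where
  "Fr \<omega> = \<Psi>r (info \<omega>) + \<beta> * \<omega> X"

lemma F_eq_Fr: "\<omega> \<in> pos_measures X \<Longrightarrow> info \<omega> \<in> PD \<Longrightarrow> F \<omega> = ereal (Fr \<omega>)"
  by (simp add: F_real Fr_def)

lemma mass_le:
  assumes "info \<omega> \<in> PD" "Fr \<omega> \<le> \<beta> * M"
  shows "\<omega> X \<le> M"
proof -
  have "\<beta> * \<omega> X \<le> \<beta> * M" using assms \<Psi>_real(2)[OF assms(1)] by (simp add: Fr_def)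
  then show ?thesis using \<beta> by simp
qed

lemma obj_le_obj_M:
  assumes "0 < M" "\<omega> \<in> pos_measures X" shows "F \<omega> \<le> obj_M X D I0 \<Psi> \<beta> M \<omega>"
  using phi_ge[OF assms(1), of "tv_norm X \<omega>"] \<beta> by (simp add: obj_def obj_M_def add_left_mono)

lemma armijo_iff:
  assumes \<omega>: "\<omega> \<in> pos_measures X" "info \<omega> \<in> PD" "\<omega> X \<le> M" and gap: "gap X D I0 \<Psi>' \<beta> M \<omega> = ereal P"
  shows "armijo X D I0 \<Psi> \<Psi>' \<beta> \<alpha> M \<omega> v s \<longleftrightarrow>
    obj_M X D I0 \<Psi> \<beta> M (move s \<omega> v) \<le> ereal (Fr \<omega> - \<alpha> * s * P)"
proof -
  have "obj_M X D I0 \<Psi> \<beta> M \<omega> = ereal (Fr \<omega>)"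
    using \<omega> by (simp add: obj_M_def psi_def info_def[symmetric] \<Psi>_real(1) tv_norm_pos phi_def Fr_def)
  then show ?thesis
    unfolding armijo_def gap by (cases "obj_M X D I0 \<Psi> \<beta> M (move s \<omega> v)") (auto simp: algebra_simps)
qed

text \<open>The accepted step length is either 1 or \<open>\<gamma>\<close> times a rejected one, and a rejected step length
  violates the sufficient condition for the Armijo test. The lower bound on \<open>s\<close> is quantified over all
  Lipschitz constants because the accepted step does not depend on them.\<close>

lemma insertion_step_decrease:
  assumes \<omega>: "\<omega> \<in> pos_measures X" "info \<omega> \<in> PD" "Fr \<omega> \<le> \<beta> * M" and M: "0 < M"
    and step_params: "0 < \<gamma>" "\<gamma> < 1" "0 < \<alpha>" and P: "gap X D I0 \<Psi>' \<beta> M \<omega> = ereal P" "0 < P"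
    and step: "insertion_step X D I0 \<Psi> \<Psi>' \<beta> \<gamma> \<alpha> M \<omega> y \<omega>'"
  obtains s where "0 < s" "\<omega>' \<in> pos_measures X" "info \<omega>' \<in> PD" "Fr \<omega>' \<le> Fr \<omega> - \<alpha> * s * P"
    "\<forall>L B \<omega>\<^sub>1. lipschitz_const_dpsi X D I0 \<Psi>' (sublevel X D I0 \<Psi> \<beta> \<omega>\<^sub>1) L \<longrightarrow> F \<omega> \<le> F \<omega>\<^sub>1 \<longrightarrow> 0 < B \<longrightarrow>
      \<omega> X + tv_norm X (insertion X D I0 \<Psi>' \<beta> M \<omega> y) \<le> B \<longrightarrow>
      min 1 (\<gamma> * (2 * (1 - \<alpha>) * P / (L * B\<^sup>2))) \<le> s"
proof -
  let ?v = "insertion X D I0 \<Psi>' \<beta> M \<omega> y"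
  have y: "is_arg_min (d\<psi> \<omega>) (\<lambda>x. x \<in> X) y" using step by (simp add: insertion_step_def)
  obtain n where n: "armijo X D I0 \<Psi> \<Psi>' \<beta> \<alpha> M \<omega> ?v (\<gamma> ^ n)"
      "\<And>m. m < n \<Longrightarrow> \<not> armijo X D I0 \<Psi> \<Psi>' \<beta> \<alpha> M \<omega> ?v (\<gamma> ^ m)"
    and \<omega>': "\<omega>' \<in> pos_measures X" "F \<omega>' \<le> F (move (\<gamma> ^ n) \<omega> ?v)"
    using step by (auto simp: insertion_step_def Let_def)
  have \<gamma>: "0 < \<gamma> ^ m" "\<gamma> ^ m \<le> 1" for m using step_params by (auto simp: power_le_one)
  have v: "?v \<in> pos_measures X" by (rule insertion_in_pos_measures[OF M])
  have mass: "\<omega> X \<le> M" by (rule mass_le[OF \<omega>(2,3)])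
  note armijo = armijo_iff[OF \<omega>(1,2) mass P(1)]
  have "F \<omega>' \<le> F (move (\<gamma> ^ n) \<omega> ?v)" by (rule \<omega>'(2))
  also have "\<dots> \<le> obj_M X D I0 \<Psi> \<beta> M (move (\<gamma> ^ n) \<omega> ?v)"
    using \<gamma>[of n] by (intro obj_le_obj_M M move_in_pos_measures \<omega> v) auto
  also have "\<dots> \<le> ereal (Fr \<omega> - \<alpha> * \<gamma> ^ n * P)" using n(1) by (simp add: armijo)
  finally have dec: "F \<omega>' \<le> ereal (Fr \<omega> - \<alpha> * \<gamma> ^ n * P)" .
  show thesis
  proof (rule that[OF \<gamma>(1) \<omega>'(1) F_finite(1)[OF \<omega>'(1) dec]])
    show "Fr \<omega>' \<le> Fr \<omega> - \<alpha> * \<gamma> ^ n * P" using F_finite(2)[OF \<omega>'(1) dec] by (simp add: Fr_def)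
    show "\<forall>L B \<omega>\<^sub>1. lipschitz_const_dpsi X D I0 \<Psi>' (sublevel X D I0 \<Psi> \<beta> \<omega>\<^sub>1) L \<longrightarrow> F \<omega> \<le> F \<omega>\<^sub>1 \<longrightarrow> 0 < B \<longrightarrow>
      \<omega> X + tv_norm X ?v \<le> B \<longrightarrow> min 1 (\<gamma> * (2 * (1 - \<alpha>) * P / (L * B\<^sup>2))) \<le> \<gamma> ^ n"
    proof (intro allI impI)
      fix L B \<omega>\<^sub>1
      assume L: "lipschitz_const_dpsi X D I0 \<Psi>' (sublevel X D I0 \<Psi> \<beta> \<omega>\<^sub>1) L" and "F \<omega> \<le> F \<omega>\<^sub>1" "0 < B"
        and B: "\<omega> X + tv_norm X ?v \<le> B"
      have sub: "\<omega> \<in> sublevel X D I0 \<Psi> \<beta> \<omega>\<^sub>1" using \<omega>(1) \<open>F \<omega> \<le> F \<omega>\<^sub>1\<close> by (simp add: sublevel_def)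
      have LB: "0 < L * B\<^sup>2" using L \<open>0 < B\<close> by (simp add: lipschitz_const_dpsi_def)
      have P': "gap_at M \<omega> ?v = P" using gap_attained[OF \<omega>(1) M y] P(1) by simp
      show "min 1 (\<gamma> * (2 * (1 - \<alpha>) * P / (L * B\<^sup>2))) \<le> \<gamma> ^ n"
      proof (cases n)
        case (Suc m)
        have "\<not> L * B\<^sup>2 * \<gamma> ^ m \<le> 2 * (1 - \<alpha>) * P"
        proof
          assume "L * B\<^sup>2 * \<gamma> ^ m \<le> 2 * (1 - \<alpha>) * P"
          from armijo_sufficient[OF sub \<omega>(2) v M mass P' P(2) L _ step_params(3) \<gamma> this] B
          have "armijo X D I0 \<Psi> \<Psi>' \<beta> \<alpha> M \<omega> ?v (\<gamma> ^ m)" unfolding armijo by (simp add: tv_norm_pos[OF v] Fr_def)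
          then show False using n(2)[of m] Suc by simp
        qed
        then have "2 * (1 - \<alpha>) * P / (L * B\<^sup>2) \<le> \<gamma> ^ m" using LB by (simp add: pos_divide_le_eq mult.commute)
        then have "\<gamma> * (2 * (1 - \<alpha>) * P / (L * B\<^sup>2)) \<le> \<gamma> * \<gamma> ^ m" using step_params(1) by (intro mult_left_mono) auto
        then show ?thesis using Suc by simp
      qed simp
    qed
  qed
qed

end

locale insertion_run = sensor_problem X D I0 \<Psi> \<Psi>' \<beta>
  for X :: "(real^'d) set" and D :: "real^'d \<Rightarrow> real^'n" and I0 \<Psi> \<Psi>' \<beta> +
  fixes \<alpha> \<gamma> :: real and \<omega> :: "nat \<Rightarrow> (real^'d) set \<Rightarrow> real" and y :: "nat \<Rightarrow> real^'d"
  assumes step_params: "0 < \<gamma>" "\<gamma> < 1" "0 < \<alpha>" "\<alpha> \<le> 1/2"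
    and gen: "generated X D I0 \<Psi> \<Psi>' \<beta> \<gamma> \<alpha> \<omega> y"
begin

abbreviation "M\<^sub>0 \<equiv> M_init X D I0 \<Psi> \<beta> (\<omega> 1)"
abbreviation "E\<^sub>1 \<equiv> sublevel X D I0 \<Psi> \<beta> (\<omega> 1)"

definition inf_value where "inf_value = real_of_ereal (INF v\<in>pos_measures X. F v)"

lemma start: "\<omega> 1 \<in> pos_measures X" "info (\<omega> 1) \<in> PD"
  using gen \<Psi>_finite_iff[OF info_NND] by (auto simp: generated_def dom_psi_def psi_def info_def)

lemma M0: "0 < M\<^sub>0" "\<beta> * M\<^sub>0 = Fr (\<omega> 1)"
  using gen \<beta> F_eq_Fr[OF start] by (auto simp: generated_def Let_def M_init_def)

lemma generated_step:
  assumes "1 \<le> k" "0 < gap X D I0 \<Psi>' \<beta> M\<^sub>0 (\<omega> k)"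
  shows "insertion_step X D I0 \<Psi> \<Psi>' \<beta> \<gamma> \<alpha> M\<^sub>0 (\<omega> k) (y k) (\<omega> (k + 1))"
  using gen assms unfolding generated_def Let_def by blast

lemma generated_stop:
  assumes "1 \<le> k" "gap X D I0 \<Psi>' \<beta> M\<^sub>0 (\<omega> k) = 0"
  shows "\<omega> (k + 1) = \<omega> k"
  using gen assms unfolding generated_def Let_def by blast

lemma gap_real:
  assumes "v \<in> pos_measures X"
  obtains P where "gap X D I0 \<Psi>' \<beta> M\<^sub>0 v = ereal P"
  using dpsi_arg_min_exists gap_attained[OF assms M0(1)] by metis

lemma INF_eq: "(INF v\<in>pos_measures X. F v) = ereal inf_value"
proof -
  have "(INF v\<in>pos_measures X. F v) \<le> ereal (Fr (\<omega> 1))"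
    using INF_lower[OF start(1), of F] F_eq_Fr[OF start] by simp
  moreover have "0 \<le> (INF v\<in>pos_measures X. F v)"
  proof (rule INF_greatest)
    fix v assume v: "v \<in> pos_measures X"
    show "0 \<le> F v"
      using nonneg[OF info_NND[OF v]] \<beta> tv_norm_nonneg_pos[OF v] by (simp add: obj_def psi_def info_def)
  qed
  ultimately show ?thesis unfolding inf_value_def by (cases "INF v\<in>pos_measures X. F v") auto
qed

lemma inf_value_le: "v \<in> pos_measures X \<Longrightarrow> ereal inf_value \<le> F v"
  using INF_lower[of v "pos_measures X" F] by (simp add: INF_eq)

text \<open>The invariant of the iteration, and what one iteration achieves: a stop means that the gap, hence the
  residual, vanishes.\<close>

lemma step_cases:
  assumes k: "1 \<le> k" and \<omega>: "\<omega> k \<in> pos_measures X" "info (\<omega> k) \<in> PD" "Fr (\<omega> k) \<le> Fr (\<omega> 1)"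
  obtains P where "gap X D I0 \<Psi>' \<beta> M\<^sub>0 (\<omega> k) = ereal P" "0 \<le> P" "Fr (\<omega> k) - inf_value \<le> P"
    "P = 0 \<longrightarrow> \<omega> (k + 1) = \<omega> k"
    "0 < P \<longrightarrow> insertion_step X D I0 \<Psi> \<Psi>' \<beta> \<gamma> \<alpha> M\<^sub>0 (\<omega> k) (y k) (\<omega> (k + 1))"
proof -
  obtain P where P: "gap X D I0 \<Psi>' \<beta> M\<^sub>0 (\<omega> k) = ereal P" using gap_real[OF \<omega>(1)] by metis
  have "\<Psi>r (info (\<omega> k)) + \<beta> * \<omega> k X \<le> \<beta> * M\<^sub>0" using \<omega>(3) M0(2) by (simp add: Fr_def)
  note res = residual_le_gap[OF \<omega>(1,2) M0(1) this P]
  have "ereal (\<Psi>r (info (\<omega> k)) + \<beta> * \<omega> k X - P) \<le> (INF v\<in>pos_measures X. F v)"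
    by (rule INF_greatest) (rule res(2))
  then have "Fr (\<omega> k) - inf_value \<le> P" by (simp add: INF_eq Fr_def)
  moreover have "P = 0 \<longrightarrow> \<omega> (k + 1) = \<omega> k"
      "0 < P \<longrightarrow> insertion_step X D I0 \<Psi> \<Psi>' \<beta> \<gamma> \<alpha> M\<^sub>0 (\<omega> k) (y k) (\<omega> (k + 1))"
    using generated_step[OF k] generated_stop[OF k] P by (auto simp: zero_ereal_def)
  ultimately show thesis using that[OF P res(1)] by blast
qed

lemma iterates:
  assumes "1 \<le> k"
  shows "\<omega> k \<in> pos_measures X \<and> info (\<omega> k) \<in> PD \<and> Fr (\<omega> k) \<le> Fr (\<omega> 1)"
  using assms
proof (induction k rule: dec_induct)
  case base
  then show ?case using start by simp
next
  case (step k)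
  then have \<omega>: "\<omega> k \<in> pos_measures X" "info (\<omega> k) \<in> PD" "Fr (\<omega> k) \<le> Fr (\<omega> 1)" by auto
  obtain P where P: "gap X D I0 \<Psi>' \<beta> M\<^sub>0 (\<omega> k) = ereal P" "0 \<le> P" "Fr (\<omega> k) - inf_value \<le> P"
    "P = 0 \<longrightarrow> \<omega> (k + 1) = \<omega> k"
    "0 < P \<longrightarrow> insertion_step X D I0 \<Psi> \<Psi>' \<beta> \<gamma> \<alpha> M\<^sub>0 (\<omega> k) (y k) (\<omega> (k + 1))"
    by (rule step_cases[OF step(1) \<omega>])
  show ?case
  proof (cases "P = 0")
    case True
    then show ?thesis using P(4) \<omega> by simp
  next
    case False
    then have "0 < P" using P(2) by simp
    have "Fr (\<omega> k) \<le> \<beta> * M\<^sub>0" using \<omega>(3) M0(2) by simp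
    note decrease = insertion_step_decrease[OF \<omega>(1,2) this M0(1) step_params(1-3) P(1) \<open>0 < P\<close>
        P(5)[rule_format, OF \<open>0 < P\<close>]]
    obtain s where s: "0 < s" "\<omega> (k + 1) \<in> pos_measures X" "info (\<omega> (k + 1)) \<in> PD"
      "Fr (\<omega> (k + 1)) \<le> Fr (\<omega> k) - \<alpha> * s * P"
      by (rule decrease) (rule that)
    have "0 \<le> \<alpha> * s * P" using s(1) step_params(3) P(2) by simp
    then show ?thesis using s \<omega>(3) by simp
  qed
qed

lemma F_iterate: "1 \<le> k \<Longrightarrow> F (\<omega> k) = ereal (Fr (\<omega> k))"
  using iterates F_eq_Fr by blast

lemma iterate_in_sublevel: "1 \<le> k \<Longrightarrow> \<omega> k \<in> E\<^sub>1"
  using iterates[of k] F_iterate[of k] F_iterate[OF order_refl] unfolding sublevel_def by simp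

lemma iterate_mass:
  assumes "1 \<le> k" shows "\<omega> k X \<le> M\<^sub>0"
proof (rule mass_le)
  show "info (\<omega> k) \<in> PD" "Fr (\<omega> k) \<le> \<beta> * M\<^sub>0" unfolding M0(2) using iterates[OF assms] by blast+
qed

lemma residual_eq: "1 \<le> k \<Longrightarrow> residual X D I0 \<Psi> \<beta> (\<omega> k) = ereal (Fr (\<omega> k) - inf_value)"
  unfolding residual_def INF_eq F_iterate by simp

lemma residual_nonneg:
  assumes "1 \<le> k" shows "0 \<le> Fr (\<omega> k) - inf_value"
  using inf_value_le[OF conjunct1[OF iterates[OF assms]]] unfolding F_iterate[OF assms] by simp

lemma insertion_bound_exists: "\<exists>c\<^sub>2. insertion_bound X D I0 \<Psi> \<Psi>' \<beta> \<omega> y c\<^sub>2"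
proof -
  obtain b where b: "0 < b" "\<And>\<nu> x. \<nu> \<in> E\<^sub>1 \<Longrightarrow> x \<in> X \<Longrightarrow> \<bar>d\<psi> \<nu> x\<bar> \<le> b"
    using dpsi_bounded_on_sublevel[OF start] by metis
  have "tv_norm X (insertion X D I0 \<Psi>' \<beta> M\<^sub>0 (\<omega> k) (y k)) \<le> (M\<^sub>0 / \<beta>) * b"
    if k: "1 \<le> k" "0 < gap X D I0 \<Psi>' \<beta> M\<^sub>0 (\<omega> k)" for k
  proof -
    have "insertion_step X D I0 \<Psi> \<Psi>' \<beta> \<gamma> \<alpha> M\<^sub>0 (\<omega> k) (y k) (\<omega> (k + 1))"
      by (rule generated_step[OF k])
    then have yX: "y k \<in> X" by (simp add: insertion_step_def is_arg_min_def)
    let ?p = "d\<psi> (\<omega> k) (y k)"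
    have "\<bar>?p\<bar> \<le> b" by (rule b(2)[OF iterate_in_sublevel[OF k(1)] yX])
    then have "(M\<^sub>0 / \<beta>) * (- ?p) \<le> (M\<^sub>0 / \<beta>) * b" using M0(1) \<beta> by (intro mult_left_mono) auto
    moreover have "0 \<le> (M\<^sub>0 / \<beta>) * b" using M0(1) \<beta> b(1) by simp
    ultimately have "opt_weight \<beta> M\<^sub>0 ?p \<le> (M\<^sub>0 / \<beta>) * b" by (auto simp: opt_weight_def)
    then show ?thesis
      unfolding tv_norm_pos[OF insertion_in_pos_measures[OF M0(1)]] insertion_mass[OF yX] .
  qed
  then have "insertion_bound X D I0 \<Psi> \<Psi>' \<beta> \<omega> y ((M\<^sub>0 / \<beta>) * b)"
    using M0(1) \<beta> b(1) by (simp add: insertion_bound_def Let_def)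
  then show ?thesis by blast
qed

text \<open>The decrease is \<open>\<alpha> s P\<close> with gap \<open>P\<close> at least the residual \<open>r\<close> and step length at least
  \<open>min 1 (\<kappa> \<rho>)\<close>, where \<open>\<rho> = r / r\<^sub>1 \<le> 1\<close> is the relative residual. As \<open>min 1 (\<kappa> \<rho>) \<ge> min \<kappa> 1 * \<rho>\<close>, the
  relative residual decreases quadratically in itself.\<close>

lemma residual_decrease:
  assumes L: "lipschitz_const_dpsi X D I0 \<Psi>' E\<^sub>1 L" and c2: "insertion_bound X D I0 \<Psi> \<Psi>' \<beta> \<omega> y c\<^sub>2"
    and k: "1 \<le> k" and r1: "0 < Fr (\<omega> 1) - inf_value"
    and \<kappa>: "\<kappa> = 2 * \<gamma> * (1 - \<alpha>) * (Fr (\<omega> 1) - inf_value) / (L * (M\<^sub>0 + c\<^sub>2)\<^sup>2)"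
  defines "\<rho> \<equiv> \<lambda>k. (Fr (\<omega> k) - inf_value) / (Fr (\<omega> 1) - inf_value)"
  shows "\<rho> (k + 1) \<le> \<rho> k - \<alpha> * min \<kappa> 1 * (\<rho> k)\<^sup>2"
proof -
  define r where "r = Fr (\<omega> k) - inf_value"
  define r1 where "r1 = Fr (\<omega> 1) - inf_value"
  have r1: "0 < r1" using assms(4) by (simp add: r1_def)
  have \<omega>: "\<omega> k \<in> pos_measures X" "info (\<omega> k) \<in> PD" "Fr (\<omega> k) \<le> Fr (\<omega> 1)" using iterates[OF k] by auto
  have r: "0 \<le> r" "r \<le> r1" using residual_nonneg[OF k] \<omega>(3) by (auto simp: r_def r1_def)
  have \<rho>: "\<rho> k = r / r1" "0 \<le> \<rho> k" "\<rho> k \<le> 1" using r r1 by (auto simp: \<rho>_def r_def r1_def)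
  have L0: "0 < L" and c20: "0 < c\<^sub>2" using L c2 by (auto simp: lipschitz_const_dpsi_def insertion_bound_def)
  define B where "B = M\<^sub>0 + c\<^sub>2"
  have B: "0 < B" using M0(1) c20 by (simp add: B_def)
  have \<kappa>0: "0 \<le> \<kappa>" using \<kappa> L0 r1 step_params by (simp add: r1_def)
  obtain P where P: "gap X D I0 \<Psi>' \<beta> M\<^sub>0 (\<omega> k) = ereal P" "0 \<le> P" "r \<le> P"
    "P = 0 \<longrightarrow> \<omega> (k + 1) = \<omega> k"
    "0 < P \<longrightarrow> insertion_step X D I0 \<Psi> \<Psi>' \<beta> \<gamma> \<alpha> M\<^sub>0 (\<omega> k) (y k) (\<omega> (k + 1))"
    unfolding r_def by (rule step_cases[OF k \<omega>])
  have "Fr (\<omega> (k + 1)) - inf_value \<le> r - \<alpha> * (min \<kappa> 1 * \<rho> k) * r"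
  proof (cases "P = 0")
    case True
    then have "r = 0" using P(3) r(1) by simp
    then show ?thesis using P(4) True by (simp add: r_def)
  next
    case False
    then have P0: "0 < P" using P(2) by simp
    have "Fr (\<omega> k) \<le> \<beta> * M\<^sub>0" using \<omega>(3) M0(2) by simp
    note decrease = insertion_step_decrease[OF \<omega>(1,2) this M0(1) step_params(1-3) P(1) P0
        P(5)[rule_format, OF P0]]
    obtain s where s: "0 < s" "Fr (\<omega> (k + 1)) \<le> Fr (\<omega> k) - \<alpha> * s * P"
      and lower: "\<forall>L B \<omega>\<^sub>1. lipschitz_const_dpsi X D I0 \<Psi>' (sublevel X D I0 \<Psi> \<beta> \<omega>\<^sub>1) L \<longrightarrow> F (\<omega> k) \<le> F \<omega>\<^sub>1 \<longrightarrow> 0 < B \<longrightarrow>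
        \<omega> k X + tv_norm X (insertion X D I0 \<Psi>' \<beta> M\<^sub>0 (\<omega> k) (y k)) \<le> B \<longrightarrow>
        min 1 (\<gamma> * (2 * (1 - \<alpha>) * P / (L * B\<^sup>2))) \<le> s"
      by (rule decrease) (rule that)
    have "tv_norm X (insertion X D I0 \<Psi>' \<beta> M\<^sub>0 (\<omega> k) (y k)) \<le> c\<^sub>2"
      using c2 k P(1) P0 by (simp add: insertion_bound_def Let_def)
    then have "min 1 (\<gamma> * (2 * (1 - \<alpha>) * P / (L * B\<^sup>2))) \<le> s"
      using iterate_mass[OF k] F_iterate[OF k] F_iterate[of 1] \<omega>(3) B by (intro lower[rule_format, OF L]) (auto simp: B_def)
    moreover have "min \<kappa> 1 * \<rho> k \<le> min 1 (\<gamma> * (2 * (1 - \<alpha>) * P / (L * B\<^sup>2)))"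
    proof (rule min.boundedI)
      have "min \<kappa> 1 * \<rho> k \<le> 1 * 1" using \<rho> \<kappa>0 by (intro mult_mono) auto
      then show "min \<kappa> 1 * \<rho> k \<le> 1" by simp
      have "min \<kappa> 1 * \<rho> k \<le> \<kappa> * \<rho> k" using \<rho>(2) by (intro mult_right_mono) auto
      also have "\<dots> = \<gamma> * (2 * (1 - \<alpha>) * r / (L * B\<^sup>2))"
        using r1 unfolding \<kappa> \<rho>(1) r1_def[symmetric] B_def[symmetric] by simp
      also have "\<dots> \<le> \<gamma> * (2 * (1 - \<alpha>) * P / (L * B\<^sup>2))"
        using P(3) L0 step_params by (intro mult_left_mono divide_right_mono) auto
      finally show "min \<kappa> 1 * \<rho> k \<le> \<gamma> * (2 * (1 - \<alpha>) * P / (L * B\<^sup>2))" .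
    qed
    ultimately have "min \<kappa> 1 * \<rho> k \<le> s" by linarith
    then have "\<alpha> * (min \<kappa> 1 * \<rho> k) * r \<le> \<alpha> * s * P"
      using P(3) r(1) s(1) step_params(3) by (intro mult_mono mult_left_mono) auto
    then show ?thesis using s(2) by (simp add: r_def)
  qed
  then have "\<rho> (k + 1) \<le> (r - \<alpha> * (min \<kappa> 1 * \<rho> k) * r) / r1"
    unfolding \<rho>_def r1_def[symmetric] using r1 by (intro divide_right_mono) auto
  also have "\<dots> = \<rho> k - \<alpha> * min \<kappa> 1 * (\<rho> k)\<^sup>2"
    unfolding \<rho>(1) by (simp add: diff_divide_distrib power2_eq_square)
  finally show ?thesis .
qed

lemma residual_rate:
  assumes L: "lipschitz_const_dpsi X D I0 \<Psi>' E\<^sub>1 L" and c2: "insertion_bound X D I0 \<Psi> \<Psi>' \<beta> \<omega> y c\<^sub>2"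
    and k: "1 \<le> k" and \<kappa>: "\<kappa> = 2 * \<gamma> * (1 - \<alpha>) * (Fr (\<omega> 1) - inf_value) / (L * (M\<^sub>0 + c\<^sub>2)\<^sup>2)"
  shows "Fr (\<omega> k) - inf_value \<le> (Fr (\<omega> 1) - inf_value) / (1 + \<alpha> * min \<kappa> 1 * (real k - 1))"
proof (cases "Fr (\<omega> 1) - inf_value = 0")
  case True
  then show ?thesis using iterates[OF k] by simp
next
  case False
  then have r1: "0 < Fr (\<omega> 1) - inf_value" using residual_nonneg[of 1] by simp
  have L0: "0 < L" using L by (auto simp: lipschitz_const_dpsi_def)
  have \<kappa>0: "0 \<le> \<kappa>" using \<kappa> L0 r1 step_params by simp
  have q: "0 \<le> \<alpha> * min \<kappa> 1" "\<alpha> * min \<kappa> 1 \<le> 1/2"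
    using \<kappa>0 step_params mult_mono[of \<alpha> "1/2" "min \<kappa> 1" 1] by auto
  have "(Fr (\<omega> k) - inf_value) / (Fr (\<omega> 1) - inf_value) \<le> 1 / (1 + \<alpha> * min \<kappa> 1 * (real k - 1))"
    using r1 residual_nonneg residual_decrease[OF L c2 _ r1 \<kappa>]
    by (intro sublinear_recursion[OF q, where \<rho>="\<lambda>k. (Fr (\<omega> k) - inf_value) / (Fr (\<omega> 1) - inf_value)"] k) auto
  then show ?thesis using r1 by (simp add: pos_divide_le_eq)
qed

lemma Fr_eventually_less:
  assumes "inf_value < e"
  obtains K where "\<And>k. K \<le> k \<Longrightarrow> 1 \<le> k \<Longrightarrow> Fr (\<omega> k) < e"
proof -
  obtain L where L: "lipschitz_const_dpsi X D I0 \<Psi>' E\<^sub>1 L" using dpsi_lipschitz_exists[OF start] by blast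
  obtain c2 where c2: "insertion_bound X D I0 \<Psi> \<Psi>' \<beta> \<omega> y c2" using insertion_bound_exists by blast
  define r1 where "r1 = Fr (\<omega> 1) - inf_value"
  define \<kappa> where "\<kappa> = 2 * \<gamma> * (1 - \<alpha>) * (Fr (\<omega> 1) - inf_value) / (L * (M\<^sub>0 + c2)\<^sup>2)"
  define q where "q = \<alpha> * min \<kappa> 1"
  show thesis
  proof (cases "r1 = 0")
    case True
    then show thesis using that[of 0] iterates assms by (force simp: r1_def)
  next
    case False
    then have r1: "0 < r1" using residual_nonneg[of 1] by (simp add: r1_def)
    have "0 < L * (M\<^sub>0 + c2)\<^sup>2"
      using L c2 M0(1) by (simp add: lipschitz_const_dpsi_def insertion_bound_def)
    moreover have "0 < 2 * \<gamma> * (1 - \<alpha>) * (Fr (\<omega> 1) - inf_value)"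
      using r1 step_params unfolding r1_def by (intro mult_pos_pos) auto
    ultimately have "0 < \<kappa>" unfolding \<kappa>_def by (intro divide_pos_pos)
    then have q: "0 < q" using step_params by (simp add: q_def)
    obtain K where K: "r1 < real K * (q * (e - inf_value))"
      using ex_less_of_nat_mult[of "q * (e - inf_value)" r1] q assms by auto
    show thesis
    proof (rule that)
      fix k assume k: "Suc K \<le> k" "1 \<le> k"
      have "real K * q \<le> 1 + q * (real k - 1)" using k q by (simp add: mult.commute mult_left_mono add_increasing)
      then have "real K * q * (e - inf_value) \<le> (1 + q * (real k - 1)) * (e - inf_value)" using assms by (intro mult_right_mono) auto
      then have "r1 < (e - inf_value) * (1 + q * (real k - 1))" using K by (simp add: mult.commute mult.left_commute)
      moreover have "0 < 1 + q * (real k - 1)" using q k(2) by (intro add_pos_nonneg) auto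
      ultimately have "r1 / (1 + q * (real k - 1)) < e - inf_value" by (simp add: pos_divide_less_eq)
      then show "Fr (\<omega> k) < e" using residual_rate[OF L c2 k(2) \<kappa>_def] by (simp add: r1_def q_def)
    qed
  qed
qed

section \<open>Optimality of the accumulation points\<close>

lemma accumulation_point_exists: "\<exists>\<mu>. weak_star_accumulation_point X \<omega> \<mu>"
proof -
  obtain r \<mu> where r: "strict_mono (r :: nat \<Rightarrow> nat)" and \<mu>: "\<mu> \<in> pos_measures X"
    and lim: "\<And>f. continuous_on X f \<Longrightarrow> (\<lambda>k. pairing X f (\<omega> (Suc (r k)))) \<longlonglongrightarrow> pairing X f \<mu>"
    using pos_measures_weak_star_compact[OF compact_X X_ne, of "\<lambda>k. \<omega> (Suc k)" M\<^sub>0] iterates iterate_mass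
    by (metis le_add1 plus_1_eq_Suc)
  have "weak_star_accumulation_point X \<omega> \<mu>"
  proof (rule weak_star_accumulation_pointI[where r="\<lambda>k. Suc (r k)"])
    show "strict_mono (\<lambda>k. Suc (r k))" using r by (simp add: strict_mono_def)
    show "\<omega> (Suc (r k)) \<in> signed_measures X" for k using iterates[of "Suc (r k)"] pos_measures_signed by auto
  qed (use lim pos_measures_signed[OF \<mu>] in auto)
  then show ?thesis by blast
qed

text \<open>The objective depends on a positive measure only through finitely many pairings, namely the entries of
  its information matrix and its mass, and is lower semicontinuous in them.\<close>

lemma accumulation_point_optimal:
  assumes acc: "weak_star_accumulation_point X \<omega> \<mu>"
  shows "is_arg_min F (\<lambda>v. v \<in> pos_measures X) \<mu>"
proof -
  have \<mu>: "\<mu> \<in> pos_measures X"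
    using weak_star_accumulation_point_pos[OF compact_X _ acc] iterates by blast
  have "F \<mu> \<le> F v" if v: "v \<in> pos_measures X" for v
  proof (rule ccontr)
    assume "\<not> F \<mu> \<le> F v"
    then have "F v < F \<mu>" by (simp add: not_le)
    from ereal_dense2[OF this] obtain e where e: "F v < ereal e" "ereal e < F \<mu>" by blast
    have "inf_value < e" using inf_value_le[OF v] e(1) by (metis ereal_less_eq(3) less_ereal.simps(1) order.strict_trans1)
    then obtain K where K: "\<And>k. K \<le> k \<Longrightarrow> 1 \<le> k \<Longrightarrow> Fr (\<omega> k) < e" using Fr_eventually_less by metis
    have "ereal (e - \<beta> * \<mu> X) < \<Psi> (info \<mu>)"
      using e(2) by (cases "\<Psi> (info \<mu>)") (auto simp: obj_def psi_def info_def tv_norm_pos[OF \<mu>])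
    then obtain d where d: "ereal (e - \<beta> * \<mu> X) < ereal d" "ereal d < \<Psi> (info \<mu>)"
      using ereal_dense2 by blast
    have "\<forall>\<^sub>F A in at (info \<mu>) within NND. ereal d < \<Psi> A"
      using lsc info_NND[OF \<mu>] d(2) unfolding lsc_on_def by blast
    then obtain \<delta> where \<delta>: "0 < \<delta>"
        "\<And>A. A \<in> NND \<Longrightarrow> A \<noteq> info \<mu> \<Longrightarrow> dist A (info \<mu>) < \<delta> \<Longrightarrow> ereal d < \<Psi> A"
      unfolding eventually_at by blast
    define \<eta> where "\<eta> = d + \<beta> * \<mu> X - e"
    have \<eta>: "0 < \<eta>" using d(1) by (simp add: \<eta>_def)
    define n2 where "n2 = real CARD('n) * real CARD('n)"
    have n2: "0 \<le> n2" by (simp add: n2_def)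
    \<comment> \<open>Entries within \<open>\<epsilon>\<close> put the matrix within \<open>\<delta>\<close> in norm, and a mass within \<open>\<epsilon>\<close> costs at most \<open>\<eta>\<close>.\<close>
    define \<epsilon> where "\<epsilon> = min (\<delta> / (n2 + 1)) (\<eta> / \<beta>)"
    have \<epsilon>: "0 < \<epsilon>" "\<beta> * \<epsilon> \<le> \<eta>" "n2 * \<epsilon> < \<delta>"
    proof -
      show "0 < \<epsilon>" using \<delta>(1) \<eta> \<beta> n2 by (simp add: \<epsilon>_def)
      have "\<epsilon> \<le> \<eta> / \<beta>" by (simp add: \<epsilon>_def)
      then show "\<beta> * \<epsilon> \<le> \<eta>" using \<beta> by (simp add: pos_le_divide_eq mult.commute)
      have "\<epsilon> \<le> \<delta> / (n2 + 1)" by (simp add: \<epsilon>_def)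
      then have "\<epsilon> * (n2 + 1) \<le> \<delta>" using n2 by (simp add: pos_le_divide_eq)
      then show "n2 * \<epsilon> < \<delta>" using \<open>0 < \<epsilon>\<close> by (simp add: algebra_simps)
    qed
    let ?G = "insert (\<lambda>x. 1) ((\<lambda>(k, l) x. D x $ k * D x $ l) ` UNIV)"
    have "infinite {k. 1 \<le> k \<and> (\<forall>f\<in>?G. \<bar>pairing X f (\<omega> k) - pairing X f \<mu>\<bar> < \<epsilon>)}"
      by (rule weak_star_accumulation_frequently[OF acc _ _ \<epsilon>(1)])
        (auto intro!: continuous_intros D_cont)
    then obtain k where k: "K \<le> k" "1 \<le> k"
      and close: "\<And>f. f \<in> ?G \<Longrightarrow> \<bar>pairing X f (\<omega> k) - pairing X f \<mu>\<bar> < \<epsilon>"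
      unfolding infinite_nat_iff_unbounded_le by blast
    have \<omega>: "\<omega> k \<in> pos_measures X" "info (\<omega> k) \<in> PD" using iterates[OF k(2)] by auto
    have "norm (info (\<omega> k) - info \<mu>) \<le> real CARD('n) * (real CARD('n) * \<epsilon>)"
    proof (rule norm_matrix_le)
      fix i j
      have "(\<lambda>x. D x $ i * D x $ j) \<in> ?G" by (rule insertI2, rule image_eqI[of _ _ "(i, j)"]) auto
      from close[OF this] show "\<bar>(info (\<omega> k) - info \<mu>) $ i $ j\<bar> \<le> \<epsilon>" by (simp add: info_def fisher_def)
    qed
    also have "\<dots> < \<delta>" using \<epsilon>(3) by (simp add: n2_def)
    finally have "dist (info (\<omega> k)) (info \<mu>) < \<delta>" by (simp add: dist_norm)
    then have "ereal d < \<Psi> (info (\<omega> k))"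
      using \<delta>(2)[OF info_NND[OF \<omega>(1)]] d(2) by (cases "info (\<omega> k) = info \<mu>") auto
    then have "d < \<Psi>r (info (\<omega> k))" using \<Psi>_real(1)[OF \<omega>(2)] by simp
    moreover have "\<beta> * \<mu> X - \<eta> \<le> \<beta> * \<omega> k X"
    proof -
      have "\<bar>\<omega> k X - \<mu> X\<bar> < \<epsilon>" using close[of "\<lambda>x. 1"] pairing_const[OF \<omega>(1), of 1] pairing_const[OF \<mu>, of 1] by simp
      then have "\<beta> * (\<mu> X - \<omega> k X) \<le> \<beta> * \<epsilon>" using \<beta> by (intro mult_left_mono) auto
      then show ?thesis using \<epsilon>(2) by (simp add: algebra_simps)
    qed
    ultimately have "e < Fr (\<omega> k)" by (simp add: Fr_def \<eta>_def)
    then show False using K[OF k] by simp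
  qed
  then show ?thesis using \<mu> by (auto simp: is_arg_min_def not_less)
qed

end

theorem theorem4p7:
  fixes \<Omega> X :: "(real^'d) set"
    and Q U :: "(real^'n) set" and qh :: "real^'n"
    and S :: "real^'n \<Rightarrow> real^'d \<Rightarrow> real"
    and dS :: "real^'n \<Rightarrow> real^'d \<Rightarrow> real^'n"
    and I0 :: "real^'n^'n"
    and \<Psi> :: "real^'n^'n \<Rightarrow> ereal"
    and \<Psi>' :: "real^'n^'n \<Rightarrow> real^'n^'n"
    and \<alpha> \<beta> \<gamma> :: real
    and \<omega> :: "nat \<Rightarrow> (real^'d) set \<Rightarrow> real"
    and y :: "nat \<Rightarrow> real^'d"
  assumes domain: "open \<Omega>" "connected \<Omega>" "bounded \<Omega>" "\<Omega> \<noteq> {}"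
    and obs: "X \<subseteq> closure \<Omega>" "X \<noteq> {}" "closed X"
    and state: "open U" "Q \<subseteq> U" "C1_state_map U X S dS" "qh \<in> Q"
    and params: "I0 \<in> NND" "0 < \<beta>"
    and proper: "\<forall>N\<in>Sym. \<Psi> N \<noteq> - \<infinity>"
    and A1: "{N \<in> Sym. \<Psi> N < \<infinity>} = PD"
    and A2: "C1_on_PD \<Psi> \<Psi>'"
    and A3: "\<forall>N\<in>NND. 0 \<le> \<Psi> N"
    and A4: "lsc_on NND \<Psi>" "ereal_convex_on NND \<Psi>"
    and A5: "\<forall>N\<^sub>1\<in>NND. \<forall>N\<^sub>2\<in>NND. loewner_le N\<^sub>1 N\<^sub>2 \<longrightarrow> \<Psi> N\<^sub>1 \<ge> \<Psi> N\<^sub>2"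
    and lip: "\<forall>K. compact K \<and> K \<subseteq> PD \<longrightarrow> (\<exists>L. L-lipschitz_on K \<Psi>')"
    and step_params: "0 < \<gamma>" "\<gamma> < 1" "0 < \<alpha>" "\<alpha> \<le> 1/2"
    and gen: "generated X (dS qh) I0 \<Psi> \<Psi>' \<beta> \<gamma> \<alpha> \<omega> y"
  shows "(\<exists>\<mu>. weak_star_accumulation_point X \<omega> \<mu>) \<and>
    (\<forall>\<mu>. weak_star_accumulation_point X \<omega> \<mu> \<longrightarrow>
       is_arg_min (obj X (dS qh) I0 \<Psi> \<beta>) (\<lambda>v. v \<in> pos_measures X) \<mu>) \<and>
    (\<exists>L. lipschitz_const_dpsi X (dS qh) I0 \<Psi>' (sublevel X (dS qh) I0 \<Psi> \<beta> (\<omega> 1)) L) \<and>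
    (\<exists>c\<^sub>2. insertion_bound X (dS qh) I0 \<Psi> \<Psi>' \<beta> \<omega> y c\<^sub>2) \<and>
    (\<forall>L c\<^sub>2.
       lipschitz_const_dpsi X (dS qh) I0 \<Psi>' (sublevel X (dS qh) I0 \<Psi> \<beta> (\<omega> 1)) L \<and>
       insertion_bound X (dS qh) I0 \<Psi> \<Psi>' \<beta> \<omega> y c\<^sub>2 \<longrightarrow>
       (let r\<^sub>1 = real_of_ereal (residual X (dS qh) I0 \<Psi> \<beta> (\<omega> 1));
            M\<^sub>0 = M_init X (dS qh) I0 \<Psi> \<beta> (\<omega> 1);
            c\<^sub>1 = 2 * \<gamma> * (1 - \<alpha>) * r\<^sub>1;
            q = \<alpha> * min (c\<^sub>1 / (L * (M\<^sub>0 + c\<^sub>2)\<^sup>2)) 1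
        in \<forall>k\<ge>1. residual X (dS qh) I0 \<Psi> \<beta> (\<omega> k) \<le> ereal (r\<^sub>1 / (1 + q * (real k - 1)))))"
proof -
  have X: "compact X"
    using domain(3) obs(1,3) compact_eq_bounded_closed bounded_subset[OF bounded_closure] by blast
  have D: "continuous_on X (dS qh)" using state unfolding C1_state_map_def by blast
  interpret insertion_run X "dS qh" I0 \<Psi> \<Psi>' \<beta> \<alpha> \<gamma> \<omega> y
    by unfold_locales (use X obs(2) D params A1 A2 A3 A4 lip step_params gen in blast)+
  have rate: "let r\<^sub>1 = real_of_ereal (residual X (dS qh) I0 \<Psi> \<beta> (\<omega> 1));
            M\<^sub>0 = M_init X (dS qh) I0 \<Psi> \<beta> (\<omega> 1);
            c\<^sub>1 = 2 * \<gamma> * (1 - \<alpha>) * r\<^sub>1;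
            q = \<alpha> * min (c\<^sub>1 / (L * (M\<^sub>0 + c\<^sub>2)\<^sup>2)) 1
        in \<forall>k\<ge>1. residual X (dS qh) I0 \<Psi> \<beta> (\<omega> k) \<le> ereal (r\<^sub>1 / (1 + q * (real k - 1)))"
    if "lipschitz_const_dpsi X (dS qh) I0 \<Psi>' E\<^sub>1 L" "insertion_bound X (dS qh) I0 \<Psi> \<Psi>' \<beta> \<omega> y c\<^sub>2" for L c\<^sub>2
    unfolding Let_def residual_eq[OF order_refl] real_of_ereal.simps
  proof (intro allI impI)
    fix k :: nat assume "1 \<le> k"
    from residual_rate[OF that this refl]
    show "residual X (dS qh) I0 \<Psi> \<beta> (\<omega> k) \<le> ereal ((Fr (\<omega> 1) - inf_value) /
        (1 + \<alpha> * min (2 * \<gamma> * (1 - \<alpha>) * (Fr (\<omega> 1) - inf_value) / (L * (M\<^sub>0 + c\<^sub>2)\<^sup>2)) 1 * (real k - 1)))"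
      unfolding residual_eq[OF \<open>1 \<le> k\<close>] by simp
  qed
  show ?thesis
    using accumulation_point_exists accumulation_point_optimal dpsi_lipschitz_exists[OF start]
      insertion_bound_exists rate by blast
qed

end
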